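(* Let $\beta_q(t)=\frac{t^{\alpha_q-1}}{\Gamma(\alpha_q)}$ with $0<\alpha_q<1$, $q=1,2$, and let $c>0$. Let $u$ be the solution of $$u'(t)+\sum_{q=1}^2\int_0^t\beta_q(t-s)\mathbf B_qu(s)\,ds=f(t),\ t>0,\qquad u(0)=u_0,$$ and let $U^n$ be the solution of the Crank–Nicolson trapezoidal-convolution-quadrature scheme $$\delta_tU^n+\sum_{q=1}^2\mathcal Q^{(q)}_{n-1/2}(\mathbf B_qU)=f^{n-1/2},\quad n\ge1,\qquad U^0=u_0 .$$ Then, with a positive constant $\mathcal C$ independent of the time step $k$, $$\begin{aligned}\|U^n-u(t_n)\|_A\le\mathcal Ck\Bigg\{&e^{-\frac c2}\int_0^k\|u_{tt}(\zeta)\|d\zeta+k\sum_{n=2}^\infty e^{-\frac c2n}\int_{t_{n-1}}^{t_n}\|u_{ttt}(\zeta)\|d\zeta\\&+\sum_{q=1}^2\sum_{n=1}^\infty e^{-\frac c2n}\Big(k^2t_n^{\alpha_q-1}\|\mathbf B_qu_t(0)\|+k^{\alpha_q+1}\int_{t_{n-1}}^{t_n}\|\mathbf B_qu_{tt}(\zeta)\|d\zeta+k^2\int_0^{t_{n-1}}(t_n-\zeta)^{\alpha_q-1}\|\mathbf B_qu_{tt}(\zeta)\|d\zeta\Big)\Bigg\}.\end{aligned}$$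
   Context: $H$ is a real Hilbert space (such as $L^2(\Omega)$) with norm $\|\cdot\|$; $f:[0,\infty)\to H$. Each $\mathbf B_q$ is a positive self-adjoint linear operator on a dense subspace $\mathcal D(\mathbf B_q)\subset H$; all $U^n$ lie in $\mathcal D(\mathbf B_1)\cap\mathcal D(\mathbf B_2)$, and $u$ is regular enough for the quantities in the estimate to be defined. Notation: $k>0$ is the time step, $t_n=nk$, $f^n=f(t_n)$, $\delta_tv^n=(v^n-v^{n-1})/k$, $v^{n-\frac12}=\frac12(v^n+v^{n-1})$, and for a sequence $(v^n)_{n\ge0}$ in $H$, $\|v^n\|_A=\sqrt{\sum_{n=0}^\infty e^{-cn}\|v^n\|^2}$ (here $v^n=U^n-u(t_n)$, $v^0=0$). Trapezoidal convolution quadrature: the weights $\mu^{(q)}_m$ are given by $\left(\frac{2(1-\zeta)}{1+\zeta}\right)^{-\alpha_q}=\sum_{m=0}^\infty\mu^{(q)}_m\zeta^m$, and $$\mathcal Q^{(q)}_n(\varphi)=\kappa^{(q)}_{n,0}\varphi^0+k^{\alpha_q}\sum_{p=0}^n\mu^{(q)}_{n-p}\varphi^p,\qquad\kappa^{(q)}_{n,0}=(\beta_q*1)(t_n)-k^{\alpha_q}\sum_{p=0}^n\mu^{(q)}_{p}\quad(n\ge0),$$ $$\mathcal Q^{(q)}_{n-\frac12}(\varphi)=\tfrac12\big(\mathcal Q^{(q)}_n(\varphi)+\mathcal Q^{(q)}_{n-1}(\varphi)\big)\quad(n\ge1),$$ where $(\beta_q*1)(t)=\int_0^t\beta_q(s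)\,ds$.
   Formalization: It is additionally assumed that f is right-continuous at 0: the equation holds only for t>0 while the scheme uses f^0=f(0), so without this the estimate fails (u=0, f=0 for t>0, f(0)≠0 gives U^1≠0 and right side 0). *)

theory Defs
  imports "HOL-Analysis.Analysis"
begin

subsection \<open>Unbounded self-adjoint operators\<close>

text \<open>
  An unbounded operator on \<open>H\<close> is given by its domain \<open>D\<close> and a total function \<open>B\<close> whose
  values outside \<open>D\<close> are irrelevant.
\<close>

definition densely_defined_linear :: "'a::real_inner set \<Rightarrow> ('a \<Rightarrow> 'a) \<Rightarrow> bool" where
  "densely_defined_linear D B \<longleftrightarrow>
     subspace D \<and> closure D = UNIV \<and>
     (\<forall>x\<in>D. \<forall>y\<in>D. B (x + y) = B x + B y) \<and> (\<forall>r. \<forall>x\<in>D. B (r *\<^sub>R x) = r *\<^sub>R B x)"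

text \<open>
  The graph of the adjoint. It is a function because \<open>D\<close> is dense, so self-adjointness
  (equality of the two operators, including their domains) is equality of graphs.
\<close>

definition adjoint_graph :: "'a::real_inner set \<Rightarrow> ('a \<Rightarrow> 'a) \<Rightarrow> ('a \<times> 'a) set" where
  "adjoint_graph D B = {(y, z). \<forall>x\<in>D. B x \<bullet> y = x \<bullet> z}"

definition self_adjoint_op :: "'a::real_inner set \<Rightarrow> ('a \<Rightarrow> 'a) \<Rightarrow> bool" where
  "self_adjoint_op D B \<longleftrightarrow>
     densely_defined_linear D B \<and> adjoint_graph D B = {(x, B x) | x. x \<in> D}"

definition positive_op :: "'a::real_inner set \<Rightarrow> ('a \<Rightarrow> 'a) \<Rightarrow> bool" where
  "positive_op D B \<longleftrightarrow> (\<forall>x\<in>D. B x \<bullet> x \<ge> 0)"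

subsection \<open>The integro-differential equation\<close>

definition beta :: "real \<Rightarrow> real \<Rightarrow> real" where
  "beta \<alpha> t = t powr (\<alpha> - 1) / Gamma \<alpha>"

text \<open>
  Here \<open>ut\<close> is the derivative of \<open>u\<close>. The integral is the Henstock-Kurzweil one, which needs no
  separability of \<open>H\<close> and extends the Bochner integral.
\<close>

definition solves_equation ::
    "(nat \<Rightarrow> real) \<Rightarrow> (nat \<Rightarrow> 'a::real_inner set) \<Rightarrow> (nat \<Rightarrow> 'a \<Rightarrow> 'a) \<Rightarrow> (real \<Rightarrow> 'a) \<Rightarrow> 'a \<Rightarrow>
     (real \<Rightarrow> 'a) \<Rightarrow> (real \<Rightarrow> 'a) \<Rightarrow> bool" where
  "solves_equation \<alpha> D B f u0 u ut \<longleftrightarrow>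
     u 0 = u0 \<and>
     (\<forall>q\<in>{1..2}. \<forall>t\<ge>0. u t \<in> D q) \<and>
     (\<forall>t>0. \<forall>q\<in>{1..2}. (\<lambda>s. beta (\<alpha> q) (t - s) *\<^sub>R B q (u s)) integrable_on {0..t}) \<and>
     (\<forall>t>0. ut t + (\<Sum>q=1..2. integral {0..t} (\<lambda>s. beta (\<alpha> q) (t - s) *\<^sub>R B q (u s))) = f t)"

subsection \<open>Trapezoidal convolution quadrature\<close>

definition generates_trap_weights :: "real \<Rightarrow> (nat \<Rightarrow> real) \<Rightarrow> bool" where
  "generates_trap_weights \<alpha> \<mu> \<longleftrightarrow>
     (\<forall>\<zeta>::real. \<bar>\<zeta>\<bar> < 1 \<longrightarrow>
        (\<lambda>m. \<mu> m * \<zeta> ^ m) sums ((2 * (1 - \<zeta>) / (1 + \<zeta>)) powr (- \<alpha>)))"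

definition trap_weight :: "real \<Rightarrow> nat \<Rightarrow> real" where
  "trap_weight \<alpha> = (THE \<mu>. generates_trap_weights \<alpha> \<mu>)"

lemma powser_eq_imp_coeff_eq:
  fixes a b :: "nat \<Rightarrow> real"
  assumes "\<And>x. \<bar>x\<bar> < 1 \<Longrightarrow> (\<lambda>n. a n * x ^ n) sums g x"
    and "\<And>x. \<bar>x\<bar> < 1 \<Longrightarrow> (\<lambda>n. b n * x ^ n) sums g x"
  shows "a = b"
proof (rule ccontr)
  assume "a \<noteq> b"
  define d where "d n = a n - b n" for n
  have d0: "(\<lambda>n. d n * x ^ n) sums 0" if "\<bar>x\<bar> < 1" for x
    using sums_diff[OF assms(1)[OF that] assms(2)[OF that]] by (simp add: d_def algebra_simps)
  have ex: "\<exists>n. d n \<noteq> 0" using \<open>a \<noteq> b\<close> by (auto simp: d_def)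
  define m where "m = (LEAST n. d n \<noteq> 0)"
  have m: "d m \<noteq> 0" "\<And>n. n < m \<Longrightarrow> d n = 0"
    using LeastI_ex[OF ex] not_less_Least by (auto simp: m_def)
  have s: "(\<lambda>n. d (n + m) * x ^ n) sums 0" if "\<bar>x\<bar> < 1" "x \<noteq> 0" for x
  proof -
    have "(\<lambda>n. d (n + m) * x ^ (n + m)) sums 0"
      using d0[OF that(1)] m(2) by (subst sums_iff_shift) simp
    from sums_divide[OF this, of "x ^ m"] show ?thesis using that by (simp add: power_add)
  qed
  have "((\<lambda>_::real. 0::real) \<longlongrightarrow> d (0 + m)) (at 0)"
    by (rule powser_limit_0_strong[where a = "\<lambda>n. d (n + m)" and s = 1]) (use s in auto)
  then have "d m = 0" using LIM_unique[OF _ tendsto_const] by fastforce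
  with m(1) show False by simp
qed

lemma generates_trap_weights_ex1: "\<exists>!\<mu>. generates_trap_weights \<alpha> \<mu>"
proof (rule ex_ex1I)
  define p where "p n = 2 powr (-\<alpha>) * (\<alpha> gchoose n)" for n
  define r where "r n = ((-\<alpha>) gchoose n) * (-1) ^ n" for n
  define \<mu> where "\<mu> n = (\<Sum>i\<le>n. p i * r (n - i))" for n
  have P: "(\<lambda>n. p n * x ^ n) sums (2 powr (-\<alpha>) * (1 + x) powr \<alpha>)" if "\<bar>x\<bar> < 1" for x
    using sums_mult[OF gen_binomial_real[OF that, of \<alpha>], of "2 powr (-\<alpha>)"]
    by (simp add: p_def mult.assoc)
  have R: "(\<lambda>n. r n * x ^ n) sums ((1 - x) powr (-\<alpha>))" if "\<bar>x\<bar> < 1" for x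
    using gen_binomial_real[of "-x" "-\<alpha>"] that
    by (simp add: r_def power_minus[of x] mult.assoc)
  have "generates_trap_weights \<alpha> \<mu>"
    unfolding generates_trap_weights_def
  proof (intro allI impI)
    fix x :: real
    assume x: "\<bar>x\<bar> < 1"
    then obtain y where y: "\<bar>x\<bar> < y" "y < 1" using dense by blast
    then have y': "\<bar>y\<bar> < 1" "norm x < norm y" by auto
    have "(\<lambda>n. \<Sum>i\<le>n. (p i * x ^ i) * (r (n - i) * x ^ (n - i))) sums
        ((\<Sum>n. p n * x ^ n) * (\<Sum>n. r n * x ^ n))"
      by (rule Cauchy_product_sums; rule powser_insidea[OF _ y'(2)])
         (use P[OF y'(1)] R[OF y'(1)] in \<open>auto simp: sums_iff\<close>)
    moreover have "(\<Sum>i\<le>n. (p i * x ^ i) * (r (n - i) * x ^ (n - i))) = \<mu> n * x ^ n" for n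
      unfolding \<mu>_def sum_distrib_right
      by (rule sum.cong) (auto simp: power_add[symmetric] mult_ac)
    moreover have "(2 * (1 - x) / (1 + x)) powr (- \<alpha>) =
        2 powr (-\<alpha>) * (1 + x) powr \<alpha> * (1 - x) powr (-\<alpha>)"
    proof -
      have "(2 * (1 - x) / (1 + x)) powr (- \<alpha>) = (2 * (1 - x)) powr (-\<alpha>) / (1 + x) powr (-\<alpha>)"
        by (rule powr_divide)
      also have "(2 * (1 - x)) powr (-\<alpha>) = 2 powr (-\<alpha>) * (1 - x) powr (-\<alpha>)"
        by (rule powr_mult)
      finally show ?thesis by (simp only: powr_minus[of "1 + x"] divide_inverse inverse_inverse_eq mult_ac)
    qed
    ultimately show "(\<lambda>m. \<mu> m * x ^ m) sums ((2 * (1 - x) / (1 + x)) powr (- \<alpha>))"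
      using P[OF x] R[OF x] by (simp add: sums_iff)
  qed
  then show "\<exists>\<mu>. generates_trap_weights \<alpha> \<mu>" by blast
next
  fix \<mu> \<nu>
  assume "generates_trap_weights \<alpha> \<mu>" "generates_trap_weights \<alpha> \<nu>"
  then show "\<mu> = \<nu>"
    unfolding generates_trap_weights_def by (intro powser_eq_imp_coeff_eq) blast+
qed

lemma trap_weight_generates: "generates_trap_weights \<alpha> (trap_weight \<alpha>)"
  unfolding trap_weight_def by (rule theI'[OF generates_trap_weights_ex1])

definition kappa :: "real \<Rightarrow> real \<Rightarrow> nat \<Rightarrow> real" where
  "kappa \<alpha> k n =
     integral {0..real n * k} (beta \<alpha>) - k powr \<alpha> * (\<Sum>p=0..n. trap_weight \<alpha> p)"

definition cq :: "real \<Rightarrow> real \<Rightarrow> (nat \<Rightarrow> 'a::real_vector) \<Rightarrow> nat \<Rightarrow> 'a" where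
  "cq \<alpha> k \<phi> n =
     kappa \<alpha> k n *\<^sub>R \<phi> 0 + k powr \<alpha> *\<^sub>R (\<Sum>p=0..n. trap_weight \<alpha> (n - p) *\<^sub>R \<phi> p)"

text \<open>\<open>cq_half \<alpha> k \<phi> n\<close> is the quadrature at level \<open>n - 1/2\<close>, meant for \<open>n \<ge> 1\<close>.\<close>

definition cq_half :: "real \<Rightarrow> real \<Rightarrow> (nat \<Rightarrow> 'a::real_vector) \<Rightarrow> nat \<Rightarrow> 'a" where
  "cq_half \<alpha> k \<phi> n = (1/2) *\<^sub>R (cq \<alpha> k \<phi> n + cq \<alpha> k \<phi> (n - 1))"

subsection \<open>The Crank--Nicolson scheme\<close>

definition solves_scheme ::
    "(nat \<Rightarrow> real) \<Rightarrow> (nat \<Rightarrow> 'a::real_inner set) \<Rightarrow> (nat \<Rightarrow> 'a \<Rightarrow> 'a) \<Rightarrow> (real \<Rightarrow> 'a) \<Rightarrow> 'a \<Rightarrow>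
     real \<Rightarrow> (nat \<Rightarrow> 'a) \<Rightarrow> bool" where
  "solves_scheme \<alpha> D B f u0 k U \<longleftrightarrow>
     U 0 = u0 \<and>
     (\<forall>q\<in>{1..2}. \<forall>n. U n \<in> D q) \<and>
     (\<forall>n\<ge>1. (1/k) *\<^sub>R (U n - U (n - 1)) + (\<Sum>q=1..2. cq_half (\<alpha> q) k (\<lambda>p. B q (U p)) n) =
        (1/2) *\<^sub>R (f (real n * k) + f (real (n - 1) * k)))"

subsection \<open>Norm and bound\<close>

definition weighted_sq :: "real \<Rightarrow> (nat \<Rightarrow> 'a::real_normed_vector) \<Rightarrow> nat \<Rightarrow> real" where
  "weighted_sq c v n = exp (- c * real n) * (norm (v n))\<^sup>2"

definition norm_A :: "real \<Rightarrow> (nat \<Rightarrow> 'a::real_normed_vector) \<Rightarrow> real" where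
  "norm_A c v = sqrt (\<Sum>\<^sub>\<infinity>n. weighted_sq c v n)"

definition time_term :: "real \<Rightarrow> real \<Rightarrow> (real \<Rightarrow> 'a::real_normed_vector) \<Rightarrow> nat \<Rightarrow> real" where
  "time_term c k uttt n =
     exp (- (c/2) * real n) * integral {real (n - 1) * k..real n * k} (\<lambda>\<zeta>. norm (uttt \<zeta>))"

definition quad_term ::
    "real \<Rightarrow> real \<Rightarrow> real \<Rightarrow> ('a::real_normed_vector \<Rightarrow> 'a) \<Rightarrow> (real \<Rightarrow> 'a) \<Rightarrow> (real \<Rightarrow> 'a) \<Rightarrow>
     nat \<Rightarrow> real" where
  "quad_term c \<alpha> k B ut utt n =
     exp (- (c/2) * real n) *
     (k\<^sup>2 * (real n * k) powr (\<alpha> - 1) * norm (B (ut 0))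
      + k powr (\<alpha> + 1) * integral {real (n - 1) * k..real n * k} (\<lambda>\<zeta>. norm (B (utt \<zeta>)))
      + k\<^sup>2 * integral {0..real (n - 1) * k}
                (\<lambda>\<zeta>. (real n * k - \<zeta>) powr (\<alpha> - 1) * norm (B (utt \<zeta>))))"

text \<open>
  The regularity needed for the quantities above to be defined: \<open>ut\<close>, \<open>utt\<close>, \<open>uttt\<close> are the
  successive derivatives of \<open>u\<close>, one-sided at \<open>0\<close> for \<open>ut\<close>. The derivatives \<open>utt\<close> and \<open>uttt\<close> are
  only required away from \<open>0\<close>, since solutions are in general weakly singular there;
  accordingly \<open>uttt\<close> need not be integrable up to \<open>0\<close>. Integrability of the norms times the
  kernel in \<open>quad_term\<close> follows, as the kernel is monotone and bounded there.
\<close>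

definition regular_solution ::
    "(nat \<Rightarrow> 'a::real_inner set) \<Rightarrow> (nat \<Rightarrow> 'a \<Rightarrow> 'a) \<Rightarrow> (real \<Rightarrow> 'a) \<Rightarrow> (real \<Rightarrow> 'a) \<Rightarrow>
     (real \<Rightarrow> 'a) \<Rightarrow> (real \<Rightarrow> 'a) \<Rightarrow> bool" where
  "regular_solution D B u ut utt uttt \<longleftrightarrow>
     (\<forall>t\<ge>0. (u has_vector_derivative ut t) (at t within {0..})) \<and>
     (\<forall>t>0. (ut has_vector_derivative utt t) (at t)) \<and>
     (\<forall>t>0. (utt has_vector_derivative uttt t) (at t)) \<and>
     (\<forall>q\<in>{1..2}. ut 0 \<in> D q \<and> (\<forall>t>0. utt t \<in> D q)) \<and>
     (\<forall>T>0. (\<lambda>\<zeta>. norm (utt \<zeta>)) integrable_on {0..T}) \<and>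
     (\<forall>a b. 0 < a \<and> a < b \<longrightarrow> (\<lambda>\<zeta>. norm (uttt \<zeta>)) integrable_on {a..b}) \<and>
     (\<forall>q\<in>{1..2}. \<forall>T>0. (\<lambda>\<zeta>. norm (B q (utt \<zeta>))) integrable_on {0..T})"

end

theory Submission
  imports Defs "HOL-Real_Asymp.Real_Asymp"
begin

text \<open>
  The error \<open>e\<^sub>n = U\<^sub>n - u(t\<^sub>n)\<close> satisfies the scheme with the consistency error as right-hand side.
  Testing with \<open>(e\<^sub>n + e\<^sub>n\<^sub>-\<^sub>1)/2\<close> and weighting by \<open>exp (-c n)\<close>, the difference quotients control the
  weighted norm after summation by parts, while the convolution terms are nonnegative, because the
  generating function \<open>((1 + \<zeta>)/(2(1 - \<zeta>)))\<^sup>\<alpha>\<close> of the weights has nonnegative real part in the unit disc.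

  The quadrature error has a Peano kernel whose size is governed by the uncorrected rule at \<open>t\<^sub>n\<close>
  applied to \<open>t \<mapsto> t\<close>. In units of the step this error is \<open>O(n\<^sup>\<alpha>\<^sup>-\<^sup>1)\<close>: the singularity of the generating function
  at \<open>\<zeta> = 1\<close> reproduces the exact value up to that order, and the one at \<open>\<zeta> = -1\<close> contributes less.
\<close>

subsection \<open>Alternating tails of the binomial series\<close>

text \<open>The weight drops by exp(-c) per step whatever k is, so summation by parts produces 1 -
  exp(-c) times the squared norm; the difference quotient contributes 1/k, hence the factor k.
  Testing leaves one power of the norm against a weighted l1 sum of residuals, which explains why
  plain sums with exp(-c n/2) stand on the right. The rate n^(\<alpha> - 1) requires cancellation of
  the n^\<alpha> terms, hence a second-order expansion of a Gamma ratio. The point \<zeta> = -1 is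
  controlled by alternation: the coefficients of (1 + \<zeta>)^\<alpha> alternate with convex
  magnitudes, a structure that survives two divisions by 1 - \<zeta>. Weak regularity at t = 0
  shapes the rest. The equation is posed for t > 0 while the first step uses f(0), so f(0) = u_t(0)
  is obtained as a limit, continuity of u_t at 0 is derived, and the first cell is estimated through
  u_tt only. The corrected rule is exact on constants, and since the error starts at 0 its
  correction term disappears from the stability form.\<close>

lemma alternating_suminf_bounds:
  fixes b :: "nat \<Rightarrow> real"
  assumes "b \<longlonglongrightarrow> 0" and "\<And>n. b (Suc n) \<le> b n"
  shows "0 \<le> (\<Sum>i. (-1)^i * b i)" and "(\<Sum>i. (-1)^i * b i) \<le> b 0"
proof -
  have nn: "0 \<le> b n" for n
    using assms by (intro decseq_ge) (auto simp: decseq_Suc_iff)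
  show "0 \<le> (\<Sum>i. (-1)^i * b i)"
    using summable_Leibniz'(2)[OF assms(1) nn assms(2), of 0] by simp
  show "(\<Sum>i. (-1)^i * b i) \<le> b 0"
    using summable_Leibniz'(4)[OF assms(1) nn assms(2), of 0] by simp
qed

text \<open>The tail from j of the alternating series of \<open>b\<close>, divided by the sign of
  its first term, so that Leibniz bounds apply for either parity of j.\<close>

definition alt_tail :: "(nat \<Rightarrow> real) \<Rightarrow> nat \<Rightarrow> real" where
  "alt_tail b j = (\<Sum>i. (-1)^i * b (i + j))"

lemma alt_tail_bounds:
  assumes "b \<longlonglongrightarrow> 0" and "\<And>n. b (Suc n) \<le> b n"
  shows "0 \<le> alt_tail b j" and "alt_tail b j \<le> b j"
  using alternating_suminf_bounds[of "\<lambda>i. b (i + j)"] LIMSEQ_ignore_initial_segment[OF assms(1)] assms(2)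
  unfolding alt_tail_def by auto

text \<open>Convexity makes the first differences of \<open>b\<close> decrease, so the difference of
  two consecutive tails is again an alternating Leibniz series. Thus the tails can themselves be
  summed with alternating signs.\<close>

lemma alt_tail_decreasing:
  assumes lim: "b \<longlonglongrightarrow> 0" and dec: "\<And>n. b (Suc n) \<le> b n"
    and convex: "\<And>n. 2 * b (Suc n) \<le> b n + b (Suc (Suc n))"
  shows "alt_tail b (Suc j) \<le> alt_tail b j"
proof -
  have nn: "0 \<le> b n" for n
    using lim dec by (intro decseq_ge) (auto simp: decseq_Suc_iff)
  have sm: "summable (\<lambda>i. (-1)^i * b (i + m))" for m
    using LIMSEQ_ignore_initial_segment[OF lim] nn dec by (intro summable_Leibniz'(1)) auto
  have lim_diff: "(\<lambda>i. b (i + j) - b (i + Suc j)) \<longlonglongrightarrow> 0"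
    using tendsto_diff[OF LIMSEQ_ignore_initial_segment[OF lim, of j] LIMSEQ_ignore_initial_segment[OF lim, of "Suc j"]]
    by simp
  have dec_diff: "b (Suc i + j) - b (Suc i + Suc j) \<le> b (i + j) - b (i + Suc j)" for i
    using convex[of "i + j"] by simp
  have "0 \<le> (\<Sum>i. (-1)^i * (b (i + j) - b (i + Suc j)))"
    by (rule alternating_suminf_bounds(1)[OF lim_diff dec_diff])
  also have "\<dots> = alt_tail b j - alt_tail b (Suc j)"
    unfolding alt_tail_def right_diff_distrib by (rule suminf_diff[symmetric]) (rule sm)+
  finally show ?thesis by simp
qed

lemma alternating_tail_sum:
  "(\<Sum>i. (-1) ^ (i + j) * b (i + j)) = (-1) ^ j * alt_tail b j"
  if "summable (\<lambda>i. \<bar>b i\<bar>)"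
proof -
  have "summable (\<lambda>i. (-1)^i * b (i + j))"
    using summable_ignore_initial_segment[OF that, of j]
    by - (rule summable_rabs_cancel, simp add: abs_mult)
  from suminf_mult[OF this, of "(-1)^j"] show ?thesis
    by (simp add: alt_tail_def power_add mult_ac)
qed

text \<open>Abel's limit in the absolutely convergent case, by the M-test. It evaluates at 1 series
  whose closed form is available only for |x| < 1.\<close>

lemma abs_summable_power_limit:
  fixes f :: "nat \<Rightarrow> real"
  assumes "summable (\<lambda>n. \<bar>f n\<bar>)"
  shows "((\<lambda>x. \<Sum>n. f n * x ^ n) \<longlongrightarrow> (\<Sum>n. f n)) (at_left 1)"
proof -
  have u: "uniform_limit {0..1} (\<lambda>n x. \<Sum>i<n. f i * x ^ i) (\<lambda>x. \<Sum>i. f i * x ^ i) sequentially"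
    by (rule Weierstrass_m_test[OF _ assms])
       (auto simp: abs_mult intro!: mult_left_le power_le_one)
  have "continuous_on {0..1} (\<lambda>x. \<Sum>i. f i * x ^ i)"
    by (rule uniform_limit_theorem[OF _ u]) (auto intro!: always_eventually continuous_intros)
  then have "((\<lambda>x. \<Sum>i. f i * x ^ i) \<longlongrightarrow> (\<Sum>i. f i * 1 ^ i)) (at 1 within {0..1})"
    unfolding continuous_on_def by (rule bspec) auto
  moreover have "at (1::real) within {0..1} = at_left 1"
    by (rule at_within_nhd[of _ "{0<..<2}"]) auto
  ultimately show ?thesis by simp
qed

text \<open>Coefficients of 2^(-\<alpha>) (1 + \<zeta>)^\<alpha>, scaled so that the function equals
  1 at \<zeta> = 1.\<close>

definition half_binom :: "real \<Rightarrow> nat \<Rightarrow> real" where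
  "half_binom \<alpha> n = 2 powr (-\<alpha>) * (\<alpha> gchoose n)"

text \<open>Coefficients of (1 - \<zeta>)^(-c); the Pochhammer form shows their positivity for c >
  0.\<close>

definition neg_binom :: "real \<Rightarrow> nat \<Rightarrow> real" where
  "neg_binom c n = pochhammer c n / fact n"

lemma neg_binom_0 [simp]: "neg_binom c 0 = 1"
  by (simp add: neg_binom_def)

lemma neg_binom_Suc: "neg_binom c (Suc n) = neg_binom c n * ((c + n) / (Suc n))"
  by (simp add: neg_binom_def pochhammer_Suc field_simps)

lemma neg_binom_pos: "0 < c \<Longrightarrow> 0 < neg_binom c n"
  by (simp add: neg_binom_def pochhammer_pos)

text \<open>Coefficient form of (1 - \<zeta>) (1 - \<zeta>)^(-(c + 1)) = (1 - \<zeta>)^(-c).\<close>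

lemma neg_binom_diff: "neg_binom (c + 1) (Suc n) - neg_binom (c + 1) n = neg_binom c (Suc n)"
proof -
  have "c * pochhammer (c + 1) n = pochhammer c n * (c + n)"
    by (metis pochhammer_Suc pochhammer_rec)
  then have "c * neg_binom (c + 1) n = neg_binom c n * (c + n)"
    by (simp add: neg_binom_def)
  moreover have "neg_binom (c + 1) (Suc n) - neg_binom (c + 1) n = c * neg_binom (c + 1) n / Suc n"
    by (simp add: neg_binom_Suc divide_simps) (simp add: algebra_simps)
  ultimately show ?thesis by (simp add: neg_binom_Suc)
qed

lemma gbinomial_neg_binom: "(a gchoose n) = (-1) ^ n * neg_binom (-a) n"
  by (simp add: gbinomial_pochhammer neg_binom_def)

text \<open>The absolute values of the coefficients of \<open>2\<^sup>-\<^sup>\<alpha> (1 + \<zeta>)\<^sup>\<alpha>\<close> beyond the constant one.\<close>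

definition binom_mag :: "real \<Rightarrow> nat \<Rightarrow> real" where
  "binom_mag \<alpha> j = 2 powr (-\<alpha>) * \<alpha> * neg_binom (1 - \<alpha>) j / (Suc j)"

lemma half_binom_Suc: "half_binom \<alpha> (Suc j) = (-1) ^ j * binom_mag \<alpha> j"
proof -
  have "neg_binom (-\<alpha>) (Suc j) = - \<alpha> * neg_binom (1 - \<alpha>) j / (Suc j)"
    by (simp add: neg_binom_def pochhammer_rec field_simps)
  then show ?thesis by (simp add: half_binom_def gbinomial_neg_binom binom_mag_def)
qed

section \<open>Binomial magnitudes: summability, convexity and iterated tails\<close>

context
  fixes \<alpha> :: real
  assumes \<alpha>: "0 < \<alpha>" "\<alpha> < 1"
begin

lemma half_powr_le_1: "2 powr (-\<alpha>) \<le> 1"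
  using powr_mono[of "-\<alpha>" 0 2] \<alpha> by simp

lemma neg_binom_le_1: "neg_binom (1 - \<alpha>) j \<le> 1"
proof (induction j)
  case (Suc j)
  then show ?case
    using \<alpha> neg_binom_pos[of "1 - \<alpha>" j]
    unfolding neg_binom_Suc by (intro mult_le_one) auto
qed simp

lemma binom_mag_nonneg: "0 \<le> binom_mag \<alpha> j"
  using \<alpha> neg_binom_pos[of "1 - \<alpha>" j] by (simp add: binom_mag_def)

lemma binom_mag_Suc: "binom_mag \<alpha> (Suc j) = binom_mag \<alpha> j * ((j + 1 - \<alpha>) / (j + 2))"
  by (simp add: binom_mag_def neg_binom_Suc field_simps)

lemma binom_mag_le: "binom_mag \<alpha> j \<le> 1 / (Suc j)"
proof -
  have "2 powr (-\<alpha>) * \<alpha> * neg_binom (1 - \<alpha>) j \<le> 1"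
    using \<alpha> neg_binom_le_1[of j] half_powr_le_1 neg_binom_pos[of "1 - \<alpha>" j]
    by (intro mult_le_one) auto
  then show ?thesis unfolding binom_mag_def by (intro divide_right_mono) auto
qed

text \<open>Up to sign and scaling these are coefficients of (1 - \<zeta>)^\<alpha> = (1 - \<zeta>)
  (1 - \<zeta>)^(\<alpha> - 1), hence differences. Telescoping bounds all partial sums by 1.\<close>

lemma binom_mag_telescope:
  "binom_mag \<alpha> j = 2 powr (-\<alpha>) * (neg_binom (1 - \<alpha>) j - neg_binom (1 - \<alpha>) (Suc j))"
  by (simp add: binom_mag_def neg_binom_Suc field_simps)

lemma binom_mag_sum_le: "(\<Sum>j<n. binom_mag \<alpha> j) \<le> 1"
proof -
  have "(\<Sum>j<n. binom_mag \<alpha> j) = 2 powr (-\<alpha>) * (1 - neg_binom (1 - \<alpha>) n)"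
    by (simp add: binom_mag_telescope sum_distrib_left[symmetric] sum_lessThan_telescope')
  also have "\<dots> \<le> 1"
    using half_powr_le_1 \<alpha> neg_binom_pos[of "1 - \<alpha>" n] neg_binom_le_1[of n] by (intro mult_le_one) auto
  finally show ?thesis .
qed

lemma binom_mag_summable: "summable (binom_mag \<alpha>)"
  by (rule summableI_nonneg_bounded[OF binom_mag_nonneg binom_mag_sum_le])

lemma binom_mag_decreasing: "binom_mag \<alpha> (Suc j) \<le> binom_mag \<alpha> j"
  unfolding binom_mag_Suc using \<alpha> binom_mag_nonneg[of j] by (intro mult_left_le) auto

lemma binom_mag_convex: "2 * binom_mag \<alpha> (Suc j) \<le> binom_mag \<alpha> j + binom_mag \<alpha> (Suc (Suc j))"
proof -
  define x :: real where "x = j"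
  have "binom_mag \<alpha> j + binom_mag \<alpha> (Suc (Suc j)) - 2 * binom_mag \<alpha> (Suc j)
      = binom_mag \<alpha> j * (1 + (x + 1 - \<alpha>) / (x + 2) * ((x + 2 - \<alpha>) / (x + 3)) - 2 * ((x + 1 - \<alpha>) / (x + 2)))"
    unfolding binom_mag_Suc x_def of_nat_Suc distrib_left right_diff_distrib by (simp add: add_ac mult_ac)
  also have "1 + (x + 1 - \<alpha>) / (x + 2) * ((x + 2 - \<alpha>) / (x + 3)) - 2 * ((x + 1 - \<alpha>) / (x + 2))
      = (1 + \<alpha>) * (2 + \<alpha>) / ((x + 2) * (x + 3))"
    using x_def by (simp add: divide_simps) (simp add: algebra_simps)
  also have "binom_mag \<alpha> j * \<dots> \<ge> 0"
    using \<alpha> binom_mag_nonneg[of j] x_def by auto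
  finally show ?thesis by simp
qed

lemma binom_mag_tendsto_0: "binom_mag \<alpha> \<longlonglongrightarrow> 0"
  by (rule summable_LIMSEQ_zero[OF binom_mag_summable])

lemma half_binom_summable: "summable (\<lambda>n. \<bar>half_binom \<alpha> n\<bar>)"
  by (subst summable_Suc_iff[symmetric])
     (simp add: half_binom_Suc abs_mult binom_mag_nonneg binom_mag_summable)

abbreviation (input) "tail1 \<equiv> alt_tail (binom_mag \<alpha>)"

lemma tail1_facts:
  "0 \<le> tail1 j" "tail1 j \<le> binom_mag \<alpha> j" "tail1 (Suc j) \<le> tail1 j" "summable tail1"
proof -
  show a: "0 \<le> tail1 j" "tail1 j \<le> binom_mag \<alpha> j" for j
    using alt_tail_bounds[OF binom_mag_tendsto_0 binom_mag_decreasing] by auto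
  show "tail1 (Suc j) \<le> tail1 j"
    by (rule alt_tail_decreasing[OF binom_mag_tendsto_0 binom_mag_decreasing binom_mag_convex])
  show "summable tail1"
    by (rule summable_comparison_test'[OF binom_mag_summable, of 0]) (use a in auto)
qed

lemma tail2_bounds: "0 \<le> alt_tail tail1 j" "alt_tail tail1 j \<le> binom_mag \<alpha> j"
proof -
  have l: "tail1 \<longlonglongrightarrow> 0" by (rule summable_LIMSEQ_zero[OF tail1_facts(4)])
  show "0 \<le> alt_tail tail1 j" using alt_tail_bounds(1)[of tail1 j] l tail1_facts(3) by blast
  show "alt_tail tail1 j \<le> binom_mag \<alpha> j"
    using alt_tail_bounds(2)[of tail1 j] l tail1_facts(3) tail1_facts(2)[of j] by force
qed

text \<open>Dividing A(1) - A by 1 - \<zeta> gives a series whose coefficients are the tails of A;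
  these are the coefficients of two such divisions in succession. The definitions display sign and
  magnitude, \<open>tail_once_eq\<close> and \<open>tail_twice_eq\<close> identify them as
  tails.\<close>

definition "tail_once j = (-1) ^ j * tail1 j" for j :: nat
definition "tail_twice j = (-1) ^ Suc j * alt_tail tail1 (Suc j)" for j :: nat

lemma tail_once_eq: "tail_once j = (\<Sum>i. half_binom \<alpha> (i + Suc j))"
  unfolding tail_once_def add_Suc_right half_binom_Suc
  by (rule alternating_tail_sum[symmetric]) (simp add: binom_mag_nonneg binom_mag_summable)

lemma tail_twice_eq: "tail_twice j = (\<Sum>i. tail_once (i + Suc j))"
  unfolding tail_once_def tail_twice_def
  by (rule alternating_tail_sum[symmetric]) (simp add: tail1_facts(1,4))

lemma tail_once_summable: "summable (\<lambda>n. \<bar>tail_once n\<bar>)"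
  by (simp add: tail_once_def abs_mult tail1_facts(1,4))

lemma half_binom_sums: "\<bar>x\<bar> < 1 \<Longrightarrow> (\<lambda>n. half_binom \<alpha> n * x ^ n) sums (2 powr (-\<alpha>) * (1 + x) powr \<alpha>)"
  using sums_mult[OF gen_binomial_real[of x \<alpha>], of "2 powr (-\<alpha>)"]
  by (simp add: half_binom_def mult.assoc)

lemma half_binom_suminf: "(\<Sum>n. half_binom \<alpha> n) = 1"
proof -
  have ev: "\<forall>\<^sub>F x in at_left 1. (\<Sum>n. half_binom \<alpha> n * x ^ n) = 2 powr (-\<alpha>) * (1 + x) powr \<alpha>"
    unfolding eventually_at_left_field
    by (rule exI[of _ 0]) (auto intro!: sums_unique[symmetric] half_binom_sums)
  have "((\<lambda>x. 2 powr (-\<alpha>) * (1 + x) powr \<alpha>) \<longlongrightarrow> 2 powr (-\<alpha>) * (1 + 1) powr \<alpha>) (at_left (1::real))"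
    by (intro tendsto_intros) auto
  then have "((\<lambda>x. \<Sum>n. half_binom \<alpha> n * x ^ n) \<longlongrightarrow> 1) (at_left 1)"
    using ev by (subst tendsto_cong[OF ev]) (simp add: powr_minus)
  then show ?thesis
    by (rule tendsto_unique[OF trivial_limit_at_left_real abs_summable_power_limit[OF half_binom_summable]])
qed

lemma tail_once_diff: "tail_once (Suc j) - tail_once j = - half_binom \<alpha> (Suc j)"
  and tail_once_0: "tail_once 0 = 1 - half_binom \<alpha> 0"
proof -
  have s: "summable (\<lambda>i. half_binom \<alpha> (i + m))" for m
    by (rule summable_ignore_initial_segment[OF summable_rabs_cancel[OF half_binom_summable]])
  show "tail_once (Suc j) - tail_once j = - half_binom \<alpha> (Suc j)"
    using suminf_split_head[OF s[of "Suc j"]] by (simp add: tail_once_eq)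
  show "tail_once 0 = 1 - half_binom \<alpha> 0"
    using suminf_split_head[OF s[of 0]] by (simp add: tail_once_eq half_binom_suminf)
qed

lemma tail_once_power_sum:
  assumes "\<bar>x\<bar> < 1"
  shows "(1 - x) * (\<Sum>n. tail_once n * x ^ n) = 1 - 2 powr (-\<alpha>) * (1 + x) powr \<alpha>"
proof -
  have sm: "summable (\<lambda>n. tail_once n * x ^ n)"
    by (rule summable_comparison_test'[OF tail_once_summable, of 0])
       (use assms in \<open>auto simp: abs_mult power_abs intro!: mult_left_le power_le_one\<close>)
  have "(\<Sum>n. tail_once n * x ^ n) = tail_once 0 + (\<Sum>n. tail_once (Suc n) * x ^ Suc n)"
    using suminf_split_head[OF sm] by simp
  moreover have "x * (\<Sum>n. tail_once n * x ^ n) = (\<Sum>n. tail_once n * x ^ Suc n)"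
    by (subst suminf_mult[OF sm, symmetric]) (simp add: mult_ac)
  moreover have "(\<Sum>n. tail_once (Suc n) * x ^ Suc n) - (\<Sum>n. tail_once n * x ^ Suc n)
      = (\<Sum>n. - half_binom \<alpha> (Suc n) * x ^ Suc n)"
    using summable_mult[OF sm, of x] sm summable_Suc_iff[of "\<lambda>n. tail_once n * x ^ n"]
    by (subst suminf_diff) (auto simp: tail_once_diff[symmetric] algebra_simps)
  moreover have "(\<Sum>n. - half_binom \<alpha> (Suc n) * x ^ Suc n) = half_binom \<alpha> 0 - 2 powr (-\<alpha>) * (1 + x) powr \<alpha>"
    using half_binom_sums[OF assms] suminf_split_head[of "\<lambda>n. half_binom \<alpha> n * x ^ n"]
      summable_Suc_iff[of "\<lambda>n. half_binom \<alpha> n * x ^ n"]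
      suminf_minus[of "\<lambda>n. half_binom \<alpha> (Suc n) * x ^ Suc n"]
    by (simp add: sums_iff)
  ultimately show ?thesis by (simp add: tail_once_0 algebra_simps)
qed

text \<open>Since h(1) = 1, the generating function (1 - h(x)) / (1 - x) of the tails is the
  difference quotient at 1 of h(x) = 2^(-\<alpha>) (1 + x)^\<alpha>. Its Abel limit is h'(1) =
  \<alpha> / 2.\<close>

lemma tail_once_suminf: "(\<Sum>n. tail_once n) = \<alpha> / 2"
proof -
  define h where "h x = 2 powr (-\<alpha>) * (1 + x) powr \<alpha>" for x :: real
  have "(h has_field_derivative 2 powr (-\<alpha>) * (\<alpha> * 2 powr (\<alpha> - 1))) (at 1)"
    unfolding h_def by (auto intro!: derivative_eq_intros)
  moreover have "2 powr (-\<alpha>) * (\<alpha> * 2 powr (\<alpha> - 1)) = \<alpha> / 2"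
    by (simp add: powr_diff powr_minus)
  ultimately have "((\<lambda>x. (h x - h 1) / (x - 1)) \<longlongrightarrow> \<alpha> / 2) (at 1)"
    by (simp add: has_field_derivative_iff)
  then have lim: "((\<lambda>x. (h x - h 1) / (x - 1)) \<longlongrightarrow> \<alpha> / 2) (at_left 1)"
    by (rule filterlim_mono) (auto simp: at_le)
  have h1: "h 1 = 1" by (simp add: h_def powr_minus)
  have ev: "\<forall>\<^sub>F x in at_left 1. (\<Sum>n. tail_once n * x ^ n) = (h x - h 1) / (x - 1)"
    unfolding eventually_at_left_field
  proof (intro exI[of _ 0] conjI allI impI)
    fix y :: real
    assume "0 < y" "y < 1"
    then have "(1 - y) * (\<Sum>n. tail_once n * y ^ n) = h 1 - h y"
      using tail_once_power_sum[of y] by (simp add: h1) (simp add: h_def)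
    with \<open>y < 1\<close> show "(\<Sum>n. tail_once n * y ^ n) = (h y - h 1) / (y - 1)"
      by (simp add: divide_simps) (simp add: algebra_simps)
  qed simp
  have "((\<lambda>x. \<Sum>n. tail_once n * x ^ n) \<longlongrightarrow> \<alpha> / 2) (at_left 1)"
    using lim by (subst tendsto_cong[OF ev])
  then show ?thesis
    by (rule tendsto_unique[OF trivial_limit_at_left_real abs_summable_power_limit[OF tail_once_summable]])
qed

lemma tail_twice_diff: "tail_twice (Suc j) - tail_twice j = - tail_once (Suc j)"
  and tail_twice_0: "tail_twice 0 = \<alpha> / 2 - tail_once 0"
proof -
  have s: "summable (\<lambda>i. tail_once (i + m))" for m
    by (rule summable_ignore_initial_segment[OF summable_rabs_cancel[OF tail_once_summable]])
  show "tail_twice (Suc j) - tail_twice j = - tail_once (Suc j)"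
    using suminf_split_head[OF s[of "Suc j"]] by (simp add: tail_twice_eq)
  show "tail_twice 0 = \<alpha> / 2 - tail_once 0"
    using suminf_split_head[OF s[of 0]] by (simp add: tail_twice_eq tail_once_suminf)
qed

lemma tail_twice_le: "\<bar>tail_twice j\<bar> \<le> binom_mag \<alpha> j"
  using tail2_bounds[of "Suc j"] binom_mag_decreasing[of j]
  by (simp add: tail_twice_def abs_mult)

end

subsection \<open>Moments of the weights\<close>

unbundle no vec_syntax and fps_syntax

lemma of_real_gbinomial: "of_real (a gchoose n) = (of_real a gchoose n :: 'a::{real_div_algebra, field_char_0})"
  by (simp add: gbinomial_prod_rev)

text \<open>The symbol is a Cauchy product of two binomial series, one for each of the singular
  points -1 and 1. The complex version serves the positivity argument, which evaluates the symbol on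
  circles inside the disc.\<close>

lemma trap_generating_complex:
  fixes z :: complex
  assumes "norm z < 1"
  shows "(\<lambda>n. of_real (\<Sum>i\<le>n. half_binom \<alpha> i * neg_binom \<alpha> (n - i)) * z ^ n) sums
    (of_real (2 powr (-\<alpha>)) * (1 + z) powr of_real \<alpha> * (1 - z) powr (- of_real \<alpha>))"
proof -
  have P: "(\<lambda>n. of_real (half_binom \<alpha> n) * z ^ n) sums (of_real (2 powr (-\<alpha>)) * (1 + z) powr of_real \<alpha>)"
    if "norm z < 1" for z :: complex
    using sums_mult[OF gen_binomial_complex[OF that, of "of_real \<alpha>"], of "of_real (2 powr (-\<alpha>))"]
    by (simp add: half_binom_def mult.assoc flip: of_real_gbinomial)
  have R: "(\<lambda>n. of_real (neg_binom \<alpha> n) * z ^ n) sums ((1 - z) powr (- of_real \<alpha>))"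
    if "norm z < 1" for z :: complex
  proof -
    have "(of_real (-\<alpha>) gchoose n) * (- z) ^ n = of_real (neg_binom \<alpha> n) * z ^ n" for n
    proof -
      have "(of_real (-\<alpha>) gchoose n :: complex) = of_real ((-1) ^ n * neg_binom \<alpha> n)"
        using gbinomial_neg_binom[of "-\<alpha>" n] by (metis minus_minus of_real_gbinomial)
      then show ?thesis by (simp add: power_minus[of z])
    qed
    then show ?thesis using gen_binomial_complex[of "-z" "of_real (-\<alpha>)"] that by simp
  qed
  \<comment> \<open>Convergence at a larger radius makes both series absolutely convergent at
    \<open>z\<close>, as the Cauchy product requires.\<close>
  obtain y where y: "norm z < y" "y < 1" using assms dense by blast
  then have y': "norm (of_real y :: complex) < 1" "norm z < norm (of_real y :: complex)"
    using order.strict_trans1[OF norm_ge_zero y(1)] by auto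
  have "(\<lambda>n. \<Sum>i\<le>n. (of_real (half_binom \<alpha> i) * z ^ i) * (of_real (neg_binom \<alpha> (n - i)) * z ^ (n - i))) sums
      ((\<Sum>n. of_real (half_binom \<alpha> n) * z ^ n) * (\<Sum>n. of_real (neg_binom \<alpha> n) * z ^ n))"
    by (rule Cauchy_product_sums; rule powser_insidea[OF _ y'(2)])
       (use P[OF y'(1)] R[OF y'(1)] in \<open>auto simp: sums_iff\<close>)
  moreover have "(\<Sum>i\<le>n. (of_real (half_binom \<alpha> i) * z ^ i) * (of_real (neg_binom \<alpha> (n - i)) * z ^ (n - i)))
      = of_real (\<Sum>i\<le>n. half_binom \<alpha> i * neg_binom \<alpha> (n - i)) * z ^ n" for n
    unfolding of_real_sum sum_distrib_right
    by (rule sum.cong) (auto simp: power_add[symmetric] mult_ac)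
  ultimately show ?thesis using P[OF assms] R[OF assms] by (simp add: sums_iff)
qed

lemma trap_weight_eq: "trap_weight \<alpha> n = (\<Sum>i\<le>n. half_binom \<alpha> i * neg_binom \<alpha> (n - i))"
proof -
  have "generates_trap_weights \<alpha> (\<lambda>n. \<Sum>i\<le>n. half_binom \<alpha> i * neg_binom \<alpha> (n - i))"
    unfolding generates_trap_weights_def
  proof (intro allI impI)
    fix x :: real
    assume x: "\<bar>x\<bar> < 1"
    have "complex_of_real (2 powr (-\<alpha>)) * (1 + of_real x) powr of_real \<alpha> * (1 - of_real x) powr (- of_real \<alpha>)
        = of_real (2 powr (-\<alpha>) * (1 + x) powr \<alpha> * (1 - x) powr (-\<alpha>))"
      using x powr_of_real[of "1 + x" \<alpha>] powr_of_real[of "1 - x" "-\<alpha>"] by simp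
    also have "2 powr (-\<alpha>) * (1 + x) powr \<alpha> * (1 - x) powr (-\<alpha>) = (2 * (1 - x) / (1 + x)) powr (- \<alpha>)"
      unfolding powr_divide powr_mult[of 2 "1 - x"] by (simp add: powr_minus[of "1 + x"] divide_inverse mult_ac)
    finally have eq: "complex_of_real (2 powr (-\<alpha>)) * (1 + of_real x) powr of_real \<alpha> * (1 - of_real x) powr (- of_real \<alpha>)
        = of_real ((2 * (1 - x) / (1 + x)) powr (- \<alpha>))" .
    have "(\<lambda>n. complex_of_real ((\<Sum>i\<le>n. half_binom \<alpha> i * neg_binom \<alpha> (n - i)) * x ^ n)) sums
        of_real ((2 * (1 - x) / (1 + x)) powr (- \<alpha>))"
      using trap_generating_complex[of "of_real x" \<alpha>] x unfolding eq by simp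
    then show "(\<lambda>n. (\<Sum>i\<le>n. half_binom \<alpha> i * neg_binom \<alpha> (n - i)) * x ^ n) sums
        (2 * (1 - x) / (1 + x)) powr (- \<alpha>)"
      by (simp only: sums_of_real_iff)
  qed
  then show ?thesis
    using generates_trap_weights_ex1 trap_weight_generates by metis
qed

lemma neg_binom_0_left: "neg_binom 0 n = (if n = 0 then 1 else 0)"
  by (simp add: neg_binom_def pochhammer_0_left)

lemma neg_binom_2: "neg_binom 2 n = real (Suc n)"
  by (induction n) (simp_all add: neg_binom_Suc field_simps)

lemma one_minus_X_mult_nth:
  "((1 - fps_X) * f) $ n = (if n = 0 then f $ 0 else f $ n - f $ (n - 1))" for f :: "'a::comm_ring_1 fps"
  by (simp add: left_diff_distrib)

lemma one_minus_X_neg_binom: "(1 - fps_X) * Abs_fps (neg_binom (c + 1)) = Abs_fps (neg_binom c)"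
proof (rule fps_ext)
  fix n show "((1 - fps_X) * Abs_fps (neg_binom (c + 1))) $ n = Abs_fps (neg_binom c) $ n"
    using neg_binom_diff[of c] by (cases n) (simp_all add: one_minus_X_mult_nth)
qed

text \<open>The uncorrected rule at t_n for the function t, with k^(\<alpha> + 1) divided out; the
  exact convolution is n^(\<alpha> + 1) / Gamma(\<alpha> + 2) in the same units.\<close>

definition trap_moment :: "real \<Rightarrow> nat \<Rightarrow> real" where
  "trap_moment \<alpha> n = (\<Sum>m\<le>n. trap_weight \<alpha> m * real (n - m))"

text \<open>
  With \<open>W = 1 - \<zeta>\<close> and \<open>A = 2\<^sup>-\<^sup>\<alpha> (1 + \<zeta>)\<^sup>\<alpha>\<close>, dividing \<open>A\<close> twice by \<open>W\<close> gives
  \<open>A = 1 - (\<alpha>/2) W + W\<^sup>2 S\<close> with absolutely summable \<open>S\<close>. The generating function of the moments is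
  \<open>\<zeta> W\<^sup>-\<^sup>2\<close> times \<open>W\<^sup>-\<^sup>\<alpha> A\<close>.
\<close>

lemma trap_moment_Suc:
  assumes \<alpha>: "0 < \<alpha>" "\<alpha> < 1"
  shows "trap_moment \<alpha> (Suc n) = neg_binom (\<alpha> + 2) n - \<alpha> / 2 * neg_binom (\<alpha> + 1) n
     + (\<Sum>i\<le>n. tail_twice \<alpha> i * neg_binom \<alpha> (n - i))"
proof -
  define W :: "real fps" where "W = 1 - fps_X"
  define A where "A = Abs_fps (half_binom \<alpha>)"
  define T where "T = Abs_fps (tail_once \<alpha>)"
  define S where "S = Abs_fps (tail_twice \<alpha>)"
  define N where "N c = Abs_fps (neg_binom c)" for c
  have WT: "W * T = 1 - A"
  proof (rule fps_ext)
    fix n show "(W * T) $ n = (1 - A) $ n"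
      using tail_once_diff[OF \<alpha>] tail_once_0[OF \<alpha>]
      by (cases n) (simp_all add: W_def T_def A_def one_minus_X_mult_nth)
  qed
  have WS: "W * S = fps_const (\<alpha> / 2) - T"
  proof (rule fps_ext)
    fix n show "(W * S) $ n = (fps_const (\<alpha> / 2) - T) $ n"
      using tail_twice_diff[OF \<alpha>] tail_twice_0[OF \<alpha>]
      by (cases n) (simp_all add: W_def T_def S_def one_minus_X_mult_nth)
  qed
  have WN: "W * N (c + 1) = N c" for c
    unfolding W_def N_def by (rule one_minus_X_neg_binom)
  have WN2: "W * (W * N (c + 2)) = N c" for c
    using WN[of "c + 1"] WN[of c] by (simp add: add.assoc)
  have N0: "N 0 = 1"
    by (rule fps_ext) (simp add: N_def neg_binom_0_left)
  \<comment> \<open>\<open>N 2\<close> is the inverse of W^2, while \<open>N \<alpha>\<close> is W^2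
    times \<open>N (\<alpha> + 2)\<close>.\<close>
  have N2: "N \<alpha> * N 2 = N (\<alpha> + 2)"
  proof -
    have "N \<alpha> * N 2 = N (\<alpha> + 2) * (W * (W * N (0 + 2)))"
      unfolding WN2[of \<alpha>, symmetric] by (simp add: mult_ac)
    then show ?thesis unfolding WN2[of 0] N0 by simp
  qed
  have A: "A = 1 - fps_const (\<alpha> / 2) * W + W * (W * S)"
    unfolding WS using WT by (simp add: algebra_simps)
  have F: "Abs_fps (trap_weight \<alpha>) = A * N \<alpha>"
    by (rule fps_ext) (simp add: A_def N_def fps_mult_nth trap_weight_eq atLeast0AtMost)
  have XN: "(fps_X * N 2) $ j = real j" for j
    by (cases j) (simp_all add: N_def neg_binom_2)
  have "trap_moment \<alpha> m = (Abs_fps (trap_weight \<alpha>) * (fps_X * N 2)) $ m" for m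
    unfolding fps_mult_nth[of _ "fps_X * N 2"] XN by (simp add: trap_moment_def atLeast0AtMost)
  moreover have "Abs_fps (trap_weight \<alpha>) * (fps_X * N 2)
      = fps_X * (N (\<alpha> + 2) - fps_const (\<alpha> / 2) * N (\<alpha> + 1) + S * N \<alpha>)"
  proof -
    have "A * N (\<alpha> + 2) = N (\<alpha> + 2) - fps_const (\<alpha> / 2) * (W * N ((\<alpha> + 1) + 1)) + S * (W * (W * N (\<alpha> + 2)))"
      unfolding A by (simp add: algebra_simps)
    also have "\<dots> = N (\<alpha> + 2) - fps_const (\<alpha> / 2) * N (\<alpha> + 1) + S * N \<alpha>"
      unfolding WN WN2 ..
    finally show ?thesis unfolding F N2[symmetric] by (simp add: mult_ac)
  qed
  ultimately have "trap_moment \<alpha> (Suc n) = (N (\<alpha> + 2) - fps_const (\<alpha> / 2) * N (\<alpha> + 1) + S * N \<alpha>) $ n"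
    by simp
  also have "\<dots> = neg_binom (\<alpha> + 2) n - \<alpha> / 2 * neg_binom (\<alpha> + 1) n
     + (\<Sum>i\<le>n. tail_twice \<alpha> i * neg_binom \<alpha> (n - i))"
    using fps_mult_nth[of S "N \<alpha>" n] by (simp add: N_def S_def atLeast0AtMost)
  finally show ?thesis .
qed

subsection \<open>Second-order expansion of the Gamma ratio\<close>

lemma ln_one_plus_quadratic:
  fixes y :: real
  assumes "0 \<le> y"
  shows "\<bar>ln (1 + y) - y + y\<^sup>2 / 2\<bar> \<le> y ^ 3"
proof -
  define h where "h x = ln (1 + x) - x + x\<^sup>2 / 2" for x :: real
  have d: "(h has_real_derivative x\<^sup>2 / (1 + x)) (at x)" if "0 \<le> x" for x
    unfolding h_def using that
    by (auto intro!: derivative_eq_intros simp: field_simps power2_eq_square)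
  have "h 0 \<le> h y"
    by (rule DERIV_nonneg_imp_nondecreasing[OF assms]) (use d in \<open>force intro: exI\<close>)
  moreover have "y ^ 3 - h y \<ge> 0 ^ 3 - h 0"
  proof (rule DERIV_nonneg_imp_nondecreasing[OF assms])
    fix x :: real assume x: "0 \<le> x" "x \<le> y"
    have "x\<^sup>2 / (1 + x) \<le> x\<^sup>2" using x by (simp add: divide_le_eq mult_le_cancel_left1)
    moreover have "((\<lambda>x. x ^ 3 - h x) has_real_derivative (3 * x\<^sup>2 - x\<^sup>2 / (1 + x))) (at x)"
      by (rule derivative_eq_intros d[OF x(1)] refl | simp)+
    ultimately show "\<exists>z. ((\<lambda>x. x ^ 3 - h x) has_real_derivative z) (at x) \<and> 0 \<le> z"
      using zero_le_power2[of x] by (intro exI[of _ "3 * x\<^sup>2 - x\<^sup>2 / (1 + x)"] conjI) linarith+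
  qed
  ultimately show ?thesis by (simp add: h_def)
qed

text \<open>The sequence c_n = 2K / (n + 1)^2 loses at least K / (n + 1)^3 per step, so c + L and c
  - L both decrease to 0 and are therefore nonnegative.\<close>

lemma null_sequence_cubic_increments:
  fixes L :: "nat \<Rightarrow> real"
  assumes lim: "L \<longlonglongrightarrow> 0" and "0 \<le> K"
    and inc: "\<And>n. \<bar>L (Suc n) - L n\<bar> \<le> K / real (Suc n) ^ 3"
  shows "\<bar>L n\<bar> \<le> 2 * K / (real (Suc n))\<^sup>2"
proof -
  define c where "c n = 2 * K / (real (Suc n))\<^sup>2" for n
  have c_diff: "K / real (Suc n) ^ 3 \<le> c n - c (Suc n)" for n
  proof -
    define x where "x = real (Suc n)"
    have x: "1 \<le> x" by (simp add: x_def)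
    have "c n - c (Suc n) - K / x ^ 3 = 2 * K / x\<^sup>2 - 2 * K / (x + 1)\<^sup>2 - K / x ^ 3"
      by (simp add: c_def x_def add.commute)
    also have "\<dots> = K * (3 * x\<^sup>2 - 1) / (x ^ 3 * (x + 1)\<^sup>2)"
      using x by (simp add: divide_simps) (simp add: power2_eq_square power3_eq_cube algebra_simps)
    also have "\<dots> \<ge> 0"
    proof -
      have "0 \<le> 3 * x\<^sup>2 - 1" using one_le_power[OF x, of 2] by linarith
      then show ?thesis using x \<open>0 \<le> K\<close> by (intro divide_nonneg_nonneg mult_nonneg_nonneg) auto
    qed
    finally show ?thesis by (simp add: x_def)
  qed
  have c_lim: "c \<longlonglongrightarrow> 0"
    unfolding c_def by real_asymp
  have "0 \<le> s * L n + c n" if s: "\<bar>s\<bar> = 1" for s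
  proof (rule decseq_ge)
    show "decseq (\<lambda>n. s * L n + c n)"
    proof (rule decseq_SucI)
      fix n
      have "s * (L (Suc n) - L n) \<le> K / real (Suc n) ^ 3"
        using inc[of n] s by (metis abs_ge_self abs_mult mult_1 order_trans)
      with c_diff[of n] show "s * L (Suc n) + c (Suc n) \<le> s * L n + c n"
        by (simp add: algebra_simps)
    qed
    show "(\<lambda>n. s * L n + c n) \<longlonglongrightarrow> 0"
      using tendsto_add[OF tendsto_mult_left[OF lim] c_lim, of s] by simp
  qed
  from this[of 1] this[of "-1"] show ?thesis by (simp add: c_def abs_le_iff)
qed

lemma abs_exp_minus_one_le: "\<bar>exp x - 1\<bar> \<le> \<bar>x\<bar> * exp \<bar>x\<bar>" for x :: real
proof (cases "0 \<le> x")
  case True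
  have "1 - x \<le> exp (-x)" using exp_ge_add_one_self[of "-x"] by simp
  then have "(1 - x) * exp x \<le> exp (-x) * exp x" by (rule mult_right_mono) simp
  then show ?thesis using True by (simp add: exp_minus algebra_simps)
next
  case False
  have "1 + x \<le> exp x" by (rule exp_ge_add_one_self)
  moreover have "-x * 1 \<le> -x * exp (-x)" using False by (intro mult_left_mono) auto
  moreover have "exp x \<le> 1" using False by simp
  ultimately have "\<bar>exp x - 1\<bar> \<le> -x * exp (-x)" by linarith
  then show ?thesis using False by simp
qed

text \<open>The shift \<open>\<alpha> (1 - \<alpha>) / 2\<close> is the one for which the terms of order \<open>n\<^sup>\<alpha>\<close> cancel.\<close>

lemma Gamma_ratio_expansion:
  assumes \<alpha>: "0 < \<alpha>" "\<alpha> < 1"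
  shows "\<exists>C>0. \<forall>n. \<bar>Gamma (\<alpha> + 1) * neg_binom (\<alpha> + 1) n * (real (Suc n) + \<alpha> * (1 - \<alpha>) / 2)
     - real (Suc n) powr (\<alpha> + 1)\<bar> \<le> C * real (Suc n) powr (\<alpha> - 1)"
proof -
  define b where "b = \<alpha> * (1 - \<alpha>) / 2"
  have b: "0 \<le> b" "b \<le> 1" using \<alpha> mult_le_one[of \<alpha> "1 - \<alpha>"] by (auto simp: b_def)
  define G where "G n = Gamma (\<alpha> + 1) * neg_binom (\<alpha> + 1) n * (real (Suc n) + b)" for n
  have Gam: "0 < Gamma (\<alpha> + 1)" using \<alpha> by (intro Gamma_real_pos) auto
  have Gam0: "Gamma (1 + \<alpha>) \<noteq> 0" using Gam by (metis add.commute less_irrefl)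
  have Gpos: "0 < G n" for n
    unfolding G_def using Gam neg_binom_pos[of "\<alpha> + 1" n] \<alpha> b by (intro mult_pos_pos) auto
  define L where "L n = ln (G n / real (Suc n) powr (\<alpha> + 1))" for n
  have L_alt: "L n = ln (G n) - (\<alpha> + 1) * ln (real (Suc n))" for n
    using Gpos[of n] by (simp add: L_def ln_div ln_powr)
  have inc: "\<bar>L (Suc n) - L n\<bar> \<le> 12 / real (Suc n) ^ 3" for n
  proof -
    define x where "x = 1 / real (Suc n)"
    have x: "0 < x" "real (Suc n) * x = 1" by (simp_all add: x_def)
    have r: "G (Suc n) / G n = (1 + \<alpha> * x) * (1 + (1 + b) * x) / (1 + b * x)"
      using Gam0 neg_binom_pos[of "\<alpha> + 1" n] \<alpha> b
      by (simp add: G_def neg_binom_Suc x_def divide_simps) (simp add: algebra_simps)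
    have p: "0 < 1 + \<alpha> * x" "0 < 1 + (1 + b) * x" "0 < 1 + b * x"
      using x(1) \<alpha> b by (auto intro!: add_pos_nonneg)
    have "real (Suc (Suc n)) = real (Suc n) * (1 + x)" by (simp add: x_def field_simps)
    then have "ln (real (Suc (Suc n))) = ln (real (Suc n)) + ln (1 + x)"
      using x(1) by (simp add: ln_mult)
    moreover have "ln (G (Suc n)) - ln (G n) = ln (1 + \<alpha> * x) + ln (1 + (1 + b) * x) - ln (1 + b * x)"
      using arg_cong[OF r, of ln] Gpos[of n] Gpos[of "Suc n"] p
      by (simp add: ln_div ln_mult less_imp_neq[symmetric] split: if_splits)
    ultimately have "L (Suc n) - L n = ln (1 + \<alpha> * x) + ln (1 + (1 + b) * x) - ln (1 + b * x) - (\<alpha> + 1) * ln (1 + x)"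
      unfolding L_alt by (simp add: algebra_simps)
    \<comment> \<open>The inserted Taylor polynomials add up to zero: \<alpha> + (1 + b) - b =
      \<alpha> + 1 in first order, and \<alpha>^2 + (1 + b)^2 - b^2 = \<alpha> + 1 in second order,
      which is what determines b. Only cubic remainders survive.\<close>
    also have "\<dots> = (ln (1 + \<alpha> * x) - \<alpha> * x + (\<alpha> * x)\<^sup>2 / 2)
        + (ln (1 + (1 + b) * x) - (1 + b) * x + ((1 + b) * x)\<^sup>2 / 2)
        - (ln (1 + b * x) - b * x + (b * x)\<^sup>2 / 2) - (\<alpha> + 1) * (ln (1 + x) - x + x\<^sup>2 / 2)"
      by (simp add: b_def power2_eq_square field_simps)
    also have "\<bar>\<dots>\<bar> \<le> (\<alpha> * x) ^ 3 + ((1 + b) * x) ^ 3 + (b * x) ^ 3 + (\<alpha> + 1) * x ^ 3"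
    proof -
      have "\<bar>(\<alpha> + 1) * (ln (1 + x) - x + x\<^sup>2 / 2)\<bar> \<le> (\<alpha> + 1) * x ^ 3"
        using ln_one_plus_quadratic[of x] x(1) \<alpha> by (simp add: abs_mult)
      moreover have "\<bar>p + q - r - s\<bar> \<le> P + Q + R + S"
        if "\<bar>p\<bar> \<le> P" "\<bar>q\<bar> \<le> Q" "\<bar>r\<bar> \<le> R" "\<bar>s\<bar> \<le> S" for p q r s P Q R S :: real
        using that by linarith
      ultimately show ?thesis
        using ln_one_plus_quadratic[of "\<alpha> * x"] ln_one_plus_quadratic[of "(1 + b) * x"]
          ln_one_plus_quadratic[of "b * x"] x(1) \<alpha> b
        by simp
    qed
    also have "\<dots> = (\<alpha> ^ 3 + (1 + b) ^ 3 + b ^ 3 + (\<alpha> + 1)) * x ^ 3"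
      unfolding power_mult_distrib by (simp only: distrib_right)
    \<comment> \<open>The four coefficients are at most 1, 8, 1 and 2.\<close>
    also have "\<dots> \<le> 12 * x ^ 3"
    proof -
      have "\<alpha> ^ 3 \<le> 1" "b ^ 3 \<le> 1" "(1 + b) ^ 3 \<le> 2 ^ 3"
        using \<alpha> b power_mono[of "1 + b" 2 3] by (auto intro!: power_le_one)
      then have "\<alpha> ^ 3 + (1 + b) ^ 3 + b ^ 3 + (\<alpha> + 1) \<le> 12" using \<alpha> by simp
      then show ?thesis using x(1) by (intro mult_right_mono) auto
    qed
    finally show ?thesis by (simp add: x_def power_divide)
  qed
  \<comment> \<open>Increments determine \<open>L\<close> only up to a constant. Euler's limit for
    Gamma fixes it: the normalised ratio tends to 1.\<close>
  have lim: "L \<longlonglongrightarrow> 0"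
  proof -
    have gs: "inverse (Gamma_series \<alpha> n) = \<alpha> * neg_binom (\<alpha> + 1) n / real n powr \<alpha>" if "0 < n" for n
      using that \<alpha> by (simp add: Gamma_series_def pochhammer_rec neg_binom_def powr_def field_simps)
    have nz: "Gamma \<alpha> \<noteq> 0" using Gamma_real_pos[OF \<alpha>(1)] by simp
    have "(\<lambda>n. Gamma \<alpha> * inverse (Gamma_series \<alpha> n)) \<longlonglongrightarrow> Gamma \<alpha> * inverse (Gamma \<alpha>)"
      by (intro tendsto_intros Gamma_series_LIMSEQ nz)
    moreover have "(\<lambda>n. real n powr \<alpha> * (real n + 1 + b) / (real n + 1) powr (\<alpha> + 1)) \<longlonglongrightarrow> 1"
      using \<alpha> b by real_asymp
    ultimately have "(\<lambda>n. Gamma \<alpha> * inverse (Gamma_series \<alpha> n) *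
        (real n powr \<alpha> * (real n + 1 + b) / (real n + 1) powr (\<alpha> + 1))) \<longlonglongrightarrow> 1 * 1"
      using nz by (intro tendsto_mult) auto
    moreover have "\<forall>\<^sub>F n in sequentially. Gamma \<alpha> * inverse (Gamma_series \<alpha> n) *
        (real n powr \<alpha> * (real n + 1 + b) / (real n + 1) powr (\<alpha> + 1)) = G n / real (Suc n) powr (\<alpha> + 1)"
      using eventually_gt_at_top[of 0]
    proof eventually_elim
      case (elim n)
      have "Gamma (\<alpha> + 1) = \<alpha> * Gamma \<alpha>" using \<alpha> by (intro Gamma_plus1) (auto simp: nonpos_Ints_def)
      then show ?case unfolding gs[OF elim] G_def using elim by (simp add: field_simps)
    qed
    ultimately have "(\<lambda>n. G n / real (Suc n) powr (\<alpha> + 1)) \<longlonglongrightarrow> 1"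
      by (simp add: tendsto_cong)
    from tendsto_ln[OF this] show ?thesis by (simp add: L_def[abs_def])
  qed
  have L_le: "\<bar>L n\<bar> \<le> 24 / (real (Suc n))\<^sup>2" for n
    using null_sequence_cubic_increments[OF lim _ inc, of n] by simp
  have "\<bar>G n - real (Suc n) powr (\<alpha> + 1)\<bar> \<le> 24 * exp 24 * real (Suc n) powr (\<alpha> - 1)" for n
  proof -
    define N where "N = real (Suc n)"
    have N: "1 \<le> N" by (simp add: N_def)
    have "24 / N\<^sup>2 \<le> 24" using one_le_power[OF N, of 2] by (simp add: divide_le_eq)
    then have L24: "\<bar>L n\<bar> \<le> 24" using L_le[of n] by (simp add: N_def)
    have "G n = N powr (\<alpha> + 1) * exp (L n)"
      using Gpos[of n] N by (simp add: L_def N_def)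
    then have "G n - N powr (\<alpha> + 1) = N powr (\<alpha> + 1) * (exp (L n) - 1)"
      by (simp add: algebra_simps)
    then have "\<bar>G n - N powr (\<alpha> + 1)\<bar> = N powr (\<alpha> + 1) * \<bar>exp (L n) - 1\<bar>"
      by (simp add: abs_mult)
    also have "\<dots> \<le> N powr (\<alpha> + 1) * (24 / N\<^sup>2 * exp 24)"
      using abs_exp_minus_one_le[of "L n"] L_le[of n] L24
      by (intro mult_left_mono order_trans[OF abs_exp_minus_one_le] mult_mono) (auto simp: N_def)
    also have "\<dots> = 24 * exp 24 * N powr (\<alpha> - 1)"
    proof -
      have "N powr (\<alpha> + 1) = N powr (\<alpha> - 1) * N\<^sup>2"
        using powr_add[of N "\<alpha> - 1" 2] N by (simp add: add.commute)
      then show ?thesis using N by simp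
    qed
    finally show ?thesis by (simp add: N_def)
  qed
  then show ?thesis unfolding G_def b_def by (intro exI[of _ "24 * exp 24"]) auto
qed

subsection \<open>The quadrature defect\<close>

context
  fixes \<alpha> :: real
  assumes \<alpha>: "0 < \<alpha>" "\<alpha> < 1"
begin

text \<open>Consecutive coefficients have ratio 1 + (\<alpha> - 1) x with x = 1 / (n + 1). As
  \<alpha> - 1 < 0 and ln (1 + x) <= x, this ratio is at most (1 + x)^(\<alpha> - 1), the ratio of
  the powers.\<close>

lemma neg_binom_le_powr: "neg_binom \<alpha> n \<le> real (Suc n) powr (\<alpha> - 1)"
proof (induction n)
  case (Suc n)
  define x where "x = 1 / real (Suc n)"
  have x: "0 < x" by (simp add: x_def)
  have "1 + (\<alpha> - 1) * x \<le> 1 + (\<alpha> - 1) * ln (1 + x)"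
    using ln_add_one_self_le_self[of x] x \<alpha> by (simp add: mult_le_cancel_left)
  also have "\<dots> \<le> exp ((\<alpha> - 1) * ln (1 + x))" by (rule exp_ge_add_one_self)
  also have "\<dots> = (1 + x) powr (\<alpha> - 1)" using x by (simp add: powr_def)
  finally have step: "1 + (\<alpha> - 1) * x \<le> (1 + x) powr (\<alpha> - 1)" .
  have "neg_binom \<alpha> (Suc n) = neg_binom \<alpha> n * (1 + (\<alpha> - 1) * x)"
    by (simp add: neg_binom_Suc x_def field_simps)
  also have "\<dots> \<le> real (Suc n) powr (\<alpha> - 1) * (1 + x) powr (\<alpha> - 1)"
    using Suc.IH step neg_binom_pos[OF \<alpha>(1), of n] by (intro mult_mono) (auto simp: x_def field_simps \<alpha> less_imp_le)
  also have "\<dots> = (real (Suc n) * (1 + x)) powr (\<alpha> - 1)" by (rule powr_mult[symmetric])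
  also have "real (Suc n) * (1 + x) = real (Suc (Suc n))" by (simp add: x_def field_simps)
  finally show ?case .
qed simp

text \<open>The growth factor 1 + \<alpha> / (m + 2) is dominated by ((m + 2) / (m + 1))^\<alpha>,
  so the induction runs with the base one smaller than claimed and starts at index 1, where the
  factor 2 absorbs \<alpha> + 1.\<close>

lemma neg_binom_plus_one_le_powr: "neg_binom (\<alpha> + 1) n \<le> 2 * real (Suc n) powr \<alpha>"
proof -
  have *: "neg_binom (\<alpha> + 1) (Suc m) \<le> 2 * real (Suc m) powr \<alpha>" for m
  proof (induction m)
    case 0
    then show ?case using \<alpha> by (simp add: neg_binom_Suc)
  next
    case (Suc m)
    define x where "x = 1 / real (Suc m)"
    have x: "0 < x" by (simp add: x_def)
    have "ln (1 / (1 + x)) \<le> 1 / (1 + x) - 1" using x by (intro ln_le_minus_one) auto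
    moreover have "1 / real (Suc (Suc m)) = 1 - 1 / (1 + x)" by (simp add: x_def field_simps)
    ultimately have "1 / real (Suc (Suc m)) \<le> ln (1 + x)" using x by (simp add: ln_div)
    then have "1 + \<alpha> * (1 / real (Suc (Suc m))) \<le> 1 + \<alpha> * ln (1 + x)"
      using \<alpha> by (intro add_left_mono mult_left_mono) auto
    also have "\<dots> \<le> exp (\<alpha> * ln (1 + x))" by (rule exp_ge_add_one_self)
    also have "\<dots> = (1 + x) powr \<alpha>" using x by (simp add: powr_def)
    finally have step: "1 + \<alpha> / real (Suc (Suc m)) \<le> (1 + x) powr \<alpha>" by simp
    have "neg_binom (\<alpha> + 1) (Suc (Suc m)) = neg_binom (\<alpha> + 1) (Suc m) * (1 + \<alpha> / real (Suc (Suc m)))"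
      by (subst neg_binom_Suc) (simp add: divide_simps algebra_simps)
    also have "\<dots> \<le> 2 * real (Suc m) powr \<alpha> * (1 + x) powr \<alpha>"
      using Suc.IH step \<alpha> by (intro mult_mono) auto
    also have "\<dots> = 2 * (real (Suc m) * (1 + x)) powr \<alpha>" by (simp only: powr_mult mult.assoc)
    also have "real (Suc m) * (1 + x) = real (Suc (Suc m))" by (simp add: x_def field_simps)
    finally show ?case .
  qed
  show ?thesis
  proof (cases n)
    case (Suc m)
    have "real (Suc m) powr \<alpha> \<le> real (Suc n) powr \<alpha>" using Suc \<alpha> by (intro powr_mono2) auto
    with *[of m] Suc show ?thesis by simp
  qed simp
qed

lemma neg_binom_sum: "(\<Sum>j\<le>n. neg_binom \<alpha> j) = neg_binom (\<alpha> + 1) n"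
proof (induction n)
  case (Suc n)
  then show ?case using neg_binom_diff[of \<alpha> n] by simp
qed simp

text \<open>Split at i = n/2. In the lower half \<open>neg_binom\<close> is O(n^(\<alpha> - 1)) and
  the magnitudes sum to at most 1; in the upper half the magnitudes are at most 2/N and
  \<open>neg_binom\<close> sums to O(n^\<alpha>). The constant is 2 + 2 * 2.\<close>

lemma tail_convolution_bound:
  "\<bar>\<Sum>i\<le>n. tail_twice \<alpha> i * neg_binom \<alpha> (n - i)\<bar> \<le> 6 * real (Suc n) powr (\<alpha> - 1)"
proof -
  define N where "N = real (Suc n)"
  have N: "1 \<le> N" by (simp add: N_def)
  have bnd: "\<bar>tail_twice \<alpha> i * neg_binom \<alpha> (n - i)\<bar>
      \<le> 2 * N powr (\<alpha> - 1) * binom_mag \<alpha> i + 2 / N * neg_binom \<alpha> (n - i)" if "i \<le> n" for i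
  proof -
    have pos: "0 < neg_binom \<alpha> (n - i)" by (rule neg_binom_pos[OF \<alpha>(1)])
    have mag: "0 \<le> binom_mag \<alpha> i" by (rule binom_mag_nonneg[OF \<alpha>])
    have le: "\<bar>tail_twice \<alpha> i * neg_binom \<alpha> (n - i)\<bar> \<le> binom_mag \<alpha> i * neg_binom \<alpha> (n - i)"
      using tail_twice_le[OF \<alpha>, of i] pos by (simp add: abs_mult)
    have nn: "0 \<le> 2 * N powr (\<alpha> - 1) * binom_mag \<alpha> i" "0 \<le> 2 / N * neg_binom \<alpha> (n - i)"
      using mag pos N by auto
    show ?thesis
    proof (cases "2 * i \<le> n")
      case True
      have "neg_binom \<alpha> (n - i) \<le> real (Suc (n - i)) powr (\<alpha> - 1)" by (rule neg_binom_le_powr)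
      also have "\<dots> \<le> (N / 2) powr (\<alpha> - 1)"
        using True \<alpha> N by (intro powr_mono2') (auto simp: N_def)
      also have "\<dots> = N powr (\<alpha> - 1) * 2 powr (1 - \<alpha>)"
        using powr_minus_divide[of 2 "\<alpha> - 1"] by (simp add: powr_divide)
      also have "\<dots> \<le> N powr (\<alpha> - 1) * 2"
        using powr_mono[of "1 - \<alpha>" 1 2] \<alpha> by (intro mult_left_mono) auto
      finally have "binom_mag \<alpha> i * neg_binom \<alpha> (n - i) \<le> binom_mag \<alpha> i * (N powr (\<alpha> - 1) * 2)"
        using mag by (rule mult_left_mono)
      with le nn show ?thesis by (simp add: mult_ac)
    next
      case False
      have "binom_mag \<alpha> i \<le> 1 / real (Suc i)" by (rule binom_mag_le[OF \<alpha>])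
      also have "\<dots> \<le> 2 / N" using False by (simp add: N_def divide_simps)
      finally have "binom_mag \<alpha> i * neg_binom \<alpha> (n - i) \<le> 2 / N * neg_binom \<alpha> (n - i)"
        using pos by (intro mult_right_mono) auto
      with le nn show ?thesis by linarith
    qed
  qed
  have "\<bar>\<Sum>i\<le>n. tail_twice \<alpha> i * neg_binom \<alpha> (n - i)\<bar>
      \<le> (\<Sum>i\<le>n. 2 * N powr (\<alpha> - 1) * binom_mag \<alpha> i + 2 / N * neg_binom \<alpha> (n - i))"
    by (rule order_trans[OF sum_abs]) (intro sum_mono bnd, simp)
  also have "\<dots> = 2 * N powr (\<alpha> - 1) * (\<Sum>i\<le>n. binom_mag \<alpha> i) + 2 / N * (\<Sum>i\<le>n. neg_binom \<alpha> (n - i))"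
    by (simp add: sum.distrib sum_distrib_left)
  also have "(\<Sum>i\<le>n. neg_binom \<alpha> (n - i)) = neg_binom (\<alpha> + 1) n"
    unfolding neg_binom_sum[symmetric] by (rule sum.nat_diff_reindex[of _ "Suc n", unfolded lessThan_Suc_atMost, simplified])
  also have "2 * N powr (\<alpha> - 1) * (\<Sum>i\<le>n. binom_mag \<alpha> i) + 2 / N * neg_binom (\<alpha> + 1) n
      \<le> 2 * N powr (\<alpha> - 1) * 1 + 2 / N * (2 * N powr \<alpha>)"
    using binom_mag_sum_le[OF \<alpha>, of "Suc n"] neg_binom_plus_one_le_powr[of n] N
    by (intro add_mono mult_left_mono) (auto simp: N_def lessThan_Suc_atMost)
  also have "\<dots> = 6 * N powr (\<alpha> - 1)"
    using N by (simp add: powr_diff)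
  finally show ?thesis by (simp add: N_def)
qed

text \<open>The two leading terms of \<open>trap_moment_Suc\<close> combine to
  \<open>neg_binom (\<alpha> + 1) n\<close> times n + 1 + \<alpha> (1 - \<alpha>) / 2 over \<alpha>
  + 1. The linear term of the expansion at \<zeta> = 1 thus produces exactly the shift of
  \<open>Gamma_ratio_expansion\<close>.\<close>

lemma trap_moment_asymptotics:
  "\<exists>C>0. \<forall>n\<ge>1. \<bar>real n powr (\<alpha> + 1) / Gamma (\<alpha> + 2) - trap_moment \<alpha> n\<bar> \<le> C * real n powr (\<alpha> - 1)"
proof -
  obtain K where K: "K > 0" "\<And>n. \<bar>Gamma (\<alpha> + 1) * neg_binom (\<alpha> + 1) n * (real (Suc n) + \<alpha> * (1 - \<alpha>) / 2)
     - real (Suc n) powr (\<alpha> + 1)\<bar> \<le> K * real (Suc n) powr (\<alpha> - 1)"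
    using Gamma_ratio_expansion[OF \<alpha>] by blast
  have Gam: "0 < Gamma (\<alpha> + 1)" "0 < Gamma (\<alpha> + 2)" using \<alpha> by (auto intro: Gamma_real_pos)
  have Gam0: "Gamma (1 + \<alpha>) \<noteq> 0" using Gam(1) by (metis add.commute less_irrefl)
  have Gam2: "Gamma (\<alpha> + 2) = (\<alpha> + 1) * Gamma (\<alpha> + 1)"
    using Gamma_plus1[of "\<alpha> + 1"] \<alpha> by (auto simp: nonpos_Ints_def add.assoc)
  have "\<bar>real (Suc n) powr (\<alpha> + 1) / Gamma (\<alpha> + 2) - trap_moment \<alpha> (Suc n)\<bar>
      \<le> (K / Gamma (\<alpha> + 2) + 6) * real (Suc n) powr (\<alpha> - 1)" for n
  proof -
    define R where "R = (\<Sum>i\<le>n. tail_twice \<alpha> i * neg_binom \<alpha> (n - i))"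
    have "(\<alpha> + 1) * pochhammer (\<alpha> + 2) n = pochhammer (\<alpha> + 1) n * (\<alpha> + 1 + n)"
      using pochhammer_rec[of "\<alpha> + 1" n] pochhammer_Suc[of "\<alpha> + 1" n] by (simp add: add.assoc)
    then have "(\<alpha> + 1) * neg_binom (\<alpha> + 2) n = neg_binom (\<alpha> + 1) n * (\<alpha> + 1 + n)"
      by (simp only: neg_binom_def times_divide_eq_right times_divide_eq_left)
    then have "neg_binom (\<alpha> + 2) n = neg_binom (\<alpha> + 1) n * (\<alpha> + 1 + n) / (\<alpha> + 1)"
      using \<alpha> by (simp add: eq_divide_eq mult.commute)
    then have "neg_binom (\<alpha> + 2) n - \<alpha> / 2 * neg_binom (\<alpha> + 1) n
        = Gamma (\<alpha> + 1) * neg_binom (\<alpha> + 1) n * (real (Suc n) + \<alpha> * (1 - \<alpha>) / 2) / Gamma (\<alpha> + 2)"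
      using \<alpha> Gam0 unfolding Gam2 by (simp add: divide_simps) (simp add: algebra_simps)
    then have "real (Suc n) powr (\<alpha> + 1) / Gamma (\<alpha> + 2) - trap_moment \<alpha> (Suc n)
        = - (Gamma (\<alpha> + 1) * neg_binom (\<alpha> + 1) n * (real (Suc n) + \<alpha> * (1 - \<alpha>) / 2)
           - real (Suc n) powr (\<alpha> + 1)) / Gamma (\<alpha> + 2) - R"
      unfolding trap_moment_Suc[OF \<alpha>] R_def by (simp add: diff_divide_distrib)
    also have "\<bar>\<dots>\<bar> \<le> \<bar>Gamma (\<alpha> + 1) * neg_binom (\<alpha> + 1) n * (real (Suc n) + \<alpha> * (1 - \<alpha>) / 2)
           - real (Suc n) powr (\<alpha> + 1)\<bar> / Gamma (\<alpha> + 2) + \<bar>R\<bar>"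
      using Gam(2) by (intro order_trans[OF abs_triangle_ineq4]) (simp add: abs_divide abs_minus_commute)
    also have "\<dots> \<le> K * real (Suc n) powr (\<alpha> - 1) / Gamma (\<alpha> + 2) + 6 * real (Suc n) powr (\<alpha> - 1)"
      unfolding R_def using K(2)[of n] Gam(2) tail_convolution_bound[of n]
      by (intro add_mono divide_right_mono) auto
    finally show ?thesis by (simp add: algebra_simps)
  qed
  then have "\<forall>n\<ge>1. \<bar>real n powr (\<alpha> + 1) / Gamma (\<alpha> + 2) - trap_moment \<alpha> n\<bar>
      \<le> (K / Gamma (\<alpha> + 2) + 6) * real n powr (\<alpha> - 1)"
    by (metis One_nat_def Suc_le_D)
  then show ?thesis using K(1) Gam(2) by (intro exI[of _ "K / Gamma (\<alpha> + 2) + 6"]) (auto intro: add_pos_pos)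
qed

end

text \<open>
  \<open>k powr (\<alpha> + 1) * trap_defect \<alpha> n ((t\<^sub>n - s) / k)\<close> is the error of the uncorrected quadrature at
  \<open>t\<^sub>n\<close> for the function \<open>t \<mapsto> max 0 (t - s)\<close>, i.e. the Peano kernel of the corrected one.
\<close>

definition trap_defect :: "real \<Rightarrow> nat \<Rightarrow> real \<Rightarrow> real" where
  "trap_defect \<alpha> n x = x powr (\<alpha> + 1) / Gamma (\<alpha> + 2) - (\<Sum>m\<le>n. trap_weight \<alpha> m * max 0 (x - real m))"

lemma trap_defect_of_nat:
  assumes "j \<le> n"
  shows "trap_defect \<alpha> n (real j) = real j powr (\<alpha> + 1) / Gamma (\<alpha> + 2) - trap_moment \<alpha> j"
proof -
  have "(\<Sum>m\<le>n. trap_weight \<alpha> m * max 0 (real j - real m)) = (\<Sum>m\<le>j. trap_weight \<alpha> m * real (j - m))"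
    using assms by (intro sum.mono_neutral_cong_right) auto
  then show ?thesis by (simp add: trap_defect_def trap_moment_def)
qed

text \<open>The error is the difference of two mean values of the derivative, both taken in
  [j, j + 1]; it is bounded by the increment of x^(a - 1) there, which the negative exponent a - 2
  lets one measure at j.\<close>

lemma power_interpolation_error:
  fixes a :: real
  assumes "1 < a" "a < 2" "0 < j" "0 \<le> \<theta>" "\<theta> \<le> 1"
  shows "\<bar>(j + \<theta>) powr a - ((1 - \<theta>) * j powr a + \<theta> * (j + 1) powr a)\<bar> \<le> 2 * j powr (a - 2)"
proof (cases "\<theta> = 0")
  case False
  then have \<theta>: "0 < \<theta>" using assms by simp
  have d: "((\<lambda>x. x powr p) has_real_derivative p * x powr (p - 1)) (at x)" if "0 < x" for x p :: real
    using that by (auto intro!: derivative_eq_intros)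
  obtain z where z: "j < z" "z < j + \<theta>" "(j + \<theta>) powr a - j powr a = \<theta> * (a * z powr (a - 1))"
    using MVT2[of j "j + \<theta>" "\<lambda>x. x powr a" "\<lambda>x. a * x powr (a - 1)"] \<theta> d assms by auto
  obtain w where w: "j < w" "w < j + 1" "(j + 1) powr a - j powr a = a * w powr (a - 1)"
    using MVT2[of j "j + 1" "\<lambda>x. x powr a" "\<lambda>x. a * x powr (a - 1)"] d assms by auto
  obtain v where v: "j < v" "v < j + 1" "(j + 1) powr (a - 1) - j powr (a - 1) = (a - 1) * v powr (a - 2)"
    using MVT2[of j "j + 1" "\<lambda>x. x powr (a - 1)" "\<lambda>x. (a - 1) * x powr (a - 2)"] d[of _ "a - 1"] assms by auto
  have "v powr (a - 2) \<le> j powr (a - 2)" using v assms by (intro powr_mono2') auto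
  then have "(a - 1) * v powr (a - 2) \<le> 1 * j powr (a - 2)" using assms by (intro mult_mono) auto
  moreover have "j powr (a - 1) \<le> z powr (a - 1)" "z powr (a - 1) \<le> (j + 1) powr (a - 1)"
      "j powr (a - 1) \<le> w powr (a - 1)" "w powr (a - 1) \<le> (j + 1) powr (a - 1)"
    using z w assms by (auto intro!: powr_mono2)
  ultimately have le: "\<bar>z powr (a - 1) - w powr (a - 1)\<bar> \<le> j powr (a - 2)"
    using v(3) by linarith
  have "(j + \<theta>) powr a - ((1 - \<theta>) * j powr a + \<theta> * (j + 1) powr a)
      = ((j + \<theta>) powr a - j powr a) - \<theta> * ((j + 1) powr a - j powr a)" by (simp add: algebra_simps)
  also have "\<dots> = \<theta> * a * (z powr (a - 1) - w powr (a - 1))"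
    unfolding z(3) w(3) by (simp add: algebra_simps)
  also have "\<bar>\<dots>\<bar> \<le> 1 * 2 * j powr (a - 2)"
    unfolding abs_mult using assms le by (intro mult_mono) auto
  finally show ?thesis by simp
qed simp

text \<open>The quadrature part is piecewise linear in x with integer nodes. Between nodes the
  defect is therefore the interpolation error of the power plus interpolated nodal defects, both
  O(x^(\<alpha> - 1)); on [0, 1] only the weight of index 0 enters.\<close>

lemma trap_defect_bound:
  assumes \<alpha>: "0 < \<alpha>" "\<alpha> < 1"
  shows "\<exists>C>0. \<forall>n x. 0 \<le> x \<and> x \<le> real n \<longrightarrow>
     \<bar>trap_defect \<alpha> n x\<bar> \<le> C \<and> (1 \<le> x \<longrightarrow> \<bar>trap_defect \<alpha> n x\<bar> \<le> C * x powr (\<alpha> - 1))"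
proof -
  obtain C where C: "C > 0" "\<And>n. 1 \<le> n \<Longrightarrow>
      \<bar>real n powr (\<alpha> + 1) / Gamma (\<alpha> + 2) - trap_moment \<alpha> n\<bar> \<le> C * real n powr (\<alpha> - 1)"
    using trap_moment_asymptotics[OF \<alpha>] by blast
  define G where "G = Gamma (\<alpha> + 2)"
  have G: "0 < G" unfolding G_def using \<alpha> by (intro Gamma_real_pos) auto
  \<comment> \<open>The point x = n is itself a node and is treated directly, so that for any other
    x the cell ends at a node not exceeding n, as \<open>trap_defect_of_nat\<close> demands.\<close>
  have large: "\<bar>trap_defect \<alpha> n x\<bar> \<le> 2 * (2 / G + C) * x powr (\<alpha> - 1)" if "1 \<le> x" "x \<le> real n" for n x
  proof (cases "x = real n")
    case True
    have "\<bar>trap_defect \<alpha> n x\<bar> \<le> C * x powr (\<alpha> - 1)"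
      using C(2)[of n] that unfolding True trap_defect_of_nat[OF order_refl] by simp
    also have "\<dots> \<le> 2 * (2 / G + C) * x powr (\<alpha> - 1)" using C(1) G by (intro mult_right_mono) auto
    finally show ?thesis .
  next
    case False
    define j where "j = nat \<lfloor>x\<rfloor>"
    define \<theta> where "\<theta> = x - real j"
    have j: "1 \<le> j" "Suc j \<le> n" and \<theta>: "0 \<le> \<theta>" "\<theta> \<le> 1"
      using that False unfolding j_def \<theta>_def by linarith+
    have x: "x = real j + \<theta>" by (simp add: \<theta>_def)
    have affine: "max 0 (x - real m) = (1 - \<theta>) * max 0 (real j - real m) + \<theta> * max 0 (real (Suc j) - real m)" for m
    proof (cases "m \<le> j")
      case True
      then show ?thesis using \<theta> by (simp add: x algebra_simps)
    next
      case False
      then have "x - real m \<le> 0" "real j - real m \<le> 0" "real (Suc j) - real m \<le> 0"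
        using \<theta> unfolding x by auto
      then show ?thesis by (simp only: max_absorb1 mult_zero_right add_0)
    qed
    have "(\<Sum>m\<le>n. trap_weight \<alpha> m * max 0 (x - real m))
        = (1 - \<theta>) * (\<Sum>m\<le>n. trap_weight \<alpha> m * max 0 (real j - real m))
          + \<theta> * (\<Sum>m\<le>n. trap_weight \<alpha> m * max 0 (real (Suc j) - real m))"
      unfolding affine by (simp only: distrib_left mult.left_commute sum.distrib sum_distrib_left)
    then have "trap_defect \<alpha> n x = (x powr (\<alpha> + 1) - ((1 - \<theta>) * real j powr (\<alpha> + 1) + \<theta> * (real j + 1) powr (\<alpha> + 1))) / G
        + ((1 - \<theta>) * trap_defect \<alpha> n (real j) + \<theta> * trap_defect \<alpha> n (real (Suc j)))"
      unfolding trap_defect_def G_def by (simp add: diff_divide_distrib add_divide_distrib algebra_simps)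
    also have "\<bar>\<dots>\<bar> \<le> 2 * real j powr (\<alpha> - 1) / G + ((1 - \<theta>) * (C * real j powr (\<alpha> - 1)) + \<theta> * (C * real j powr (\<alpha> - 1)))"
    proof (intro order_trans[OF abs_triangle_ineq] add_mono)
      show "\<bar>(x powr (\<alpha> + 1) - ((1 - \<theta>) * real j powr (\<alpha> + 1) + \<theta> * (real j + 1) powr (\<alpha> + 1))) / G\<bar>
          \<le> 2 * real j powr (\<alpha> - 1) / G"
        using power_interpolation_error[of "\<alpha> + 1" "real j" \<theta>] \<alpha> j \<theta> G
        by (simp add: x abs_divide divide_right_mono)
      have 1: "\<bar>trap_defect \<alpha> n (real j)\<bar> \<le> C * real j powr (\<alpha> - 1)"
        using C(2)[of j] j by (simp add: trap_defect_of_nat)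
      have "\<bar>trap_defect \<alpha> n (real (Suc j))\<bar> \<le> C * real (Suc j) powr (\<alpha> - 1)"
        using C(2)[of "Suc j"] j by (simp only: trap_defect_of_nat)
      also have "\<dots> \<le> C * real j powr (\<alpha> - 1)"
        using C(1) \<alpha> j by (intro mult_left_mono powr_mono2') auto
      finally have 2: "\<bar>trap_defect \<alpha> n (real (Suc j))\<bar> \<le> C * real j powr (\<alpha> - 1)" .
      show "\<bar>(1 - \<theta>) * trap_defect \<alpha> n (real j)\<bar> \<le> (1 - \<theta>) * (C * real j powr (\<alpha> - 1))"
        using 1 \<theta> by (simp add: abs_mult mult_left_mono)
      show "\<bar>\<theta> * trap_defect \<alpha> n (real (Suc j))\<bar> \<le> \<theta> * (C * real j powr (\<alpha> - 1))"
        unfolding abs_mult using 2 \<theta> by (simp add: mult_left_mono)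
    qed
    also have "\<dots> = (2 / G + C) * real j powr (\<alpha> - 1)" by (simp add: algebra_simps)
    also have "\<dots> \<le> (2 / G + C) * (x / 2) powr (\<alpha> - 1)"
      using C(1) G \<alpha> j \<theta> by (intro mult_left_mono powr_mono2') (auto simp: x)
    also have "\<dots> = (2 / G + C) * (x powr (\<alpha> - 1) * 2 powr (1 - \<alpha>))"
      using powr_minus_divide[of 2 "\<alpha> - 1"] by (simp add: powr_divide)
    also have "\<dots> \<le> (2 / G + C) * (x powr (\<alpha> - 1) * 2)"
      using powr_mono[of "1 - \<alpha>" 1 2] \<alpha> C(1) G by (intro mult_left_mono) auto
    finally show ?thesis by (simp only: mult_ac)
  qed
  have small: "\<bar>trap_defect \<alpha> n x\<bar> \<le> 1 / G + \<bar>trap_weight \<alpha> 0\<bar>" if "0 \<le> x" "x \<le> 1" for n x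
  proof -
    have "(\<Sum>m\<le>n. trap_weight \<alpha> m * max 0 (x - real m)) = (\<Sum>m\<in>{0}. trap_weight \<alpha> m * max 0 (x - real m))"
      using that by (intro sum.mono_neutral_right) auto
    then have "trap_defect \<alpha> n x = x powr (\<alpha> + 1) / G - trap_weight \<alpha> 0 * x"
      using that by (simp add: trap_defect_def G_def)
    also have "\<bar>\<dots>\<bar> \<le> \<bar>x powr (\<alpha> + 1) / G\<bar> + \<bar>trap_weight \<alpha> 0 * x\<bar>" by (rule abs_triangle_ineq4)
    also have "\<dots> \<le> 1 / G + \<bar>trap_weight \<alpha> 0\<bar>"
      using that \<alpha> G powr_mono2[of "\<alpha> + 1" x 1]
      by (intro add_mono) (auto simp: abs_mult divide_right_mono intro!: mult_left_le)
    finally show ?thesis .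
  qed
  define K where "K = 2 * (2 / G + C) + 1 / G + \<bar>trap_weight \<alpha> 0\<bar>"
  have K: "0 < K" "2 * (2 / G + C) \<le> K" "1 / G + \<bar>trap_weight \<alpha> 0\<bar> \<le> K"
  proof -
    have "0 < 2 * (2 / G + C)" "0 < 1 / G" using C(1) G by (auto intro: add_pos_pos)
    then show "0 < K" "2 * (2 / G + C) \<le> K" "1 / G + \<bar>trap_weight \<alpha> 0\<bar> \<le> K"
      unfolding K_def by linarith+
  qed
  show ?thesis
  proof (intro exI[of _ K] conjI allI impI)
    fix n x assume x: "0 \<le> x \<and> x \<le> real n"
    show "\<bar>trap_defect \<alpha> n x\<bar> \<le> K * x powr (\<alpha> - 1)" if "1 \<le> x"
      using order_trans[OF large mult_right_mono[OF K(2)]] that x by simp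
    show "\<bar>trap_defect \<alpha> n x\<bar> \<le> K"
    proof (cases "x \<le> 1")
      case True
      then show ?thesis using small[of x n] x K by simp
    next
      case False
      then have "x powr (\<alpha> - 1) \<le> 1"
        using powr_mono2'[of "\<alpha> - 1" 1 x] \<alpha> by simp
      then have "2 * (2 / G + C) * x powr (\<alpha> - 1) \<le> 2 * (2 / G + C) * 1"
        using C(1) G by (intro mult_left_mono) auto
      then show ?thesis using large[of x n] False x K by simp
    qed
  qed (rule K(1))
qed

subsection \<open>Positivity of the convolution form\<close>

text \<open>The quotient (1 + z) / (1 - z) lies in the right half-plane; raising it to the power
  \<alpha> < 1 shrinks its argument and keeps it there.\<close>

lemma Re_trap_generating_nonneg:
  fixes z :: complex
  assumes \<alpha>: "0 < \<alpha>" "\<alpha> < 1" and z: "norm z < 1"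
  shows "0 \<le> Re (of_real (2 powr (-\<alpha>)) * (1 + z) powr of_real \<alpha> * (1 - z) powr (- of_real \<alpha>))"
proof -
  have re: "0 < Re (1 + z)" "0 < Re (1 - z)"
    using abs_Re_le_cmod[of z] z by auto
  then have nz: "1 + z \<noteq> 0" "1 - z \<noteq> 0" by (metis less_irrefl zero_complex.sel(1))+
  \<comment> \<open>Both logarithms have imaginary part below pi/2 in modulus, so their difference
    is the principal logarithm of the quotient, and the product of powers becomes exp (\<alpha>
    d).\<close>
  define d where "d = Ln (1 + z) - Ln (1 - z)"
  have "\<bar>Im (Ln (1 + z))\<bar> < pi / 2" "\<bar>Im (Ln (1 - z))\<bar> < pi / 2"
    using Re_Ln_pos_lt[OF nz(1)] Re_Ln_pos_lt[OF nz(2)] re by auto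
  then have "- pi < Im d" "Im d \<le> pi" by (auto simp: d_def)
  then have Ln_d: "Ln (exp d) = d" by (rule Ln_exp)
  have "exp d = (1 + z) / (1 - z)" using nz by (simp add: d_def exp_diff)
  moreover have "0 < Re ((1 + z) / (1 - z))"
  proof -
    have "(norm z)\<^sup>2 < 1" using z by (simp add: power_less_one_iff)
    then have "(Re z)\<^sup>2 + (Im z)\<^sup>2 < 1" by (simp only: cmod_power2)
    then have "0 < Re ((1 + z) * cnj (1 - z))"
      by (simp add: power2_eq_square algebra_simps)
    then show ?thesis using nz(2) by (simp add: Re_complex_div_gt_0)
  qed
  ultimately have "0 < Re (exp d)" by simp
  then have "\<bar>Im (Ln (exp d))\<bar> < pi / 2" using Re_Ln_pos_lt exp_not_eq_zero by blast
  then have "\<bar>Im d\<bar> < pi / 2" unfolding Ln_d .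
  moreover have "\<alpha> * \<bar>Im d\<bar> \<le> 1 * \<bar>Im d\<bar>" using \<alpha> by (intro mult_right_mono) auto
  ultimately have "\<bar>\<alpha> * Im d\<bar> \<le> pi / 2" using \<alpha> by (simp add: abs_mult)
  then have c: "0 \<le> cos (\<alpha> * Im d)" by (intro cos_ge_zero) auto
  have "(1 + z) powr of_real \<alpha> * (1 - z) powr (- of_real \<alpha>) = exp (of_real \<alpha> * d)"
    using nz by (simp add: powr_def d_def exp_add[symmetric] right_diff_distrib)
  then have eq: "of_real (2 powr (-\<alpha>)) * (1 + z) powr of_real \<alpha> * (1 - z) powr (- of_real \<alpha>)
      = of_real (2 powr (-\<alpha>)) * exp (of_real \<alpha> * d)" by (simp only: mult.assoc)
  show ?thesis unfolding eq using c by (simp add: Re_exp)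
qed

lemma trap_weight_abs_summable:
  assumes "0 \<le> r" "r < 1"
  shows "summable (\<lambda>m. \<bar>trap_weight \<alpha> m * r ^ m\<bar>)"
proof -
  obtain y where y: "r < y" "y < 1" using assms dense by blast
  have "summable (\<lambda>m. trap_weight \<alpha> m * y ^ m)"
    using trap_weight_generates[of \<alpha>] y assms
    unfolding generates_trap_weights_def by (meson abs_less_iff minus_less_iff less_trans order_le_less_trans neg_less_0_iff_less sums_summable zero_less_one le_less_trans)
  then show ?thesis
    using powser_insidea[of "trap_weight \<alpha>" y r] y assms by simp
qed

lemma trap_weight_cos_nonneg:
  assumes \<alpha>: "0 < \<alpha>" "\<alpha> < 1" and r: "0 \<le> r" "r < 1"
  shows "0 \<le> (\<Sum>m. trap_weight \<alpha> m * r ^ m * cos (real m * \<theta>))"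
proof -
  have z: "norm (rcis r \<theta>) < 1" using r by simp
  have "(\<lambda>m. complex_of_real (trap_weight \<alpha> m) * rcis r \<theta> ^ m) sums
     (of_real (2 powr (-\<alpha>)) * (1 + rcis r \<theta>) powr of_real \<alpha> * (1 - rcis r \<theta>) powr (- of_real \<alpha>))"
    using trap_generating_complex[OF z, of \<alpha>] by (simp only: trap_weight_eq)
  from sums_Re[OF this] have sums: "(\<lambda>m. trap_weight \<alpha> m * r ^ m * cos (real m * \<theta>)) sums
     Re (of_real (2 powr (-\<alpha>)) * (1 + rcis r \<theta>) powr of_real \<alpha> * (1 - rcis r \<theta>) powr (- of_real \<alpha>))"
    by (simp add: DeMoivre2 mult.assoc)
  show ?thesis
    unfolding sums_unique[OF sums, symmetric] by (rule Re_trap_generating_nonneg[OF \<alpha> z])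
qed

lemma has_integral_cos_int:
  "((\<lambda>\<theta>. cos (of_int i * \<theta>)) has_integral (if i = 0 then 2 * pi else 0)) {0..2 * pi}"
proof (cases "i = 0")
  case True
  then show ?thesis using has_integral_const_real[of "1::real" 0 "2 * pi"] by simp
next
  case False
  have "((\<lambda>\<theta>. cos (of_int i * \<theta>)) has_integral (sin (of_int i * (2 * pi)) / of_int i - sin (of_int i * 0) / of_int i)) {0..2 * pi}"
    using False
    by (intro fundamental_theorem_of_calculus)
       (auto intro!: derivative_eq_intros simp flip: has_real_derivative_iff_has_vector_derivative)
  moreover have "sin (of_int i * (2 * pi)) = 0"
    using sin_int_2pin[of i] by (simp add: mult_ac)
  ultimately show ?thesis using False by simp
qed

lemma has_integral_cos_cos_int:
  "((\<lambda>\<theta>. cos (of_int i * \<theta>) * cos (of_int j * \<theta>)) has_integral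
     pi * (of_bool (i = j) + of_bool (i = - j))) {0..2 * pi}"
proof -
  have "((\<lambda>\<theta>. 1/2 * (cos (of_int (i - j) * \<theta>) + cos (of_int (i + j) * \<theta>))) has_integral
     1/2 * ((if i - j = 0 then 2 * pi else 0) + (if i + j = 0 then 2 * pi else 0))) {0..2 * pi}"
    by (intro has_integral_mult_right has_integral_add has_integral_cos_int)
  moreover have "1/2 * (cos (of_int (i - j) * \<theta>) + cos (of_int (i + j) * \<theta>)) = cos (of_int i * \<theta>) * cos (of_int j * \<theta>)"
    for \<theta> :: real
    by (simp add: cos_times_cos left_diff_distrib distrib_right)
  ultimately show ?thesis
    by (rule_tac has_integral_eq_rhs) (auto simp: add_eq_0_iff2 mult.commute[of pi])
qed

text \<open>
  Herglotz' argument: the integral over the circle of the truncated symbol against the quadratic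
  form of the modulated sequence is \<open>2\<pi>\<close> times the Toeplitz form, and the truncated symbol is
  nonnegative up to an arbitrarily small error.
\<close>

lemma causal_toeplitz_form_nonneg:
  fixes \<nu> :: "nat \<Rightarrow> real" and a :: "nat \<Rightarrow> nat \<Rightarrow> real"
  assumes sm: "summable (\<lambda>m. \<bar>\<nu> m\<bar>)"
    and symbol: "\<And>\<theta>. 0 \<le> (\<Sum>m. \<nu> m * cos (real m * \<theta>))"
    and sym: "\<And>n p. a n p = a p n"
    and form: "\<And>\<theta>. 0 \<le> (\<Sum>n\<le>N. \<Sum>p\<le>N. a n p * cos (of_int (int n - int p) * \<theta>))"
  shows "0 \<le> (\<Sum>n\<le>N. \<Sum>p\<le>n. \<nu> (n - p) * a n p)"
proof -
  define Q where "Q \<theta> = (\<Sum>n\<le>N. \<Sum>p\<le>N. a n p * cos (of_int (int n - int p) * \<theta>))" for \<theta>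
  define g where "g n p = (if p \<le> n then \<nu> (n - p) else 0)" for n p
  define T where "T = (\<Sum>n\<le>N. \<Sum>p\<le>n. \<nu> (n - p) * a n p)"
  have T: "T = (\<Sum>n\<le>N. \<Sum>p\<le>N. a n p * g n p)"
    unfolding T_def g_def by (intro sum.cong refl sum.mono_neutral_cong_left) auto
  have "0 \<le> 2 * pi * T + \<epsilon> * (2 * pi * (\<Sum>n\<le>N. a n n))" if eps: "0 < \<epsilon>" for \<epsilon>
  proof -
    obtain M where M: "\<And>n. n \<ge> M \<Longrightarrow> norm (\<Sum>i. \<bar>\<nu> (i + n)\<bar>) < \<epsilon>"
      using suminf_exist_split[OF eps sm] by blast
    \<comment> \<open>Beyond M the neglected tail is below \<open>\<epsilon>\<close>; keeping all
      lags up to N makes the truncation invisible to the finite form.\<close>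
    define L where "L = max M (Suc N)"
    define h where "h \<theta> = (\<Sum>l<L. \<nu> l * cos (of_int (int l) * \<theta>))" for \<theta>
    have h_ge: "- \<epsilon> \<le> h \<theta>" for \<theta>
    proof -
      have s: "summable (\<lambda>m. \<nu> m * cos (real m * \<theta>))"
        by (rule summable_comparison_test'[OF sm, of 0]) (auto simp: abs_mult intro!: mult_left_le)
      have sL: "summable (\<lambda>m. \<bar>\<nu> (m + L)\<bar>)" by (rule summable_ignore_initial_segment[OF sm])
      have sL': "summable (\<lambda>m. \<nu> (m + L) * cos (real (m + L) * \<theta>))"
        by (rule summable_ignore_initial_segment[OF s])
      have "(\<Sum>m. \<nu> (m + L) * cos (real (m + L) * \<theta>)) \<le> (\<Sum>m. \<bar>\<nu> (m + L)\<bar>)"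
      proof (rule suminf_le[OF _ sL' sL])
        fix m
        have "\<bar>\<nu> (m + L) * cos (real (m + L) * \<theta>)\<bar> \<le> \<bar>\<nu> (m + L)\<bar>"
          unfolding abs_mult by (intro mult_left_le) auto
        then show "\<nu> (m + L) * cos (real (m + L) * \<theta>) \<le> \<bar>\<nu> (m + L)\<bar>" by linarith
      qed
      also have "\<dots> < \<epsilon>" using M[of L] by (simp add: L_def)
      finally show ?thesis
        using symbol[of \<theta>] suminf_split_initial_segment[OF s, of L] by (simp add: h_def)
    qed
    have iQ: "(Q has_integral (\<Sum>n\<le>N. \<Sum>p\<le>N. a n p * (if int n - int p = 0 then 2 * pi else 0))) {0..2 * pi}"
      unfolding Q_def by (intro has_integral_sum has_integral_mult_right has_integral_cos_int) auto
    have "((\<lambda>\<theta>. \<Sum>n\<le>N. \<Sum>p\<le>N. \<Sum>l<L. \<nu> l * a n p * (cos (of_int (int l) * \<theta>) * cos (of_int (int n - int p) * \<theta>)))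
        has_integral (\<Sum>n\<le>N. \<Sum>p\<le>N. \<Sum>l<L. \<nu> l * a n p *
          (pi * (of_bool (int l = int n - int p) + of_bool (int l = - (int n - int p)))))) {0..2 * pi}"
      by (intro has_integral_sum has_integral_mult_right has_integral_cos_cos_int) auto
    moreover have "(\<Sum>n\<le>N. \<Sum>p\<le>N. \<Sum>l<L. \<nu> l * a n p * (cos (of_int (int l) * \<theta>) * cos (of_int (int n - int p) * \<theta>)))
        = h \<theta> * Q \<theta>" for \<theta>
      unfolding Q_def h_def by (simp add: sum_distrib_left sum_distrib_right mult_ac)
    ultimately have ihQ: "((\<lambda>\<theta>. h \<theta> * Q \<theta>) has_integral (\<Sum>n\<le>N. \<Sum>p\<le>N. \<Sum>l<L. \<nu> l * a n p *
          (pi * (of_bool (int l = int n - int p) + of_bool (int l = - (int n - int p)))))) {0..2 * pi}"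
      by simp
    have pick: "(\<Sum>l<L. \<nu> l * of_bool (int l = int n - int p)) = g n p" if "n \<le> N" for n p
    proof (cases "p \<le> n")
      case True
      then have "(\<Sum>l<L. \<nu> l * of_bool (int l = int n - int p)) = (\<Sum>l\<in>{n - p}. \<nu> l * of_bool (int l = int n - int p))"
        using that by (intro sum.mono_neutral_right) (auto simp: L_def)
      then show ?thesis using True by (simp add: g_def of_nat_diff)
    qed (auto simp: g_def intro!: sum.neutral)
    have "(\<Sum>n\<le>N. \<Sum>p\<le>N. \<Sum>l<L. \<nu> l * a n p * (pi * (of_bool (int l = int n - int p) + of_bool (int l = - (int n - int p)))))
        = (\<Sum>n\<le>N. \<Sum>p\<le>N. pi * a n p * (g n p + g p n))"
    proof (intro sum.cong refl)
      fix n p assume "n \<in> {..N}" "p \<in> {..N}"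
      then have "g n p + g p n = (\<Sum>l<L. \<nu> l * (of_bool (int l = int n - int p) + of_bool (int l = - (int n - int p))))"
        using pick[of n p] pick[of p n] by (simp add: distrib_left sum.distrib)
      then show "(\<Sum>l<L. \<nu> l * a n p * (pi * (of_bool (int l = int n - int p) + of_bool (int l = - (int n - int p)))))
          = pi * a n p * (g n p + g p n)"
        by (simp add: sum_distrib_left mult_ac)
    qed
    \<comment> \<open>The product of cosines selects the lag l both as n - p and as p - n. By
      symmetry of \<open>a\<close> the two contributions coincide, hence 2 pi T.\<close>
    also have "\<dots> = pi * (T + (\<Sum>n\<le>N. \<Sum>p\<le>N. a n p * g p n))"
      unfolding T by (simp add: sum_distrib_left sum.distrib distrib_left mult.assoc)
    also have "(\<Sum>n\<le>N. \<Sum>p\<le>N. a n p * g p n) = T"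
      unfolding T by (subst sum.swap) (simp add: sym)
    finally have hQ: "((\<lambda>\<theta>. h \<theta> * Q \<theta>) has_integral 2 * pi * T) {0..2 * pi}"
      using ihQ by (simp add: mult_ac)
    have "(\<Sum>n\<le>N. \<Sum>p\<le>N. a n p * (if int n - int p = 0 then 2 * pi else 0)) = 2 * pi * (\<Sum>n\<le>N. a n n)"
      by (simp add: if_distrib[of "\<lambda>x. _ * x"] sum.delta sum_distrib_left mult_ac cong: if_cong)
    with iQ have "((\<lambda>\<theta>. \<epsilon> * Q \<theta>) has_integral \<epsilon> * (2 * pi * (\<Sum>n\<le>N. a n n))) {0..2 * pi}"
      by (intro has_integral_mult_right) simp
    from has_integral_add[OF hQ this] show ?thesis
    proof (rule has_integral_nonneg)
      fix \<theta> :: real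
      have "0 \<le> (h \<theta> + \<epsilon>) * Q \<theta>" using h_ge[of \<theta>] form[of \<theta>] by (simp add: Q_def)
      then show "0 \<le> h \<theta> * Q \<theta> + \<epsilon> * Q \<theta>" by (simp add: distrib_right)
    qed
  qed
  then have bound: "0 \<le> T + \<epsilon> * (\<Sum>n\<le>N. a n n)" if "0 < \<epsilon>" for \<epsilon>
  proof -
    have "0 \<le> 2 * pi * (T + \<epsilon> * (\<Sum>n\<le>N. a n n))"
      using \<open>\<And>\<epsilon>. 0 < \<epsilon> \<Longrightarrow> 0 \<le> 2 * pi * T + \<epsilon> * (2 * pi * (\<Sum>n\<le>N. a n n))\<close>[OF that]
      by (simp only: distrib_left mult.left_commute)
    then show ?thesis using pi_gt_zero by (simp add: zero_le_mult_iff)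
  qed
  \<comment> \<open>Only the diagonal of \<open>a\<close> multiplies \<open>\<epsilon>\<close>, and
    it does not depend on the truncation.\<close>
  have "((\<lambda>\<epsilon>. T + \<epsilon> * (\<Sum>n\<le>N. a n n)) \<longlongrightarrow> T + 0 * (\<Sum>n\<le>N. a n n)) (at_right 0)"
    by (intro tendsto_intros)
  then have "0 \<le> T + 0 * (\<Sum>n\<le>N. a n n)"
    by (rule tendsto_lowerbound) (auto intro!: bound eventually_at_rightI[of 0 1])
  then show ?thesis by (simp add: T_def)
qed

lemma linear_combination_in_domain:
  assumes "densely_defined_linear D B" "\<And>i. i \<in> I \<Longrightarrow> v i \<in> D"
  shows "(\<Sum>i\<in>I. c i *\<^sub>R v i) \<in> D" "B (\<Sum>i\<in>I. c i *\<^sub>R v i) = (\<Sum>i\<in>I. c i *\<^sub>R B (v i))"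
proof -
  have sub: "subspace D" and add: "\<And>x y. x \<in> D \<Longrightarrow> y \<in> D \<Longrightarrow> B (x + y) = B x + B y"
    and scale: "\<And>r x. x \<in> D \<Longrightarrow> B (r *\<^sub>R x) = r *\<^sub>R B x"
    using assms(1) by (auto simp: densely_defined_linear_def)
  have *: "(\<Sum>i\<in>J. c i *\<^sub>R v i) \<in> D" if "\<And>i. i \<in> J \<Longrightarrow> v i \<in> D" for J
    using sub that by (intro subspace_sum subspace_scale)
  then show "(\<Sum>i\<in>I. c i *\<^sub>R v i) \<in> D" using assms(2) .
  have zero: "B 0 = 0" using scale[OF subspace_0[OF sub], of 0] by simp
  show "B (\<Sum>i\<in>I. c i *\<^sub>R v i) = (\<Sum>i\<in>I. c i *\<^sub>R B (v i))"
    using assms(2)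
  proof (induction I rule: infinite_finite_induct)
    case (insert i I)
    then show ?case using * sub by (simp add: add scale subspace_scale)
  qed (simp_all add: zero)
qed

lemma self_adjoint_symmetric:
  assumes "self_adjoint_op D B" "x \<in> D" "y \<in> D"
  shows "B x \<bullet> y = x \<bullet> B y"
proof -
  have "(y, B y) \<in> adjoint_graph D B" using assms by (auto simp: self_adjoint_op_def)
  then show ?thesis using assms(2) by (simp add: adjoint_graph_def)
qed

text \<open>The weight factors as s^(2n) = s^(n - p) s^n s^p: the first factor damps the convolution
  weights to an absolutely summable sequence, the other two leave a symmetric form.\<close>

lemma trap_convolution_positive:
  assumes \<alpha>: "0 < \<alpha>" "\<alpha> < 1" and B: "self_adjoint_op D B" "positive_op D B"
    and w: "\<And>n. w n \<in> D" and s: "0 \<le> s" "s < 1"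
  shows "0 \<le> (\<Sum>n\<le>N. s ^ (2 * n) * ((\<Sum>p\<le>n. trap_weight \<alpha> (n - p) *\<^sub>R B (w p)) \<bullet> w n))"
proof -
  have lin: "densely_defined_linear D B" using B(1) by (simp add: self_adjoint_op_def)
  define a where "a n p = s ^ n * s ^ p * (B (w p) \<bullet> w n)" for n p
  have "0 \<le> (\<Sum>n\<le>N. \<Sum>p\<le>n. (trap_weight \<alpha> (n - p) * s ^ (n - p)) * a n p)"
  proof (rule causal_toeplitz_form_nonneg)
    show "summable (\<lambda>m. \<bar>trap_weight \<alpha> m * s ^ m\<bar>)" by (rule trap_weight_abs_summable[OF s])
    show "0 \<le> (\<Sum>m. trap_weight \<alpha> m * s ^ m * cos (real m * \<theta>))" for \<theta>
      by (rule trap_weight_cos_nonneg[OF \<alpha> s])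
    show "a n p = a p n" for n p
    proof -
      have "B (w p) \<bullet> w n = B (w n) \<bullet> w p"
        using self_adjoint_symmetric[OF B(1) w w] inner_commute by metis
      then show ?thesis by (simp add: a_def)
    qed
    show "0 \<le> (\<Sum>n\<le>N. \<Sum>p\<le>N. a n p * cos (of_int (int n - int p) * \<theta>))" for \<theta>
    proof -
      define c where "c n = s ^ n * cos (real n * \<theta>)" for n
      define d where "d n = s ^ n * sin (real n * \<theta>)" for n
      have sq: "B (\<Sum>p\<le>N. e p *\<^sub>R w p) \<bullet> (\<Sum>n\<le>N. e n *\<^sub>R w n)
          = (\<Sum>n\<le>N. \<Sum>p\<le>N. e n * e p * (B (w p) \<bullet> w n))" for e :: "nat \<Rightarrow> real"
        using linear_combination_in_domain(2)[OF lin, of "{..N}" w e] w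
        by (simp add: inner_sum_left inner_sum_right sum_distrib_left mult_ac)
      \<comment> \<open>The addition theorem turns the modulated form into \<open>B\<close> tested
        on two real combinations, so positivity applies without complexifying the space.\<close>
      have "a n p * cos (of_int (int n - int p) * \<theta>) = c n * c p * (B (w p) \<bullet> w n) + d n * d p * (B (w p) \<bullet> w n)" for n p
        by (simp add: a_def c_def d_def left_diff_distrib cos_diff algebra_simps)
      then have "(\<Sum>n\<le>N. \<Sum>p\<le>N. a n p * cos (of_int (int n - int p) * \<theta>))
          = B (\<Sum>p\<le>N. c p *\<^sub>R w p) \<bullet> (\<Sum>n\<le>N. c n *\<^sub>R w n) + B (\<Sum>p\<le>N. d p *\<^sub>R w p) \<bullet> (\<Sum>n\<le>N. d n *\<^sub>R w n)"
        unfolding sq by (simp add: sum.distrib)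
      also have "0 \<le> \<dots>"
        using B(2) linear_combination_in_domain(1)[OF lin, of "{..N}" w] w
        unfolding positive_op_def by (intro add_nonneg_nonneg) blast+
      finally show ?thesis .
    qed
  qed
  also have "\<dots> = (\<Sum>n\<le>N. s ^ (2 * n) * ((\<Sum>p\<le>n. trap_weight \<alpha> (n - p) *\<^sub>R B (w p)) \<bullet> w n))"
  proof (intro sum.cong refl)
    fix n
    have "(trap_weight \<alpha> (n - p) * s ^ (n - p)) * a n p = s ^ (2 * n) * (trap_weight \<alpha> (n - p) * (B (w p) \<bullet> w n))"
      if "p \<le> n" for p
    proof -
      have "s ^ (n - p) * s ^ p = s ^ n" using that by (simp flip: power_add)
      then have "s ^ (n - p) * (s ^ n * s ^ p) = s ^ (2 * n)"
        unfolding mult_2 power_add by (metis mult.assoc mult.commute)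
      then show ?thesis unfolding a_def by (metis mult.assoc mult.commute)
    qed
    then show "(\<Sum>p\<le>n. (trap_weight \<alpha> (n - p) * s ^ (n - p)) * a n p)
        = s ^ (2 * n) * ((\<Sum>p\<le>n. trap_weight \<alpha> (n - p) *\<^sub>R B (w p)) \<bullet> w n)"
      unfolding inner_sum_left sum_distrib_left inner_scaleR_left by (intro sum.cong) auto
  qed
  finally show ?thesis .
qed

subsection \<open>The Peano kernel\<close>

text \<open>Pairing with F b - F a reduces the claim to the real fundamental theorem of calculus,
  which supplies integrability of the paired derivative; one factor of the norm is then
  cancelled.\<close>

lemma norm_diff_le_integral:
  fixes F :: "real \<Rightarrow> 'a::real_inner"
  assumes "a \<le> b" and cont: "continuous_on {a..b} F"
    and deriv: "\<And>x. a < x \<Longrightarrow> x < b \<Longrightarrow> (F has_vector_derivative F' x) (at x)"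
    and bound: "\<And>x. a < x \<Longrightarrow> x < b \<Longrightarrow> norm (F' x) \<le> G x"
    and G: "\<And>x. 0 \<le> G x" "G integrable_on {a..b}"
  shows "norm (F b - F a) \<le> integral {a..b} G"
proof -
  define y where "y = F b - F a"
  \<comment> \<open>The derivative and its bound are known only in the open interval; the value 0 at
    the ends makes the majorant valid on all of it.\<close>
  define h where "h x = (if a < x \<and> x < b then F' x \<bullet> y else 0)" for x
  have h: "(h has_integral (F b \<bullet> y - F a \<bullet> y)) {a..b}"
    using \<open>a \<le> b\<close>
  proof (rule fundamental_theorem_of_calculus_interior)
    show "continuous_on {a..b} (\<lambda>x. F x \<bullet> y)" by (intro continuous_intros cont)
    show "((\<lambda>x. F x \<bullet> y) has_vector_derivative h x) (at x)" if "x \<in> {a<..<b}" for x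
      using that bounded_linear.has_vector_derivative[OF bounded_linear_inner_left deriv, of x y]
      by (simp add: h_def)
  qed
  have "norm (integral {a..b} h) \<le> integral {a..b} (\<lambda>x. G x * norm y)"
  proof (rule integral_norm_bound_integral)
    show "h integrable_on {a..b}" using h by blast
    show "(\<lambda>x. G x * norm y) integrable_on {a..b}" using G(2) by (rule integrable_on_mult_left)
    show "norm (h x) \<le> G x * norm y" for x
      using bound[of x] G(1)[of x] Cauchy_Schwarz_ineq2[of "F' x" y] mult_right_mono[of "norm (F' x)" "G x" "norm y"]
      by (auto simp: h_def intro: order_trans)
  qed
  also have "\<dots> = integral {a..b} G * norm y" by (rule integral_mult_left)
  finally have "norm y * norm y \<le> integral {a..b} G * norm y"
    using h by (simp add: integral_unique y_def[symmetric] inner_diff_left[symmetric] power2_norm_eq_inner[symmetric] power2_eq_square)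
  moreover have "0 \<le> integral {a..b} G" using G by (intro integral_nonneg) auto
  ultimately show ?thesis
    unfolding y_def[symmetric] using zero_less_norm_iff[of y] by (cases "y = 0") auto
qed

text \<open>The inequality is a closed condition in y, so it passes from \<open>D\<close> to y =
  v.\<close>

lemma norm_le_of_dense_inner:
  fixes v :: "'a::real_inner"
  assumes "closure D = UNIV" "0 \<le> K" "\<And>y. y \<in> D \<Longrightarrow> v \<bullet> y \<le> K * norm y"
  shows "norm v \<le> K"
proof -
  have "closed {y. v \<bullet> y \<le> K * norm y}"
    by (intro closed_Collect_le continuous_intros)
  then have "closure D \<subseteq> {y. v \<bullet> y \<le> K * norm y}"
    using assms(3) by (intro closure_minimal) auto
  then have "v \<bullet> v \<le> K * norm v"
    using assms(1) by auto
  then have "norm v * norm v \<le> K * norm v"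
    by (simp add: dot_square_norm power2_eq_square)
  then show ?thesis using assms(2) by (cases "v = 0") auto
qed

section \<open>Peano representation and error bound for scalar functions\<close>

context
  fixes \<alpha> :: real and g g1 g2 :: "real \<Rightarrow> real"
  assumes \<alpha>: "0 < \<alpha>" "\<alpha> < 1"
    and g: "\<And>t. 0 \<le> t \<Longrightarrow> (g has_vector_derivative g1 t) (at t within {0..})"
    and g1_cont: "continuous_on {0..} g1"
    and g1: "\<And>t. 0 < t \<Longrightarrow> (g1 has_vector_derivative g2 t) (at t)"
begin

lemma g_deriv: "0 < t \<Longrightarrow> (g has_real_derivative g1 t) (at t)"
  using g[of t] at_within_interior[of t "{0..}"] by (simp add: has_real_derivative_iff_has_vector_derivative interior_real_atLeast)

lemma g1_deriv: "0 < t \<Longrightarrow> (g1 has_real_derivative g2 t) (at t)"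
  using g1[of t] by (simp add: has_real_derivative_iff_has_vector_derivative)

lemma g_cont: "continuous_on {0..} g"
  unfolding continuous_on_eq_continuous_within using has_vector_derivative_continuous[OF g] by auto

lemma taylor_has_integral:
  assumes "0 \<le> T"
  shows "((\<lambda>s. (T - s) * g2 s) has_integral (g T - g 0 - T * g1 0)) {0..T}"
proof -
  have "((\<lambda>s. (T - s) * g2 s) has_integral ((g T + (T - T) * g1 T) - (g 0 + (T - 0) * g1 0))) {0..T}"
    using assms
  proof (rule fundamental_theorem_of_calculus_interior)
    show "continuous_on {0..T} (\<lambda>s. g s + (T - s) * g1 s)"
      by (intro continuous_intros continuous_on_subset[OF g_cont] continuous_on_subset[OF g1_cont]) auto
    show "((\<lambda>s. g s + (T - s) * g1 s) has_vector_derivative (T - s) * g2 s) (at s)" if "s \<in> {0<..<T}" for s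
      unfolding has_real_derivative_iff_has_vector_derivative[symmetric]
      using that by (auto intro!: derivative_eq_intros g_deriv g1_deriv)
  qed
  then show ?thesis by (simp add: algebra_simps)
qed

lemma taylor_has_integral_max:
  assumes "0 \<le> a" "a \<le> T"
  shows "((\<lambda>s. max 0 (a - s) * g2 s) has_integral (g a - g 0 - a * g1 0)) {0..T}"
proof -
  have "((\<lambda>s. max 0 (a - s) * g2 s) has_integral (g a - g 0 - a * g1 0)) {0..a}"
    by (rule has_integral_eq[OF _ taylor_has_integral[OF assms(1)]]) auto
  moreover have "((\<lambda>s. max 0 (a - s) * g2 s) has_integral 0) {a..T}"
    by (rule has_integral_is_0) auto
  ultimately show ?thesis using has_integral_combine[OF assms] by fastforce
qed

lemma Gamma_shift: "Gamma (\<alpha> + 1) = \<alpha> * Gamma \<alpha>" "Gamma (\<alpha> + 2) = (\<alpha> + 1) * Gamma (\<alpha> + 1)"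
proof -
  have "\<alpha> \<notin> \<int>\<^sub>\<le>\<^sub>0" "\<alpha> + 1 \<notin> \<int>\<^sub>\<le>\<^sub>0" using \<alpha> nonpos_Ints_nonpos by fastforce+
  then show "Gamma (\<alpha> + 1) = \<alpha> * Gamma \<alpha>" "Gamma (\<alpha> + 2) = (\<alpha> + 1) * Gamma (\<alpha> + 1)"
    using Gamma_plus1[of \<alpha>] Gamma_plus1[of "\<alpha> + 1"] by (simp_all add: add.assoc)
qed

lemma Gamma_nonzero: "Gamma \<alpha> \<noteq> 0" "Gamma (\<alpha> + 1) \<noteq> 0" "Gamma (\<alpha> + 2) \<noteq> 0"
proof -
  have "Gamma x \<noteq> 0" if "0 < x" for x :: real using Gamma_real_pos[OF that] by (metis less_irrefl)
  then show "Gamma \<alpha> \<noteq> 0" "Gamma (\<alpha> + 1) \<noteq> 0" "Gamma (\<alpha> + 2) \<noteq> 0" using \<alpha> by auto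
qed

lemma continuous_on_powr_divide:
  "continuous_on A (\<lambda>s. h s powr p / c)" if "continuous_on A h" "\<And>s. s \<in> A \<Longrightarrow> 0 \<le> h s" "0 < p" "c \<noteq> 0"
    for h :: "real \<Rightarrow> real" and p c
  using that by (intro continuous_on_divide continuous_on_powr' continuous_on_const) auto

lemma powr_Gamma_deriv:
  assumes "0 < x"
  shows "((\<lambda>x. x powr \<alpha> / Gamma (\<alpha> + 1)) has_real_derivative beta \<alpha> x) (at x)"
    and "((\<lambda>x. x powr (\<alpha> + 1) / Gamma (\<alpha> + 2)) has_real_derivative x powr \<alpha> / Gamma (\<alpha> + 1)) (at x)"
proof -
  show "((\<lambda>x. x powr \<alpha> / Gamma (\<alpha> + 1)) has_real_derivative beta \<alpha> x) (at x)"
    using assms \<alpha> Gamma_nonzero by (auto intro!: derivative_eq_intros simp: beta_def Gamma_shift(1))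
  have "(\<alpha> + 1) * x powr \<alpha> / Gamma (\<alpha> + 2) = x powr \<alpha> / Gamma (\<alpha> + 1)"
    using \<alpha> by (simp add: Gamma_shift(2))
  moreover have "((\<lambda>x. x powr (\<alpha> + 1)) has_real_derivative (\<alpha> + 1) * x powr \<alpha>) (at x)"
    using assms by (auto intro!: derivative_eq_intros)
  ultimately show "((\<lambda>x. x powr (\<alpha> + 1) / Gamma (\<alpha> + 2)) has_real_derivative x powr \<alpha> / Gamma (\<alpha> + 1)) (at x)"
    using DERIV_cdivide by metis
qed

lemma integral_beta: "0 \<le> T \<Longrightarrow> integral {0..T} (beta \<alpha>) = T powr \<alpha> / Gamma (\<alpha> + 1)"
proof -
  assume T: "0 \<le> T"
  have "(beta \<alpha> has_integral (T powr \<alpha> / Gamma (\<alpha> + 1) - 0 powr \<alpha> / Gamma (\<alpha> + 1))) {0..T}"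
    using T
  proof (rule fundamental_theorem_of_calculus_interior)
    show "continuous_on {0..T} (\<lambda>x. x powr \<alpha> / Gamma (\<alpha> + 1))"
      using \<alpha> Gamma_nonzero by (intro continuous_on_powr_divide continuous_intros) auto
    show "((\<lambda>x. x powr \<alpha> / Gamma (\<alpha> + 1)) has_vector_derivative beta \<alpha> x) (at x)" if "x \<in> {0<..<T}" for x
      using that powr_Gamma_deriv(1) by (simp flip: has_real_derivative_iff_has_vector_derivative)
  qed
  then show ?thesis by (simp add: integral_unique)
qed

text \<open>Two integrations by parts against the successive antiderivatives V1, V2 of the kernel.
  Both vanish at s = T and are continuous there, so the singularity of \<open>beta\<close> leaves no
  boundary term.\<close>

lemma convolution_taylor:
  assumes T: "0 \<le> T" and int: "(\<lambda>s. beta \<alpha> (T - s) * g s) integrable_on {0..T}"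
  shows "((\<lambda>s. (T - s) powr (\<alpha> + 1) / Gamma (\<alpha> + 2) * g2 s) has_integral
     (integral {0..T} (\<lambda>s. beta \<alpha> (T - s) * g s) - T powr \<alpha> / Gamma (\<alpha> + 1) * g 0
      - T powr (\<alpha> + 1) / Gamma (\<alpha> + 2) * g1 0)) {0..T}"
proof -
  define V1 where "V1 x = x powr \<alpha> / Gamma (\<alpha> + 1)" for x
  define V2 where "V2 x = x powr (\<alpha> + 1) / Gamma (\<alpha> + 2)" for x
  define F where "F s = V1 (T - s) * g s + V2 (T - s) * g1 s" for s
  have "((\<lambda>s. - (beta \<alpha> (T - s) * g s) + V2 (T - s) * g2 s) has_integral (F T - F 0)) {0..T}"
    using T
  proof (rule fundamental_theorem_of_calculus_interior)
    show "continuous_on {0..T} F"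
      unfolding F_def V1_def V2_def
      using \<alpha> Gamma_nonzero
      by (intro continuous_on_add continuous_on_mult continuous_on_powr_divide continuous_on_diff continuous_on_const
          continuous_on_id continuous_on_subset[OF g_cont] continuous_on_subset[OF g1_cont]) auto
    show "(F has_vector_derivative - (beta \<alpha> (T - s) * g s) + V2 (T - s) * g2 s) (at s)" if s: "s \<in> {0<..<T}" for s
    proof -
      have "((\<lambda>s. V1 (T - s)) has_real_derivative beta \<alpha> (T - s) * (0 - 1)) (at s)"
        unfolding V1_def using s by (intro DERIV_chain2[OF powr_Gamma_deriv(1)] derivative_intros) auto
      moreover have "((\<lambda>s. V2 (T - s)) has_real_derivative V1 (T - s) * (0 - 1)) (at s)"
        unfolding V1_def V2_def using s by (intro DERIV_chain2[OF powr_Gamma_deriv(2)] derivative_intros) auto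
      ultimately show ?thesis
        unfolding F_def has_real_derivative_iff_has_vector_derivative[symmetric]
        using s by (auto intro!: derivative_eq_intros g_deriv g1_deriv)
    qed
  qed
  from has_integral_add[OF this integrable_integral[OF int]]
  have "((\<lambda>s. V2 (T - s) * g2 s) has_integral (F T - F 0 + integral {0..T} (\<lambda>s. beta \<alpha> (T - s) * g s))) {0..T}"
    by simp
  moreover have "F T = 0" by (simp add: F_def V1_def V2_def)
  ultimately show ?thesis by (simp add: F_def V1_def V2_def algebra_simps)
qed

text \<open>The integral and every node value are expanded to second order at 0. The g(0) terms
  cancel because \<open>kappa\<close> makes the rule exact on constants; linear functions are not
  integrated exactly, which leaves the term with g'(0).\<close>

lemma peano_representation:
  assumes k: "0 < k" and int: "(\<lambda>s. beta \<alpha> (real n * k - s) * g s) integrable_on {0..real n * k}"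
  shows "((\<lambda>s. k powr (\<alpha> + 1) * trap_defect \<alpha> n ((real n * k - s) / k) * g2 s) has_integral
     (integral {0..real n * k} (\<lambda>s. beta \<alpha> (real n * k - s) * g s) - cq \<alpha> k (\<lambda>p. g (real p * k)) n
      - g1 0 * (k powr (\<alpha> + 1) * trap_defect \<alpha> n (real n)))) {0..real n * k}"
proof -
  define T where "T = real n * k"
  have T: "0 \<le> T" using k by (simp add: T_def)
  have kp: "k powr (\<alpha> + 1) = k powr \<alpha> * k" using k by (simp add: powr_add)
  have scale: "k * max 0 ((T - s) / k - real m) = max 0 (real (n - m) * k - s)" if "m \<le> n" for m s
    using k that by (simp add: T_def max_def field_simps of_nat_diff)
  have "((\<lambda>s. (T - s) powr (\<alpha> + 1) / Gamma (\<alpha> + 2) * g2 s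
        - k powr \<alpha> * (\<Sum>m\<le>n. trap_weight \<alpha> m * (max 0 (real (n - m) * k - s) * g2 s))) has_integral
      ((integral {0..T} (\<lambda>s. beta \<alpha> (T - s) * g s) - T powr \<alpha> / Gamma (\<alpha> + 1) * g 0 - T powr (\<alpha> + 1) / Gamma (\<alpha> + 2) * g1 0)
        - k powr \<alpha> * (\<Sum>m\<le>n. trap_weight \<alpha> m * (g (real (n - m) * k) - g 0 - real (n - m) * k * g1 0)))) {0..T}"
    using k int
    by (intro has_integral_diff has_integral_mult_right has_integral_sum convolution_taylor[OF T] taylor_has_integral_max)
       (auto simp: T_def intro: mult_right_mono)
  moreover have "(T - s) powr (\<alpha> + 1) / Gamma (\<alpha> + 2) * g2 s
        - k powr \<alpha> * (\<Sum>m\<le>n. trap_weight \<alpha> m * (max 0 (real (n - m) * k - s) * g2 s))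
      = k powr (\<alpha> + 1) * trap_defect \<alpha> n ((T - s) / k) * g2 s" if "s \<in> {0..T}" for s
  proof -
    have "k powr (\<alpha> + 1) * ((T - s) / k) powr (\<alpha> + 1) = (T - s) powr (\<alpha> + 1)"
      using k that by (simp add: powr_divide)
    moreover have "k powr (\<alpha> + 1) * (\<Sum>m\<le>n. trap_weight \<alpha> m * max 0 ((T - s) / k - real m))
        = k powr \<alpha> * (\<Sum>m\<le>n. trap_weight \<alpha> m * max 0 (real (n - m) * k - s))"
      unfolding kp mult.assoc sum_distrib_left by (intro sum.cong refl) (subst scale[symmetric], auto)
    ultimately have "k powr (\<alpha> + 1) * trap_defect \<alpha> n ((T - s) / k)
        = (T - s) powr (\<alpha> + 1) / Gamma (\<alpha> + 2) - k powr \<alpha> * (\<Sum>m\<le>n. trap_weight \<alpha> m * max 0 (real (n - m) * k - s))"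
      by (simp add: trap_defect_def right_diff_distrib)
    then show ?thesis by (simp add: left_diff_distrib sum_distrib_right mult.assoc)
  qed
  ultimately have "((\<lambda>s. k powr (\<alpha> + 1) * trap_defect \<alpha> n ((T - s) / k) * g2 s) has_integral
      ((integral {0..T} (\<lambda>s. beta \<alpha> (T - s) * g s) - T powr \<alpha> / Gamma (\<alpha> + 1) * g 0 - T powr (\<alpha> + 1) / Gamma (\<alpha> + 2) * g1 0)
        - k powr \<alpha> * (\<Sum>m\<le>n. trap_weight \<alpha> m * (g (real (n - m) * k) - g 0 - real (n - m) * k * g1 0)))) {0..T}"
    by (rule has_integral_eq[rotated])
  moreover have "cq \<alpha> k (\<lambda>p. g (real p * k)) n
      = (T powr \<alpha> / Gamma (\<alpha> + 1) - k powr \<alpha> * (\<Sum>m\<le>n. trap_weight \<alpha> m)) * g 0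
        + k powr \<alpha> * (\<Sum>m\<le>n. trap_weight \<alpha> m * g (real (n - m) * k))"
  proof -
    have "(\<Sum>p\<le>n. trap_weight \<alpha> (n - p) * g (real p * k)) = (\<Sum>m\<le>n. trap_weight \<alpha> m * g (real (n - m) * k))"
      by (rule sum.reindex_bij_witness[of _ "\<lambda>m. n - m" "\<lambda>m. n - m"]) auto
    then show ?thesis
      using integral_beta[OF T] by (simp add: cq_def kappa_def T_def atLeast0AtMost)
  qed
  moreover have "k powr (\<alpha> + 1) * trap_defect \<alpha> n (real n) = T powr (\<alpha> + 1) / Gamma (\<alpha> + 2)
      - k powr \<alpha> * (\<Sum>m\<le>n. trap_weight \<alpha> m * (real (n - m) * k))"
  proof -
    have "k powr (\<alpha> + 1) * real n powr (\<alpha> + 1) = T powr (\<alpha> + 1)"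
      using k by (simp add: T_def powr_mult)
    moreover have "k powr (\<alpha> + 1) * (\<Sum>m\<le>n. trap_weight \<alpha> m * max 0 (real n - real m))
        = k powr \<alpha> * (\<Sum>m\<le>n. trap_weight \<alpha> m * (real (n - m) * k))"
      unfolding kp mult.assoc sum_distrib_left by (intro sum.cong) (auto simp: of_nat_diff)
    ultimately show ?thesis by (simp add: trap_defect_def right_diff_distrib)
  qed
  moreover have "(\<Sum>m\<le>n. trap_weight \<alpha> m * (g (real (n - m) * k) - g 0 - real (n - m) * k * g1 0))
      = (\<Sum>m\<le>n. trap_weight \<alpha> m * g (real (n - m) * k)) - (\<Sum>m\<le>n. trap_weight \<alpha> m) * g 0
        - (\<Sum>m\<le>n. trap_weight \<alpha> m * (real (n - m) * k)) * g1 0"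
    by (simp only: right_diff_distrib sum_subtractf sum_distrib_right mult.assoc)
  ultimately show ?thesis
    unfolding T_def[symmetric] by (elim has_integral_eq_rhs) (simp only:, simp only: algebra_simps)
qed

text \<open>In the last cell the scaled argument (T - s) / k is at most 1 and only boundedness of
  the defect helps. Before it the argument is at least 1, and the decay rescales to k^2 (T -
  s)^(\<alpha> - 1). The linear error is the same decay at argument n.\<close>

lemma scalar_quadrature_error:
  assumes C: "0 < C" "\<And>n x. 0 \<le> x \<Longrightarrow> x \<le> real n \<Longrightarrow> \<bar>trap_defect \<alpha> n x\<bar> \<le> C"
      "\<And>n x. 1 \<le> x \<Longrightarrow> x \<le> real n \<Longrightarrow> \<bar>trap_defect \<alpha> n x\<bar> \<le> C * x powr (\<alpha> - 1)"
    and k: "0 < k" and n: "1 \<le> n"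
    and int: "(\<lambda>s. beta \<alpha> (real n * k - s) * g s) integrable_on {0..real n * k}"
    and G: "G integrable_on {0..real n * k}" "\<And>s. 0 \<le> s \<Longrightarrow> \<bar>g2 s\<bar> \<le> G s"
  shows "\<bar>integral {0..real n * k} (\<lambda>s. beta \<alpha> (real n * k - s) * g s) - cq \<alpha> k (\<lambda>p. g (real p * k)) n\<bar>
     \<le> C * (k\<^sup>2 * (real n * k) powr (\<alpha> - 1) * \<bar>g1 0\<bar>
        + k powr (\<alpha> + 1) * integral {real (n - 1) * k..real n * k} G
        + k\<^sup>2 * integral {0..real (n - 1) * k} (\<lambda>s. (real n * k - s) powr (\<alpha> - 1) * G s))"
proof -
  define T where "T = real n * k"
  define S where "S = real (n - 1) * k"
  have S: "0 \<le> S" "S \<le> T" "T - S = k"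
    using k n by (auto simp: S_def T_def of_nat_diff algebra_simps)
  define K where "K s = k powr (\<alpha> + 1) * trap_defect \<alpha> n ((T - s) / k)" for s
  have kp: "k powr (\<alpha> + 1) * (x / k) powr (\<alpha> - 1) = k\<^sup>2 * x powr (\<alpha> - 1)" if "0 \<le> x" for x
  proof -
    have "k powr (\<alpha> + 1) = k powr (\<alpha> - 1) * k\<^sup>2"
      using k powr_add[of k "\<alpha> - 1" 2] by (simp add: add.commute)
    then show ?thesis using k that by (simp add: powr_divide)
  qed
  have K_near: "\<bar>K s\<bar> \<le> C * k powr (\<alpha> + 1)" if "S \<le> s" "s \<le> T" for s
    using C(2)[of "(T - s) / k" n] that S k by (simp add: K_def abs_mult T_def field_simps)
  have K_far: "\<bar>K s\<bar> \<le> C * k\<^sup>2 * (T - s) powr (\<alpha> - 1)" if "0 \<le> s" "s \<le> S" for s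
  proof -
    have "1 \<le> (T - s) / k" "(T - s) / k \<le> real n" using that S k by (auto simp: T_def field_simps)
    then have "\<bar>K s\<bar> \<le> k powr (\<alpha> + 1) * (C * ((T - s) / k) powr (\<alpha> - 1))"
      unfolding K_def abs_mult using C(3)[of "(T - s) / k" n] by (simp add: mult_left_mono)
    also have "\<dots> = C * k\<^sup>2 * (T - s) powr (\<alpha> - 1)" using kp[of "T - s"] that S by simp
    finally show ?thesis .
  qed
  define E where "E = integral {0..T} (\<lambda>s. beta \<alpha> (T - s) * g s) - cq \<alpha> k (\<lambda>p. g (real p * k)) n"
  have rep: "((\<lambda>s. K s * g2 s) has_integral (E - g1 0 * (k powr (\<alpha> + 1) * trap_defect \<alpha> n (real n)))) {0..T}"
    using peano_representation[OF k int] by (simp add: K_def E_def T_def)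
  then have iK: "(\<lambda>s. K s * g2 s) integrable_on {0..T}" by blast
  have Gnn: "0 \<le> G s" if "0 \<le> s" for s using G(2)[OF that] by simp
  have G_sub: "G integrable_on {a..b}" if "0 \<le> a" "b \<le> T" for a b
    using G(1) that unfolding T_def by (elim integrable_on_subinterval) auto
  have near: "\<bar>integral {S..T} (\<lambda>s. K s * g2 s)\<bar> \<le> C * k powr (\<alpha> + 1) * integral {S..T} G"
  proof -
    have "norm (integral {S..T} (\<lambda>s. K s * g2 s)) \<le> integral {S..T} (\<lambda>s. C * k powr (\<alpha> + 1) * G s)"
    proof (rule integral_norm_bound_integral)
      show "(\<lambda>s. K s * g2 s) integrable_on {S..T}" using iK S by (elim integrable_on_subinterval) auto
      show "(\<lambda>s. C * k powr (\<alpha> + 1) * G s) integrable_on {S..T}"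
        using G_sub[of S T] S by (intro integrable_on_mult_right) auto
      show "norm (K s * g2 s) \<le> C * k powr (\<alpha> + 1) * G s" if "s \<in> {S..T}" for s
        using K_near[of s] G(2)[of s] that S C(1) by (simp add: abs_mult mult_mono)
    qed
    then show ?thesis by simp
  qed
  have far: "\<bar>integral {0..S} (\<lambda>s. K s * g2 s)\<bar> \<le> C * k\<^sup>2 * integral {0..S} (\<lambda>s. (T - s) powr (\<alpha> - 1) * G s)"
  proof -
    have cont: "continuous_on {0..S} (\<lambda>s. (T - s) powr (\<alpha> - 1))"
      using S k by (intro continuous_intros) auto
    \<comment> \<open>On this interval T - s >= k, so the kernel is bounded and continuous and may
      multiply the absolutely integrable \<open>G\<close>.\<close>
    have "(\<lambda>s. (T - s) powr (\<alpha> - 1) * G s) absolutely_integrable_on {0..S}"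
    proof (rule absolutely_integrable_bounded_measurable_product_real)
      show "(\<lambda>s. (T - s) powr (\<alpha> - 1)) \<in> borel_measurable (lebesgue_on {0..S})"
        by (rule continuous_imp_measurable_on_sets_lebesgue[OF cont]) auto
      show "bounded ((\<lambda>s. (T - s) powr (\<alpha> - 1)) ` {0..S})"
        by (rule compact_imp_bounded[OF compact_continuous_image[OF cont]]) auto
      show "G absolutely_integrable_on {0..S}"
        using Gnn G_sub[of 0 S] S by (intro nonnegative_absolutely_integrable_1) auto
    qed auto
    then have "(\<lambda>s. (T - s) powr (\<alpha> - 1) * G s) integrable_on {0..S}"
      using absolutely_integrable_on_def by blast
    then have i: "(\<lambda>s. C * k\<^sup>2 * ((T - s) powr (\<alpha> - 1) * G s)) integrable_on {0..S}"
      by (rule integrable_on_mult_right)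
    have "norm (integral {0..S} (\<lambda>s. K s * g2 s)) \<le> integral {0..S} (\<lambda>s. C * k\<^sup>2 * ((T - s) powr (\<alpha> - 1) * G s))"
    proof (rule integral_norm_bound_integral[OF _ i])
      show "(\<lambda>s. K s * g2 s) integrable_on {0..S}" using iK S by (elim integrable_on_subinterval) auto
      show "norm (K s * g2 s) \<le> C * k\<^sup>2 * ((T - s) powr (\<alpha> - 1) * G s)" if "s \<in> {0..S}" for s
        using mult_mono[OF K_far[of s] G(2)[of s]] that C(1) by (simp add: abs_mult mult.assoc)
    qed
    then show ?thesis by simp
  qed
  have lin: "\<bar>g1 0 * (k powr (\<alpha> + 1) * trap_defect \<alpha> n (real n))\<bar> \<le> C * (k\<^sup>2 * T powr (\<alpha> - 1) * \<bar>g1 0\<bar>)"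
  proof -
    have "k powr (\<alpha> + 1) * \<bar>trap_defect \<alpha> n (real n)\<bar> \<le> k powr (\<alpha> + 1) * (C * (T / k) powr (\<alpha> - 1))"
      using C(3)[of "real n" n] n k by (intro mult_left_mono) (auto simp: T_def)
    also have "\<dots> = C * k\<^sup>2 * T powr (\<alpha> - 1)" using kp[of T] S by simp
    finally have "\<bar>g1 0\<bar> * (k powr (\<alpha> + 1) * \<bar>trap_defect \<alpha> n (real n)\<bar>) \<le> \<bar>g1 0\<bar> * (C * k\<^sup>2 * T powr (\<alpha> - 1))"
      by (rule mult_left_mono) simp
    then show ?thesis by (simp add: abs_mult mult_ac)
  qed
  have "E = g1 0 * (k powr (\<alpha> + 1) * trap_defect \<alpha> n (real n)) + integral {0..S} (\<lambda>s. K s * g2 s) + integral {S..T} (\<lambda>s. K s * g2 s)"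
    using integral_unique[OF rep] Henstock_Kurzweil_Integration.integral_combine[OF S(1,2) iK] by simp
  then have "\<bar>E\<bar> \<le> C * (k\<^sup>2 * T powr (\<alpha> - 1) * \<bar>g1 0\<bar>) + C * k powr (\<alpha> + 1) * integral {S..T} G
      + C * k\<^sup>2 * integral {0..S} (\<lambda>s. (T - s) powr (\<alpha> - 1) * G s)"
    using near far lin by linarith
  then show ?thesis by (simp only: E_def T_def S_def distrib_left mult.assoc)
qed

end

subsection \<open>Consistency errors\<close>

text \<open>A function that is not integrable has integral 0 by convention.\<close>

lemma integral_nonneg_always: "0 \<le> integral S f" if "\<And>x. x \<in> S \<Longrightarrow> 0 \<le> f x" for f :: "'a::euclidean_space \<Rightarrow> real"
  using that integral_nonneg not_integrable_integral by (metis order_refl)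

lemma inner_has_vector_derivative:
  "(f has_vector_derivative f') F \<Longrightarrow> ((\<lambda>x. f x \<bullet> y) has_vector_derivative f' \<bullet> y) F"
  by (rule bounded_linear.has_vector_derivative[OF bounded_linear_inner_left])

text \<open>
  Testing against \<open>y \<in> D\<close>, where symmetry moves \<open>B\<close> to \<open>y\<close>, avoids every question about the
  measurability of \<open>B (utt s)\<close> and about exchanging \<open>B\<close> with integrals.
\<close>

context
  fixes \<alpha> :: real and D :: "'a::real_inner set" and B :: "'a \<Rightarrow> 'a" and u ut utt :: "real \<Rightarrow> 'a"
  assumes \<alpha>: "0 < \<alpha>" "\<alpha> < 1"
    and B: "self_adjoint_op D B"
    and u: "\<And>t. 0 \<le> t \<Longrightarrow> (u has_vector_derivative ut t) (at t within {0..})"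
    and ut_cont: "continuous_on {0..} ut"
    and ut: "\<And>t. 0 < t \<Longrightarrow> (ut has_vector_derivative utt t) (at t)"
    and dom: "\<And>t. 0 \<le> t \<Longrightarrow> u t \<in> D" "ut 0 \<in> D" "\<And>t. 0 < t \<Longrightarrow> utt t \<in> D"
    and utt_int: "\<And>T. 0 < T \<Longrightarrow> (\<lambda>s. norm (B (utt s))) integrable_on {0..T}"
    and conv_int: "\<And>T. 0 < T \<Longrightarrow> (\<lambda>s. beta \<alpha> (T - s) *\<^sub>R B (u s)) integrable_on {0..T}"
begin

text \<open>The second derivative is set to 0 at t = 0, where \<open>utt\<close> is not known to lie
  in \<open>D\<close>. This keeps its bound by norm (B (utt t)) valid at the left end as
  well.\<close>

lemma weak_derivatives:
  fixes y
  defines "g \<equiv> \<lambda>t. u t \<bullet> B y" and "g1 \<equiv> \<lambda>t. ut t \<bullet> B y" and "g2 \<equiv> \<lambda>t. if 0 < t then utt t \<bullet> B y else 0"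
  shows "\<And>t. 0 \<le> t \<Longrightarrow> (g has_vector_derivative g1 t) (at t within {0..})"
    and "continuous_on {0..} g1"
    and "\<And>t. 0 < t \<Longrightarrow> (g1 has_vector_derivative g2 t) (at t)"
  using u ut ut_cont unfolding g_def g1_def g2_def
  by (auto intro!: inner_has_vector_derivative continuous_intros)

lemma weak_values:
  assumes "y \<in> D"
  shows "0 \<le> t \<Longrightarrow> u t \<bullet> B y = B (u t) \<bullet> y"
    and "\<bar>u 0 \<bullet> B y\<bar> \<le> norm (B (u 0)) * norm y"
    and "\<bar>ut 0 \<bullet> B y\<bar> \<le> norm (B (ut 0)) * norm y"
    and "\<bar>if 0 < t then utt t \<bullet> B y else 0\<bar> \<le> norm (B (utt t)) * norm y"
  using self_adjoint_symmetric[OF B dom(1) assms, of t] self_adjoint_symmetric[OF B dom(1) assms, of 0]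
    self_adjoint_symmetric[OF B dom(2) assms] self_adjoint_symmetric[OF B dom(3) assms, of t]
    Cauchy_Schwarz_ineq2[of "B (u 0)" y] Cauchy_Schwarz_ineq2[of "B (ut 0)" y] Cauchy_Schwarz_ineq2[of "B (utt t)" y]
  by auto

lemma weak_convolution:
  assumes "y \<in> D" "0 < T"
  shows "(\<lambda>s. beta \<alpha> (T - s) * (u s \<bullet> B y)) integrable_on {0..T}"
    and "integral {0..T} (\<lambda>s. beta \<alpha> (T - s) * (u s \<bullet> B y))
       = integral {0..T} (\<lambda>s. beta \<alpha> (T - s) *\<^sub>R B (u s)) \<bullet> y"
proof -
  have eq: "((\<lambda>v. v \<bullet> y) \<circ> (\<lambda>s. beta \<alpha> (T - s) *\<^sub>R B (u s))) s = beta \<alpha> (T - s) * (u s \<bullet> B y)"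
    if "s \<in> {0..T}" for s
    using that weak_values(1)[OF assms(1), of s] by simp
  show "(\<lambda>s. beta \<alpha> (T - s) * (u s \<bullet> B y)) integrable_on {0..T}"
    by (rule integrable_eq[OF integrable_linear[OF conv_int[OF assms(2)] bounded_linear_inner_left] eq])
  show "integral {0..T} (\<lambda>s. beta \<alpha> (T - s) * (u s \<bullet> B y))
       = integral {0..T} (\<lambda>s. beta \<alpha> (T - s) *\<^sub>R B (u s)) \<bullet> y"
    using integral_cong[OF eq] integral_linear[OF conv_int[OF assms(2)] bounded_linear_inner_left, of y]
    by (rule trans[OF sym])
qed

lemma domain_dense: "closure D = UNIV"
  using B by (simp add: self_adjoint_op_def densely_defined_linear_def)

text \<open>The scalar estimate is applied to t -> u t . B y = B (u t) . y. Each majorant carries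
  the factor norm y, and density of the domain turns the bound into one for the norm.\<close>

lemma quadrature_error:
  assumes C: "0 < C" "\<And>n x. 0 \<le> x \<Longrightarrow> x \<le> real n \<Longrightarrow> \<bar>trap_defect \<alpha> n x\<bar> \<le> C"
      "\<And>n x. 1 \<le> x \<Longrightarrow> x \<le> real n \<Longrightarrow> \<bar>trap_defect \<alpha> n x\<bar> \<le> C * x powr (\<alpha> - 1)"
    and k: "0 < k" and n: "1 \<le> n"
  shows "norm (integral {0..real n * k} (\<lambda>s. beta \<alpha> (real n * k - s) *\<^sub>R B (u s)) - cq \<alpha> k (\<lambda>p. B (u (real p * k))) n)
     \<le> C * (k\<^sup>2 * (real n * k) powr (\<alpha> - 1) * norm (B (ut 0))
        + k powr (\<alpha> + 1) * integral {real (n - 1) * k..real n * k} (\<lambda>s. norm (B (utt s)))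
        + k\<^sup>2 * integral {0..real (n - 1) * k} (\<lambda>s. (real n * k - s) powr (\<alpha> - 1) * norm (B (utt s))))"
    (is "norm ?E \<le> C * ?R")
proof (rule norm_le_of_dense_inner[OF domain_dense])
  show "0 \<le> C * ?R"
    using C(1) by (intro mult_nonneg_nonneg add_nonneg_nonneg integral_nonneg_always) auto
next
  fix y assume y: "y \<in> D"
  have T: "0 < real n * k" using k n by simp
  have cq: "cq \<alpha> k (\<lambda>p. u (real p * k) \<bullet> B y) n = cq \<alpha> k (\<lambda>p. B (u (real p * k))) n \<bullet> y"
    using weak_values(1)[OF y] k
    by (simp add: cq_def inner_add_left inner_sum_left)
  have "\<bar>integral {0..real n * k} (\<lambda>s. beta \<alpha> (real n * k - s) * (u s \<bullet> B y)) - cq \<alpha> k (\<lambda>p. u (real p * k) \<bullet> B y) n\<bar>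
     \<le> C * (k\<^sup>2 * (real n * k) powr (\<alpha> - 1) * \<bar>ut 0 \<bullet> B y\<bar>
        + k powr (\<alpha> + 1) * integral {real (n - 1) * k..real n * k} (\<lambda>s. norm (B (utt s)) * norm y)
        + k\<^sup>2 * integral {0..real (n - 1) * k} (\<lambda>s. (real n * k - s) powr (\<alpha> - 1) * (norm (B (utt s)) * norm y)))"
    by (rule scalar_quadrature_error[OF \<alpha> weak_derivatives C k n weak_convolution(1)[OF y T] _ weak_values(4)[OF y]])
       (auto intro!: integrable_on_mult_left utt_int T)
  also have "\<dots> \<le> C * (k\<^sup>2 * (real n * k) powr (\<alpha> - 1) * (norm (B (ut 0)) * norm y)
        + k powr (\<alpha> + 1) * integral {real (n - 1) * k..real n * k} (\<lambda>s. norm (B (utt s)) * norm y)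
        + k\<^sup>2 * integral {0..real (n - 1) * k} (\<lambda>s. (real n * k - s) powr (\<alpha> - 1) * (norm (B (utt s)) * norm y)))"
    using C(1) weak_values(3)[OF y] by (intro mult_left_mono add_mono) auto
  also have "\<dots> = C * ?R * norm y"
    by (simp only: mult.assoc[symmetric] integral_mult_left) (simp add: algebra_simps)
  finally show "?E \<bullet> y \<le> C * ?R * norm y"
    unfolding cq weak_convolution(2)[OF y T] inner_diff_left[symmetric] by linarith
qed

text \<open>The second-order expansion of the convolution yields positive powers of T as factors, so
  the memory term vanishes as T tends to 0.\<close>

lemma convolution_bound:
  assumes T: "0 < T"
  shows "norm (integral {0..T} (\<lambda>s. beta \<alpha> (T - s) *\<^sub>R B (u s)))
     \<le> T powr \<alpha> / Gamma (\<alpha> + 1) * norm (B (u 0))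
       + T powr (\<alpha> + 1) / Gamma (\<alpha> + 2) * (norm (B (ut 0)) + integral {0..T} (\<lambda>s. norm (B (utt s))))"
    (is "norm ?I \<le> ?R")
proof (rule norm_le_of_dense_inner[OF domain_dense])
  have Gam: "0 < Gamma (\<alpha> + 1)" "0 < Gamma (\<alpha> + 2)" using \<alpha> by (auto intro: Gamma_real_pos)
  show "0 \<le> ?R"
    using Gam less_imp_le[OF Gam(1)] less_imp_le[OF Gam(2)]
    by (intro add_nonneg_nonneg mult_nonneg_nonneg divide_nonneg_nonneg integral_nonneg_always) auto
  fix y assume y: "y \<in> D"
  define h where "h s = (T - s) powr (\<alpha> + 1) / Gamma (\<alpha> + 2) * (if 0 < s then utt s \<bullet> B y else 0)" for s
  have h: "(h has_integral (?I \<bullet> y - T powr \<alpha> / Gamma (\<alpha> + 1) * (u 0 \<bullet> B y) - T powr (\<alpha> + 1) / Gamma (\<alpha> + 2) * (ut 0 \<bullet> B y))) {0..T}"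
    using convolution_taylor[OF \<alpha> weak_derivatives[where y = y] less_imp_le[OF T] weak_convolution(1)[OF y T]]
    unfolding weak_convolution(2)[OF y T] h_def .
  have "norm (integral {0..T} h) \<le> integral {0..T} (\<lambda>s. T powr (\<alpha> + 1) / Gamma (\<alpha> + 2) * (norm (B (utt s)) * norm y))"
  proof (rule integral_norm_bound_integral)
    show "h integrable_on {0..T}" using h by blast
    show "(\<lambda>s. T powr (\<alpha> + 1) / Gamma (\<alpha> + 2) * (norm (B (utt s)) * norm y)) integrable_on {0..T}"
      by (intro integrable_on_mult_right integrable_on_mult_left utt_int T)
    show "norm (h s) \<le> T powr (\<alpha> + 1) / Gamma (\<alpha> + 2) * (norm (B (utt s)) * norm y)" if "s \<in> {0..T}" for s
    proof -
      have "(T - s) powr (\<alpha> + 1) / Gamma (\<alpha> + 2) \<le> T powr (\<alpha> + 1) / Gamma (\<alpha> + 2)"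
        using that \<alpha> less_imp_le[OF Gam(2)] by (intro divide_right_mono powr_mono2) auto
      moreover have "\<bar>(T - s) powr (\<alpha> + 1) / Gamma (\<alpha> + 2)\<bar> = (T - s) powr (\<alpha> + 1) / Gamma (\<alpha> + 2)"
        using less_imp_le[OF Gam(2)] by simp
      ultimately show ?thesis
        unfolding h_def real_norm_def abs_mult using weak_values(4)[OF y, of s] less_imp_le[OF Gam(2)]
        by (intro mult_mono) auto
    qed
  qed
  also have "\<dots> = T powr (\<alpha> + 1) / Gamma (\<alpha> + 2) * integral {0..T} (\<lambda>s. norm (B (utt s))) * norm y"
    by (simp only: integral_mult_right integral_mult_left mult.assoc)
  finally have "?I \<bullet> y - T powr \<alpha> / Gamma (\<alpha> + 1) * (u 0 \<bullet> B y) - T powr (\<alpha> + 1) / Gamma (\<alpha> + 2) * (ut 0 \<bullet> B y)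
      \<le> T powr (\<alpha> + 1) / Gamma (\<alpha> + 2) * integral {0..T} (\<lambda>s. norm (B (utt s))) * norm y"
    using integral_unique[OF h] by simp
  moreover have "T powr \<alpha> / Gamma (\<alpha> + 1) * (u 0 \<bullet> B y) \<le> T powr \<alpha> / Gamma (\<alpha> + 1) * (norm (B (u 0)) * norm y)"
    using weak_values(2)[OF y] less_imp_le[OF Gam(1)] by (intro mult_left_mono) auto
  moreover have "T powr (\<alpha> + 1) / Gamma (\<alpha> + 2) * (ut 0 \<bullet> B y) \<le> T powr (\<alpha> + 1) / Gamma (\<alpha> + 2) * (norm (B (ut 0)) * norm y)"
    using weak_values(3)[OF y] less_imp_le[OF Gam(2)] by (intro mult_left_mono) auto
  ultimately have "?I \<bullet> y \<le> T powr \<alpha> / Gamma (\<alpha> + 1) * (norm (B (u 0)) * norm y)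
      + T powr (\<alpha> + 1) / Gamma (\<alpha> + 2) * (norm (B (ut 0)) * norm y)
      + T powr (\<alpha> + 1) / Gamma (\<alpha> + 2) * integral {0..T} (\<lambda>s. norm (B (utt s))) * norm y" by linarith
  also have "\<dots> = ?R * norm y" by (simp only: distrib_left distrib_right mult.assoc add.assoc)
  finally show "?I \<bullet> y \<le> ?R * norm y" .
qed

lemma convolution_tendsto_0:
  "((\<lambda>T. integral {0..T} (\<lambda>s. beta \<alpha> (T - s) *\<^sub>R B (u s))) \<longlongrightarrow> 0) (at_right 0)"
proof (rule Lim_null_comparison)
  define M where "M = integral {0..1} (\<lambda>s. norm (B (utt s)))"
  define b where "b T = T powr \<alpha> / Gamma (\<alpha> + 1) * norm (B (u 0)) + T powr (\<alpha> + 1) / Gamma (\<alpha> + 2) * (norm (B (ut 0)) + M)" for T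
  show "\<forall>\<^sub>F T in at_right 0. norm (integral {0..T} (\<lambda>s. beta \<alpha> (T - s) *\<^sub>R B (u s))) \<le> b T"
  proof (rule eventually_at_rightI)
    fix T :: real assume T: "T \<in> {0<..<1}"
    have "integral {0..T} (\<lambda>s. norm (B (utt s))) \<le> M"
      unfolding M_def using T by (intro integral_subset_le utt_int) auto
    then have "T powr (\<alpha> + 1) / Gamma (\<alpha> + 2) * (norm (B (ut 0)) + integral {0..T} (\<lambda>s. norm (B (utt s))))
        \<le> T powr (\<alpha> + 1) / Gamma (\<alpha> + 2) * (norm (B (ut 0)) + M)"
      using Gamma_real_pos[of "\<alpha> + 2"] \<alpha> by (intro mult_left_mono divide_nonneg_nonneg) auto
    then show "norm (integral {0..T} (\<lambda>s. beta \<alpha> (T - s) *\<^sub>R B (u s))) \<le> b T"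
      using convolution_bound[of T] T unfolding b_def by simp
  qed simp
  have "((\<lambda>T::real. T powr p) \<longlongrightarrow> 0) (at_right 0)" if "0 < p" for p
    using that by real_asymp
  from this[of \<alpha>] this[of "\<alpha> + 1"] have "(b \<longlongrightarrow> 0 / Gamma (\<alpha> + 1) * norm (B (u 0)) + 0 / Gamma (\<alpha> + 2) * (norm (B (ut 0)) + M)) (at_right 0)"
    unfolding b_def divide_inverse using \<alpha> by (intro tendsto_intros) auto
  then show "(b \<longlongrightarrow> 0) (at_right 0)" by simp
qed

end

section \<open>Continuity of the first derivative and trapezoidal truncation errors\<close>

context
  fixes u ut utt :: "real \<Rightarrow> 'a::real_inner"
  assumes u: "\<And>t. 0 \<le> t \<Longrightarrow> (u has_vector_derivative ut t) (at t within {0..})"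
    and ut: "\<And>t. 0 < t \<Longrightarrow> (ut has_vector_derivative utt t) (at t)"
    and utt_int: "\<And>T. 0 < T \<Longrightarrow> (\<lambda>s. norm (utt s)) integrable_on {0..T}"
begin

lemma u_deriv: "0 < t \<Longrightarrow> (u has_vector_derivative ut t) (at t)"
  using u[of t] at_within_interior[of t "{0..}"] by (simp add: interior_real_atLeast)

lemma u_cont: "continuous_on {0..} u"
  unfolding continuous_on_eq_continuous_within using has_vector_derivative_continuous[OF u] by auto

lemma ut_diff:
  assumes "0 < s" "s \<le> t"
  shows "norm (ut t - ut s) \<le> integral {0..t} (\<lambda>s. norm (utt s))"
proof -
  have "(\<lambda>s. norm (utt s)) integrable_on {s..t}"
    using assms by (intro integrable_on_subinterval[OF utt_int[of t]]) auto
  then have "norm (ut t - ut s) \<le> integral {s..t} (\<lambda>s. norm (utt s))"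
    using assms ut has_vector_derivative_continuous[OF ut]
    by (intro norm_diff_le_integral[where F' = utt])
       (auto simp: continuous_on_eq_continuous_within intro: continuous_at_imp_continuous_at_within)
  also have "\<dots> \<le> integral {0..t} (\<lambda>s. norm (utt s))"
    using assms \<open>(\<lambda>s. norm (utt s)) integrable_on {s..t}\<close> utt_int[of t] by (intro integral_subset_le) auto
  finally show ?thesis .
qed

lemma forward_difference_error:
  assumes h: "0 < h" and K: "\<And>s. 0 < s \<Longrightarrow> s < h \<Longrightarrow> norm (ut s - v) \<le> K" "0 \<le> K"
  shows "norm (u h - u 0 - h *\<^sub>R v) \<le> h * K"
proof -
  have "norm ((u h - h *\<^sub>R v) - (u 0 - 0 *\<^sub>R v)) \<le> integral {0..h} (\<lambda>_. K)"
  proof (rule norm_diff_le_integral)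
    show "continuous_on {0..h} (\<lambda>s. u s - s *\<^sub>R v)"
      by (intro continuous_intros continuous_on_subset[OF u_cont]) auto
    show "((\<lambda>s. u s - s *\<^sub>R v) has_vector_derivative ut s - v) (at s)" if "0 < s" for s
      using that by (auto intro!: derivative_eq_intros u_deriv)
  qed (use h K in auto)
  then show ?thesis using h by (simp add: algebra_simps)
qed

text \<open>The value \<open>ut 0\<close> is known only as a one-sided derivative. Every difference
  quotient of \<open>u\<close> at 0 over a step shorter than t is within the oscillation bound of
  \<open>ut t\<close>, and pairing with the difference passes this to the limit.\<close>

lemma ut_diff_0:
  assumes t: "0 < t"
  shows "norm (ut t - ut 0) \<le> integral {0..t} (\<lambda>s. norm (utt s))"
proof -
  define M where "M = integral {0..t} (\<lambda>s. norm (utt s))"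
  have M: "0 \<le> M" unfolding M_def by (rule integral_nonneg_always) simp
  define y where "y = ut 0 - ut t"
  have "((\<lambda>s. u s \<bullet> y) has_real_derivative ut 0 \<bullet> y) (at 0 within {0..})"
    unfolding has_real_derivative_iff_has_vector_derivative by (intro inner_has_vector_derivative u) auto
  then have "((\<lambda>s. (u s \<bullet> y - u 0 \<bullet> y) / s) \<longlongrightarrow> ut 0 \<bullet> y) (at_right 0)"
    by (simp add: has_field_derivative_iff at_within_Ici_at_right)
  moreover have "\<forall>\<^sub>F s in at_right 0. (u s \<bullet> y - u 0 \<bullet> y) / s \<le> ut t \<bullet> y + M * norm y"
  proof (rule eventually_at_rightI[OF _ t])
    fix s assume s: "s \<in> {0<..<t}"
    have "norm (ut x - ut t) \<le> M" if "0 < x" "x < s" for x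
      using ut_diff[of x t] that s by (simp add: M_def norm_minus_commute)
    then have "norm (u s - u 0 - s *\<^sub>R ut t) \<le> s * M"
      using s M by (intro forward_difference_error) auto
    then have "(u s - u 0 - s *\<^sub>R ut t) \<bullet> y \<le> s * M * norm y"
      by (meson mult_right_mono norm_cauchy_schwarz norm_ge_zero order_trans)
    then show "(u s \<bullet> y - u 0 \<bullet> y) / s \<le> ut t \<bullet> y + M * norm y"
      using s by (simp add: divide_le_eq inner_diff_left algebra_simps)
  qed
  ultimately have "ut 0 \<bullet> y \<le> ut t \<bullet> y + M * norm y"
    by (rule tendsto_upperbound) simp
  then have "y \<bullet> y \<le> M * norm y" by (simp add: y_def inner_diff_left)
  then have "norm y * norm y \<le> M * norm y" by (simp add: dot_square_norm power2_eq_square)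
  then have "norm y \<le> M" using M by (cases "y = 0") auto
  then show ?thesis by (simp add: y_def M_def norm_minus_commute)
qed

lemma ut_continuous: "continuous_on {0..} ut"
  unfolding continuous_on_eq_continuous_within
proof
  fix t :: real assume "t \<in> {0..}"
  show "continuous (at t within {0..}) ut"
  proof (cases "t = 0")
    case False
    then have "continuous (at t) ut" using \<open>t \<in> {0..}\<close> by (intro has_vector_derivative_continuous[OF ut]) auto
    then show ?thesis by (rule continuous_at_imp_continuous_at_within)
  next
    case True
    have "continuous_on {0..1} (\<lambda>t. integral {0..t} (\<lambda>s. norm (utt s)))"
      by (intro indefinite_integral_continuous_1 utt_int) auto
    then have "((\<lambda>t. integral {0..t} (\<lambda>s. norm (utt s))) \<longlongrightarrow> integral {0..0} (\<lambda>s. norm (utt s))) (at 0 within {0..1})"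
      unfolding continuous_on_def by (rule bspec) auto
    then have "((\<lambda>t. integral {0..t} (\<lambda>s. norm (utt s))) \<longlongrightarrow> 0) (at_right 0)"
      by (simp add: at_within_Icc_at_right)
    then have "((\<lambda>t. ut t - ut 0) \<longlongrightarrow> 0) (at_right 0)"
      by (rule Lim_null_comparison[rotated]) (auto intro!: eventually_at_rightI[of 0 1] ut_diff_0)
    then show ?thesis
      using True by (simp add: continuous_within at_within_Ici_at_right LIM_zero_iff)
  qed
qed

text \<open>On the cell touching 0 the error is measured by the oscillation of \<open>ut\<close>: it
  is minus the average of two difference-quotient errors, one relative to \<open>ut k\<close> and
  one to \<open>ut 0\<close>.\<close>

lemma trapezoid_error_first:
  assumes k: "0 < k"
  shows "norm ((1/2) *\<^sub>R (ut k + ut 0) - (1/k) *\<^sub>R (u k - u 0)) \<le> integral {0..k} (\<lambda>s. norm (utt s))"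
proof -
  define M where "M = integral {0..k} (\<lambda>s. norm (utt s))"
  have M: "0 \<le> M" unfolding M_def by (rule integral_nonneg_always) simp
  have "norm (ut s - ut k) \<le> M" if "0 < s" "s < k" for s
    using ut_diff[of s k] that by (simp add: M_def norm_minus_commute)
  then have 1: "norm (u k - u 0 - k *\<^sub>R ut k) \<le> k * M" using k M by (intro forward_difference_error)
  have "norm (ut s - ut 0) \<le> M" if "0 < s" "s < k" for s
  proof -
    have "integral {0..s} (\<lambda>s. norm (utt s)) \<le> M"
      unfolding M_def using that by (intro integral_subset_le utt_int) auto
    then show ?thesis using ut_diff_0[of s] that by linarith
  qed
  then have 2: "norm (u k - u 0 - k *\<^sub>R ut 0) \<le> k * M" using k M by (intro forward_difference_error)
  have "(1/2) *\<^sub>R (ut k + ut 0) - (1/k) *\<^sub>R (u k - u 0)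
      = (- 1 / (2 * k)) *\<^sub>R ((u k - u 0 - k *\<^sub>R ut k) + (u k - u 0 - k *\<^sub>R ut 0))"
  proof -
    have "(1/k) *\<^sub>R v = (1 / (2 * k)) *\<^sub>R v + (1 / (2 * k)) *\<^sub>R v" for v :: 'a
      using k by (simp add: scaleR_add_left[symmetric] field_simps)
    then show ?thesis using k by (simp add: scaleR_add_right scaleR_diff_right)
  qed
  also have "norm \<dots> = 1 / (2 * k) * norm ((u k - u 0 - k *\<^sub>R ut k) + (u k - u 0 - k *\<^sub>R ut 0))"
    using k by simp
  also have "\<dots> \<le> 1 / (2 * k) * (k * M + k * M)"
    using k by (intro mult_left_mono order_trans[OF norm_triangle_ineq] add_mono 1 2) auto
  also have "\<dots> = M" using k by simp
  finally show ?thesis by (simp add: M_def)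
qed

lemma trapezoid_error:
  assumes ab: "0 < a" "a < b"
    and utt: "\<And>t. 0 < t \<Longrightarrow> (utt has_vector_derivative uttt t) (at t)"
    and int: "(\<lambda>s. norm (uttt s)) integrable_on {a..b}"
  shows "norm ((1/2) *\<^sub>R (ut b + ut a) - (1 / (b - a)) *\<^sub>R (u b - u a)) \<le> (b - a) * integral {a..b} (\<lambda>s. norm (uttt s))"
proof -
  \<comment> \<open>The Peano kernel of the trapezoidal rule; \<open>F\<close> is the antiderivative
    of \<open>m\<close> times \<open>uttt\<close> found by integrating by parts. Bounding
    \<open>m\<close> by (b - a)^2 leaves one power after division by b - a.\<close>
  define m where "m s = (s - a) * (b - s) / 2" for s
  define F where "F s = m s *\<^sub>R utt s - ((a + b) / 2 - s) *\<^sub>R ut s - u s" for s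
  have "norm (F b - F a) \<le> integral {a..b} (\<lambda>s. (b - a)\<^sup>2 * norm (uttt s))"
  proof (rule norm_diff_le_integral)
    have F: "(F has_vector_derivative m s *\<^sub>R uttt s) (at s)" if "0 < s" for s
    proof -
      have "(m has_real_derivative ((a + b) / 2 - s)) (at s)"
        unfolding m_def by (auto intro!: derivative_eq_intros simp: field_simps)
      then show ?thesis
        unfolding F_def using that
        by (auto intro!: derivative_eq_intros u_deriv ut utt simp: has_real_derivative_iff_has_vector_derivative)
    qed
    then show "(F has_vector_derivative m s *\<^sub>R uttt s) (at s)" if "a < s" for s
      using that ab by auto
    show "continuous_on {a..b} F"
      unfolding continuous_on_eq_continuous_within
      using has_vector_derivative_continuous[OF F] ab by (auto intro: continuous_at_imp_continuous_at_within)
    show "norm (m s *\<^sub>R uttt s) \<le> (b - a)\<^sup>2 * norm (uttt s)" if "a < s" "s < b" for s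
    proof -
      have "(s - a) * (b - s) \<le> (b - a) * (b - a)" using that by (intro mult_mono) auto
      moreover have "0 \<le> (s - a) * (b - s)" using that by simp
      ultimately have "\<bar>m s\<bar> \<le> (b - a)\<^sup>2" unfolding m_def power2_eq_square by linarith
      then show ?thesis by (simp add: mult_right_mono)
    qed
    show "(\<lambda>s. (b - a)\<^sup>2 * norm (uttt s)) integrable_on {a..b}" by (rule integrable_on_mult_right[OF int])
  qed (use ab in auto)
  moreover have "F b - F a = (b - a) *\<^sub>R ((1/2) *\<^sub>R (ut b + ut a) - (1 / (b - a)) *\<^sub>R (u b - u a))"
  proof -
    have "F b = ((b - a) / 2) *\<^sub>R ut b - u b" "F a = - (((b - a) / 2) *\<^sub>R ut a) - u a"
    proof -
      have "(a + b) / 2 - b = - ((b - a) / 2)" "(a + b) / 2 - a = (b - a) / 2"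
        by (simp_all add: field_simps)
      then show "F b = ((b - a) / 2) *\<^sub>R ut b - u b" "F a = - (((b - a) / 2) *\<^sub>R ut a) - u a"
        unfolding F_def m_def by (simp_all only: scaleR_minus_left) simp_all
    qed
    then show ?thesis using ab by (simp add: scaleR_add_right scaleR_diff_right)
  qed
  ultimately have "(b - a) * norm ((1/2) *\<^sub>R (ut b + ut a) - (1 / (b - a)) *\<^sub>R (u b - u a))
      \<le> (b - a) * ((b - a) * integral {a..b} (\<lambda>s. norm (uttt s)))"
    using ab by (simp add: power2_eq_square mult.assoc)
  then show ?thesis using ab by (simp add: mult_le_cancel_left)
qed

end

subsection \<open>Stability\<close>

text \<open>Shifting the sum of the older values costs a factor \<open>\<rho>\<close>. The initial
  term vanishes since a 0 = 0, and the discarded final term has the favourable sign.\<close>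

lemma weighted_summation_by_parts:
  fixes a :: "nat \<Rightarrow> real"
  assumes "a 0 = 0" "\<And>n. 0 \<le> a n" "0 \<le> \<rho>"
  shows "(1 - \<rho>) * (\<Sum>n<N. \<rho> ^ Suc n * a (Suc n)) \<le> (\<Sum>n<N. \<rho> ^ Suc n * (a (Suc n) - a n))"
proof -
  have "(\<Sum>n<N. \<rho> ^ Suc n * a n) = \<rho> * (\<Sum>n<N. \<rho> ^ n * a n)"
    by (simp add: sum_distrib_left mult.assoc)
  also have "(\<Sum>n<N. \<rho> ^ n * a n) \<le> (\<Sum>n<Suc N. \<rho> ^ n * a n)"
    using assms by simp
  also have "\<dots> = (\<Sum>n<N. \<rho> ^ Suc n * a (Suc n))"
    by (subst sum.lessThan_Suc_shift) (simp add: assms(1))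
  finally have "(\<Sum>n<N. \<rho> ^ Suc n * a n) \<le> \<rho> * (\<Sum>n<N. \<rho> ^ Suc n * a (Suc n))"
    using assms(3) by (simp add: mult_left_mono)
  then show ?thesis by (simp add: right_diff_distrib left_diff_distrib sum_subtractf)
qed

text \<open>Pairing the difference with the average of neighbouring errors gives a difference of
  squares. Since every single weighted norm is at most sqrt S, the residual pairing is at most sqrt
  S times an l1 sum, and one factor sqrt S cancels.\<close>

lemma discrete_stability:
  fixes e F r :: "nat \<Rightarrow> 'a::real_inner"
  assumes k: "0 < k" and c: "0 < c" and e0: "e 0 = 0"
    and eq: "\<And>n. (1/k) *\<^sub>R (e (Suc n) - e n) + F (Suc n) = r (Suc n)"
    and pos: "0 \<le> (\<Sum>n<N. exp (- c * real (Suc n)) * (F (Suc n) \<bullet> ((1/2) *\<^sub>R (e (Suc n) + e n))))"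
  shows "sqrt (\<Sum>n\<le>N. weighted_sq c e n)
     \<le> 2 / (1 - exp (- c)) * k * (\<Sum>n<N. exp (- (c/2) * real (Suc n)) * norm (r (Suc n)))"
proof -
  define \<rho> where "\<rho> = exp (- c)"
  have \<rho>: "0 < \<rho>" "\<rho> < 1" using c by (auto simp: \<rho>_def)
  have pw: "exp (- c * real n) = \<rho> ^ n" for n
    by (simp add: \<rho>_def exp_of_nat_mult[symmetric] mult.commute)
  define s where "s n = exp (- (c/2) * real n)" for n
  have s: "0 < s n" "s n * s n = \<rho> ^ n" "s (Suc n) \<le> s n" for n
    using c by (auto simp: s_def pw[symmetric] exp_add[symmetric])
  define w where "w n = (1/2) *\<^sub>R (e (Suc n) + e n)" for n
  define S where "S = (\<Sum>n\<le>N. weighted_sq c e n)"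
  define R where "R = (\<Sum>n<N. s (Suc n) * norm (r (Suc n)))"
  have S_nonneg: "0 \<le> S" unfolding S_def weighted_sq_def by (intro sum_nonneg) auto
  have R_nonneg: "0 \<le> R" unfolding R_def using less_imp_le[OF s(1)] by (intro sum_nonneg mult_nonneg_nonneg) auto
  have S_alt: "S = (\<Sum>n<N. \<rho> ^ Suc n * (norm (e (Suc n)))\<^sup>2)"
    unfolding S_def weighted_sq_def pw lessThan_Suc_atMost[symmetric]
    by (subst sum.lessThan_Suc_shift) (simp add: e0)
  have le_S: "s n * norm (e n) \<le> sqrt S" if "n \<le> N" for n
  proof (rule real_le_rsqrt)
    have "(s n * norm (e n))\<^sup>2 = weighted_sq c e n"
      unfolding weighted_sq_def pw by (simp add: power_mult_distrib s(2) power2_eq_square[of "s n"])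
    also have "\<dots> \<le> S"
      unfolding S_def using that by (intro member_le_sum) (auto simp: weighted_sq_def)
    finally show "(s n * norm (e n))\<^sup>2 \<le> S" .
  qed
  have w_le: "s (Suc n) * norm (w n) \<le> sqrt S" if "n < N" for n
  proof -
    have "s (Suc n) * norm (w n) \<le> s (Suc n) * ((norm (e (Suc n)) + norm (e n)) / 2)"
      using s(1)[of "Suc n"] norm_triangle_ineq[of "e (Suc n)" "e n"] by (simp add: w_def)
    also have "\<dots> \<le> (s (Suc n) * norm (e (Suc n)) + s n * norm (e n)) / 2"
      using mult_right_mono[OF s(3)[of n], of "norm (e n)"] by (simp add: distrib_left)
    also have "\<dots> \<le> sqrt S" using le_S[of "Suc n"] le_S[of n] that by simp
    finally show ?thesis .
  qed
  have "(1 - \<rho>) * S \<le> (\<Sum>n<N. \<rho> ^ Suc n * ((norm (e (Suc n)))\<^sup>2 - (norm (e n))\<^sup>2))"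
    unfolding S_alt using weighted_summation_by_parts[of "\<lambda>n. (norm (e n))\<^sup>2" \<rho> N] \<rho> e0 by simp
  also have "\<dots> = 2 * k * (\<Sum>n<N. \<rho> ^ Suc n * (((1/k) *\<^sub>R (e (Suc n) - e n)) \<bullet> w n))"
    unfolding sum_distrib_left
  proof (intro sum.cong refl)
    fix n
    have "(e (Suc n) - e n) \<bullet> (e (Suc n) + e n) = (norm (e (Suc n)))\<^sup>2 - (norm (e n))\<^sup>2"
      by (simp add: inner_diff_left inner_diff_right inner_add_right inner_commute power2_norm_eq_inner)
    then show "\<rho> ^ Suc n * ((norm (e (Suc n)))\<^sup>2 - (norm (e n))\<^sup>2)
        = 2 * k * (\<rho> ^ Suc n * (((1/k) *\<^sub>R (e (Suc n) - e n)) \<bullet> w n))"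
      using k by (simp add: w_def)
  qed
  also have "\<dots> \<le> 2 * k * (\<Sum>n<N. \<rho> ^ Suc n * (r (Suc n) \<bullet> w n))"
  proof -
    have "(\<Sum>n<N. \<rho> ^ Suc n * (r (Suc n) \<bullet> w n))
        = (\<Sum>n<N. \<rho> ^ Suc n * (((1/k) *\<^sub>R (e (Suc n) - e n)) \<bullet> w n)) + (\<Sum>n<N. \<rho> ^ Suc n * (F (Suc n) \<bullet> w n))"
      unfolding eq[symmetric] inner_add_left distrib_left sum.distrib ..
    then show ?thesis using pos k unfolding pw w_def[symmetric] by simp
  qed
  also have "\<dots> \<le> 2 * k * (sqrt S * R)"
  proof -
    have "\<rho> ^ Suc n * (r (Suc n) \<bullet> w n) \<le> sqrt S * (s (Suc n) * norm (r (Suc n)))" if "n < N" for n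
    proof -
      have "\<rho> ^ Suc n * (r (Suc n) \<bullet> w n) \<le> \<rho> ^ Suc n * (norm (r (Suc n)) * norm (w n))"
        using \<rho> norm_cauchy_schwarz by (intro mult_left_mono) auto
      also have "\<dots> = s (Suc n) * norm (w n) * (s (Suc n) * norm (r (Suc n)))"
        unfolding s(2)[symmetric] by simp
      also have "\<dots> \<le> sqrt S * (s (Suc n) * norm (r (Suc n)))"
        using w_le[OF that] s(1)[of "Suc n"] by (intro mult_right_mono) auto
      finally show ?thesis .
    qed
    then show ?thesis
      unfolding R_def sum_distrib_left[of "sqrt S"] using k by (intro mult_left_mono sum_mono) auto
  qed
  finally have "(1 - \<rho>) * S \<le> 2 * k * (sqrt S * R)" .
  moreover have "(1 - \<rho>) * S = sqrt S * ((1 - \<rho>) * sqrt S)"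
    using S_nonneg by simp
  ultimately have "sqrt S * ((1 - \<rho>) * sqrt S) \<le> sqrt S * (2 * k * R)"
    by (simp add: mult.left_commute)
  then have "(1 - \<rho>) * sqrt S \<le> 2 * k * R"
    using S_nonneg k R_nonneg by (cases "S = 0") (auto simp: mult_le_cancel_left)
  then have "sqrt S \<le> 2 * k * R / (1 - \<rho>)" using \<rho> by (simp add: le_divide_eq mult.commute)
  then show ?thesis by (simp add: S_def R_def s_def \<rho>_def)
qed

text \<open>With e 0 = 0 the correction term drops out and the shifted convolution loses its first
  term. Averaging two levels then amounts to convolving the averaged sequence, to which
  \<open>trap_convolution_positive\<close> applies with s = exp (-c/2).\<close>

lemma cq_half_positive:
  assumes \<alpha>: "0 < \<alpha>" "\<alpha> < 1" and B: "self_adjoint_op D B" "positive_op D B"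
    and e: "\<And>n. e n \<in> D" "e 0 = 0" and c: "0 < c"
  shows "0 \<le> (\<Sum>n<N. exp (- c * real (Suc n)) * (cq_half \<alpha> k (\<lambda>p. B (e p)) (Suc n) \<bullet> ((1/2) *\<^sub>R (e (Suc n) + e n))))"
proof -
  have lin: "densely_defined_linear D B" using B(1) by (simp add: self_adjoint_op_def)
  then have D: "subspace D" and add: "\<And>x y. x \<in> D \<Longrightarrow> y \<in> D \<Longrightarrow> B (x + y) = B x + B y"
    and scale: "\<And>r x. x \<in> D \<Longrightarrow> B (r *\<^sub>R x) = r *\<^sub>R B x"
    by (auto simp: densely_defined_linear_def)
  have B0: "B 0 = 0" using scale[OF subspace_0[OF D], of 0] by simp
  \<comment> \<open>The value 0 at index 0 is the average of e 0 with a fictitious zero before it,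
    which makes the convolution identity hold for every later index.\<close>
  define w where "w n = (case n of 0 \<Rightarrow> 0 | Suc m \<Rightarrow> (1/2) *\<^sub>R (e (Suc m) + e m))" for n
  have w: "w n \<in> D" for n
    using D e(1) by (auto simp: w_def subspace_0 subspace_scale subspace_add split: nat.split)
  have half: "cq_half \<alpha> k (\<lambda>p. B (e p)) (Suc n) = k powr \<alpha> *\<^sub>R (\<Sum>p\<le>Suc n. trap_weight \<alpha> (Suc n - p) *\<^sub>R B (w p))" for n
  proof -
    have cq: "cq \<alpha> k (\<lambda>p. B (e p)) m = k powr \<alpha> *\<^sub>R (\<Sum>p\<le>m. trap_weight \<alpha> (m - p) *\<^sub>R B (e p))" for m
      by (simp add: cq_def e(2) B0 atLeast0AtMost)
    have 1: "(\<Sum>p\<le>Suc n. trap_weight \<alpha> (Suc n - p) *\<^sub>R B (e p)) = (\<Sum>p\<le>n. trap_weight \<alpha> (n - p) *\<^sub>R B (e (Suc p)))"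
      by (subst sum.atMost_Suc_shift) (simp add: e(2) B0)
    have "(\<Sum>p\<le>Suc n. trap_weight \<alpha> (Suc n - p) *\<^sub>R B (w p))
        = (\<Sum>p\<le>n. trap_weight \<alpha> (n - p) *\<^sub>R ((1/2) *\<^sub>R (B (e (Suc p)) + B (e p))))"
      by (subst sum.atMost_Suc_shift) (simp add: w_def B0 add scale e(1) subspace_add[OF D])
    also have "\<dots> = (1/2) *\<^sub>R ((\<Sum>p\<le>n. trap_weight \<alpha> (n - p) *\<^sub>R B (e (Suc p))) + (\<Sum>p\<le>n. trap_weight \<alpha> (n - p) *\<^sub>R B (e p)))"
      by (simp add: scaleR_sum_right sum.distrib scaleR_add_right mult.commute)
    finally show ?thesis
      unfolding cq_half_def cq diff_Suc_1 1 by (simp add: scaleR_add_right mult.commute)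
  qed
  define s where "s = exp (- (c/2))"
  have s: "0 \<le> s" "s < 1" using c by (auto simp: s_def)
  have pw: "exp (- c * real n) = s ^ (2 * n)" for n
    by (simp add: s_def exp_of_nat_mult[symmetric] mult.commute)
  have "0 \<le> k powr \<alpha> * (\<Sum>n\<le>N. s ^ (2 * n) * ((\<Sum>p\<le>n. trap_weight \<alpha> (n - p) *\<^sub>R B (w p)) \<bullet> w n))"
    using trap_convolution_positive[OF \<alpha> B w s] by simp
  also have "\<dots> = (\<Sum>n<N. exp (- c * real (Suc n)) * (cq_half \<alpha> k (\<lambda>p. B (e p)) (Suc n) \<bullet> ((1/2) *\<^sub>R (e (Suc n) + e n))))"
  proof -
    have shift: "(\<Sum>n\<le>N. h n) = h 0 + (\<Sum>n<N. h (Suc n))" for h :: "nat \<Rightarrow> real"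
      unfolding lessThan_Suc_atMost[symmetric] by (rule sum.lessThan_Suc_shift)
    have w0: "w 0 = 0" and wS: "w (Suc n) = (1/2) *\<^sub>R (e (Suc n) + e n)" for n by (simp_all add: w_def)
    show ?thesis
      unfolding shift half pw wS[symmetric] w0 inner_scaleR_left inner_zero_right mult_zero_right add_0 sum_distrib_left
      by (intro sum.cong refl) (simp only: mult.left_commute)
  qed
  finally show ?thesis .
qed

lemma cq_diff: "cq \<alpha> k (\<lambda>p. \<phi> p - \<psi> p) n = cq \<alpha> k \<phi> n - cq \<alpha> k \<psi> n"
  by (simp add: cq_def scaleR_diff_right sum_subtractf algebra_simps)

lemma sum_le_infsum_from_1:
  fixes g :: "nat \<Rightarrow> real"
  assumes "g summable_on {1..}" "\<And>n. 0 \<le> g n"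
  shows "(\<Sum>n<N. g (Suc n)) \<le> (\<Sum>\<^sub>\<infinity>n\<in>{1..}. g n)"
  unfolding sum.atLeast1_atMost_eq[symmetric] using assms by (intro finite_sum_le_infsum) auto

subsection \<open>The error estimate\<close>

text \<open>A condition on \<alpha> and the constant alone, so that the constant is fixed before
  operators, solution and step.\<close>

definition trap_defect_bounded_by :: "real \<Rightarrow> real \<Rightarrow> bool" where
  "trap_defect_bounded_by \<alpha> C \<longleftrightarrow> 0 < C \<and> (\<forall>n x. 0 \<le> x \<and> x \<le> real n \<longrightarrow>
     \<bar>trap_defect \<alpha> n x\<bar> \<le> C \<and> (1 \<le> x \<longrightarrow> \<bar>trap_defect \<alpha> n x\<bar> \<le> C * x powr (\<alpha> - 1)))"

text \<open>The bound is uniform in N, so summability of the weighted squares will be a conclusion.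
  The residual splits into the trapezoid error \<open>\<tau>\<close> and averaged quadrature errors
  \<open>E\<close>.\<close>

lemma weighted_error_partial_sum:
  fixes D :: "nat \<Rightarrow> 'a::real_inner set"
  assumes \<alpha>: "\<And>q. q \<in> {1..2} \<Longrightarrow> 0 < \<alpha> q \<and> \<alpha> q < 1" and c: "c > 0"
    and K: "\<And>q. q \<in> {1..2} \<Longrightarrow> trap_defect_bounded_by (\<alpha> q) (K q)"
    and B: "\<And>q. q \<in> {1..2} \<Longrightarrow> self_adjoint_op (D q) (B q) \<and> positive_op (D q) (B q)"
    and f: "continuous (at 0 within {0..}) f"
    and sol: "solves_equation \<alpha> D B f u0 u ut"
    and reg: "regular_solution D B u ut utt uttt"
    and k: "k > 0" and scheme: "solves_scheme \<alpha> D B f u0 k U"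
    and time_sum: "time_term c k uttt summable_on {2..}"
    and quad_sum: "\<And>q. q \<in> {1..2} \<Longrightarrow> quad_term c (\<alpha> q) k (B q) ut utt summable_on {1..}"
  shows "sqrt (\<Sum>n\<le>N. weighted_sq c (\<lambda>n. U n - u (real n * k)) n)
    \<le> 2 / (1 - exp (- c)) * k * (exp (- c/2) * integral {0..k} (\<lambda>\<zeta>. norm (utt \<zeta>))
            + k * (\<Sum>\<^sub>\<infinity>n\<in>{2..}. time_term c k uttt n)
            + (\<Sum>q=1..2. K q * (\<Sum>\<^sub>\<infinity>n\<in>{1..}. quad_term c (\<alpha> q) k (B q) ut utt n)))"
proof -
  define e where "e n = U n - u (real n * k)" for n
  define I where "I q t = integral {0..t} (\<lambda>s. beta (\<alpha> q) (t - s) *\<^sub>R B q (u s))" for q t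
  define E where "E q n = I q (real n * k) - cq (\<alpha> q) k (\<lambda>p. B q (u (real p * k))) n" for q n
  define \<tau> where "\<tau> n = (1/2) *\<^sub>R (ut (real n * k) + ut (real (n - 1) * k)) - (1/k) *\<^sub>R (u (real n * k) - u (real (n - 1) * k))" for n
  define r where "r n = \<tau> n + (\<Sum>q=1..2. (1/2) *\<^sub>R (E q n + E q (n - 1)))" for n
  define F where "F n = (\<Sum>q=1..2. cq_half (\<alpha> q) k (\<lambda>p. B q (e p)) n)" for n
  define s where "s n = exp (- (c/2) * real n)" for n
  \<comment> \<open>At level 0 the quadrature error is 0: \<open>kappa\<close> cancels the only
    weight, and the integral is over a point.\<close>
  define Q where "Q q n = (if n = 0 then 0 else quad_term c (\<alpha> q) k (B q) ut utt n)" for q n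
  \<comment> \<open>The cell touching 0 is bounded through \<open>utt\<close>, as
    \<open>uttt\<close> may fail to be integrable there.\<close>
  define T where "T n = (if n = 1 then exp (- c/2) * integral {0..k} (\<lambda>\<zeta>. norm (utt \<zeta>)) else k * time_term c k uttt n)" for n
  have u0: "u 0 = u0" and u_dom: "\<And>q t. q \<in> {1..2} \<Longrightarrow> 0 \<le> t \<Longrightarrow> u t \<in> D q"
    and conv_int: "\<And>q t. q \<in> {1..2} \<Longrightarrow> 0 < t \<Longrightarrow> (\<lambda>s. beta (\<alpha> q) (t - s) *\<^sub>R B q (u s)) integrable_on {0..t}"
    and equation: "\<And>t. 0 < t \<Longrightarrow> ut t + (\<Sum>q=1..2. I q t) = f t"
    using sol unfolding solves_equation_def I_def by blast+
  have u: "\<And>t. 0 \<le> t \<Longrightarrow> (u has_vector_derivative ut t) (at t within {0..})"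
    and ut: "\<And>t. 0 < t \<Longrightarrow> (ut has_vector_derivative utt t) (at t)"
    and utt: "\<And>t. 0 < t \<Longrightarrow> (utt has_vector_derivative uttt t) (at t)"
    and ut0_dom: "\<And>q. q \<in> {1..2} \<Longrightarrow> ut 0 \<in> D q"
    and utt_dom: "\<And>q t. q \<in> {1..2} \<Longrightarrow> 0 < t \<Longrightarrow> utt t \<in> D q"
    and utt_int: "\<And>T. 0 < T \<Longrightarrow> (\<lambda>\<zeta>. norm (utt \<zeta>)) integrable_on {0..T}"
    and uttt_int: "\<And>a b. 0 < a \<Longrightarrow> a < b \<Longrightarrow> (\<lambda>\<zeta>. norm (uttt \<zeta>)) integrable_on {a..b}"
    and Butt_int: "\<And>q T. q \<in> {1..2} \<Longrightarrow> 0 < T \<Longrightarrow> (\<lambda>\<zeta>. norm (B q (utt \<zeta>))) integrable_on {0..T}"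
    using reg unfolding regular_solution_def by blast+
  have U0: "U 0 = u0" and U_dom: "\<And>q n. q \<in> {1..2} \<Longrightarrow> U n \<in> D q"
    and scheme_eq: "\<And>n. 1 \<le> n \<Longrightarrow> (1/k) *\<^sub>R (U n - U (n - 1)) + (\<Sum>q=1..2. cq_half (\<alpha> q) k (\<lambda>p. B q (U p)) n) =
        (1/2) *\<^sub>R (f (real n * k) + f (real (n - 1) * k))"
    using scheme unfolding solves_scheme_def by blast+
  note ut_cont = ut_continuous[OF u ut utt_int]
  \<comment> \<open>The first step of the scheme uses f(0), but the equation holds for t > 0 only;
    both sides are compared in the limit, where the convolutions vanish.\<close>
  have f0: "f 0 = ut 0"
  proof -
    have "((\<lambda>t. I q t) \<longlongrightarrow> 0) (at_right 0)" if "q \<in> {1..2}" for q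
      unfolding I_def using \<alpha>[OF that] B[OF that] u_dom ut0_dom utt_dom Butt_int conv_int that
      by (intro convolution_tendsto_0[where D = "D q" and ut = ut and utt = utt] u ut ut_cont) auto
    moreover have "(ut \<longlongrightarrow> ut 0) (at_right 0)"
    proof -
      have "(0::real) \<in> {0..}" by simp
      then have "(ut \<longlongrightarrow> ut 0) (at 0 within {0..})"
        using ut_cont unfolding continuous_on_def by blast
      then show ?thesis by (simp add: at_within_Ici_at_right)
    qed
    ultimately have "((\<lambda>t. ut t + (\<Sum>q=1..2. I q t)) \<longlongrightarrow> ut 0 + (\<Sum>q=1..2::nat. 0)) (at_right 0)"
      by (intro tendsto_add tendsto_sum) auto
    moreover have "\<forall>\<^sub>F t in at_right 0. ut t + (\<Sum>q=1..2. I q t) = f t"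
      using equation by (intro eventually_at_rightI[of 0 1]) auto
    ultimately have "(f \<longlongrightarrow> ut 0) (at_right 0)" by (simp add: tendsto_cong)
    moreover have "(f \<longlongrightarrow> f 0) (at_right 0)"
      using f by (simp add: continuous_within at_within_Ici_at_right)
    ultimately show ?thesis using tendsto_unique[OF trivial_limit_at_right_real] by blast
  qed
  have f_eq: "f t = ut t + (\<Sum>q=1..2. I q t)" if "0 \<le> t" for t
    using equation[of t] f0 that by (cases "t = 0") (auto simp: I_def)
  have e0: "e 0 = 0" by (simp add: e_def U0 u0)
  have e_dom: "e n \<in> D q" and Be: "B q (e n) = B q (U n) - B q (u (real n * k))" if q: "q \<in> {1..2}" for q n
  proof -
    have lin: "densely_defined_linear (D q) (B q)" using B[OF q] by (simp add: self_adjoint_op_def)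
    have mem: "U n \<in> D q" "u (real n * k) \<in> D q" using U_dom[OF q] u_dom[OF q] k by auto
    then show "e n \<in> D q"
      using lin unfolding e_def densely_defined_linear_def by (auto intro: subspace_diff)
    have sc: "B q ((-1) *\<^sub>R v) = (-1) *\<^sub>R B q v" if "v \<in> D q" for v
      using lin that unfolding densely_defined_linear_def by blast
    have "(-1) *\<^sub>R u (real n * k) \<in> D q"
      using lin mem unfolding densely_defined_linear_def by (auto intro!: subspace_neg)
    then have "B q (U n + (-1) *\<^sub>R u (real n * k)) = B q (U n) + B q ((-1) *\<^sub>R u (real n * k))"
      using lin mem unfolding densely_defined_linear_def by blast
    then show "B q (e n) = B q (U n) - B q (u (real n * k))"
      using sc[OF mem(2)] by (simp add: e_def)
  qed
  have error_eq: "(1/k) *\<^sub>R (e (Suc n) - e n) + F (Suc n) = r (Suc n)" for n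
  proof -
    have cqe: "cq_half (\<alpha> q) k (\<lambda>p. B q (e p)) (Suc n)
        = cq_half (\<alpha> q) k (\<lambda>p. B q (U p)) (Suc n) - cq_half (\<alpha> q) k (\<lambda>p. B q (u (real p * k))) (Suc n)"
      if "q \<in> {1..2}" for q
      using that by (simp add: cq_half_def Be cq_diff scaleR_diff_right scaleR_add_right)
    have combine: "dU - du + G = A - du + S4" if "G = S1 - S2" "dU + S1 = A + S3" "S4 = S3 - S2"
      for dU du G A S1 S2 S3 S4 :: 'a
    proof -
      have "dU = A + S3 - S1" using that(2) by (simp add: eq_diff_eq)
      then show ?thesis unfolding that(1,3) by simp
    qed
    have "F (Suc n) = (\<Sum>q=1..2. cq_half (\<alpha> q) k (\<lambda>p. B q (U p)) (Suc n)) - (\<Sum>q=1..2. cq_half (\<alpha> q) k (\<lambda>p. B q (u (real p * k))) (Suc n))"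
      unfolding F_def sum_subtractf[symmetric] by (intro sum.cong refl cqe)
    moreover have "(1/k) *\<^sub>R (U (Suc n) - U n) + (\<Sum>q=1..2. cq_half (\<alpha> q) k (\<lambda>p. B q (U p)) (Suc n))
        = (1/2) *\<^sub>R (ut (real (Suc n) * k) + ut (real n * k)) + (\<Sum>q=1..2. (1/2) *\<^sub>R (I q (real (Suc n) * k) + I q (real n * k)))"
      using scheme_eq[of "Suc n"] f_eq[of "real (Suc n) * k"] f_eq[of "real n * k"] k
      by (simp add: scaleR_sum_right[symmetric] sum.distrib scaleR_add_right)
    moreover have "(\<Sum>q=1..2. (1/2) *\<^sub>R (E q (Suc n) + E q n))
        = (\<Sum>q=1..2. (1/2) *\<^sub>R (I q (real (Suc n) * k) + I q (real n * k))) - (\<Sum>q=1..2. cq_half (\<alpha> q) k (\<lambda>p. B q (u (real p * k))) (Suc n))"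
      unfolding sum_subtractf[symmetric] E_def cq_half_def diff_Suc_1
      by (intro sum.cong refl) (simp only: scaleR_diff_right scaleR_add_right, simp)
    ultimately have "(1/k) *\<^sub>R (U (Suc n) - U n) - (1/k) *\<^sub>R (u (real (Suc n) * k) - u (real n * k)) + F (Suc n)
        = (1/2) *\<^sub>R (ut (real (Suc n) * k) + ut (real n * k)) - (1/k) *\<^sub>R (u (real (Suc n) * k) - u (real n * k))
          + (\<Sum>q=1..2. (1/2) *\<^sub>R (E q (Suc n) + E q n))"
      by (rule combine)
    moreover have "e (Suc n) - e n = (U (Suc n) - U n) - (u (real (Suc n) * k) - u (real n * k))"
      by (simp add: e_def)
    ultimately show ?thesis
      unfolding r_def \<tau>_def diff_Suc_1 by (simp only: scaleR_diff_right)
  qed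
  have pos: "0 \<le> (\<Sum>n<N. exp (- c * real (Suc n)) * (F (Suc n) \<bullet> ((1/2) *\<^sub>R (e (Suc n) + e n))))"
  proof -
    have "0 \<le> (\<Sum>q=1..2. \<Sum>n<N. exp (- c * real (Suc n)) * (cq_half (\<alpha> q) k (\<lambda>p. B q (e p)) (Suc n) \<bullet> ((1/2) *\<^sub>R (e (Suc n) + e n))))"
    proof (rule sum_nonneg)
      fix q :: nat assume q: "q \<in> {1..2}"
      show "0 \<le> (\<Sum>n<N. exp (- c * real (Suc n)) * (cq_half (\<alpha> q) k (\<lambda>p. B q (e p)) (Suc n) \<bullet> ((1/2) *\<^sub>R (e (Suc n) + e n))))"
        using \<alpha>[OF q] B[OF q] e_dom[OF q] e0 c by (intro cq_half_positive[where D = "D q"]) auto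
    qed
    also have "\<dots> = (\<Sum>n<N. exp (- c * real (Suc n)) * (F (Suc n) \<bullet> ((1/2) *\<^sub>R (e (Suc n) + e n))))"
      unfolding F_def inner_sum_left sum_distrib_left by (rule sum.swap)
    finally show ?thesis .
  qed
  have s_pos: "0 < s n" and s_dec: "s (Suc n) \<le> s n" for n using c by (auto simp: s_def)
  have K_pos: "0 < K q" if "q \<in> {1..2}" for q using K[OF that] by (simp add: trap_defect_bounded_by_def)
  have Q_nonneg: "0 \<le> Q q n" for q n
    unfolding Q_def quad_term_def
    by (auto intro!: mult_nonneg_nonneg add_nonneg_nonneg integral_nonneg_always)
  have E_le: "s n * norm (E q n) \<le> K q * Q q n" if q: "q \<in> {1..2}" for q n
  proof (cases "n = 0")
    case True
    then show ?thesis by (simp add: Q_def E_def I_def cq_def kappa_def)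
  next
    case False
    have "norm (E q n) \<le> K q * (k\<^sup>2 * (real n * k) powr (\<alpha> q - 1) * norm (B q (ut 0))
        + k powr (\<alpha> q + 1) * integral {real (n - 1) * k..real n * k} (\<lambda>\<zeta>. norm (B q (utt \<zeta>)))
        + k\<^sup>2 * integral {0..real (n - 1) * k} (\<lambda>\<zeta>. (real n * k - \<zeta>) powr (\<alpha> q - 1) * norm (B q (utt \<zeta>))))"
      unfolding E_def I_def
      using \<alpha>[OF q] B[OF q] u_dom[OF q] ut0_dom[OF q] utt_dom[OF q] Butt_int[OF q] conv_int[OF q] K[OF q] k False
      by (intro quadrature_error[where D = "D q" and u = u] u ut ut_cont) (auto simp: trap_defect_bounded_by_def)
    then have "s n * norm (E q n) \<le> s n * (K q * (k\<^sup>2 * (real n * k) powr (\<alpha> q - 1) * norm (B q (ut 0))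
        + k powr (\<alpha> q + 1) * integral {real (n - 1) * k..real n * k} (\<lambda>\<zeta>. norm (B q (utt \<zeta>)))
        + k\<^sup>2 * integral {0..real (n - 1) * k} (\<lambda>\<zeta>. (real n * k - \<zeta>) powr (\<alpha> q - 1) * norm (B q (utt \<zeta>)))))"
      using s_pos[of n] by (intro mult_left_mono) auto
    then show ?thesis using False by (simp only: Q_def quad_term_def s_def if_False mult.left_commute)
  qed
  have \<tau>_le: "s (Suc n) * norm (\<tau> (Suc n)) \<le> T (Suc n)" for n
  proof (cases "n = 0")
    case True
    have "norm (\<tau> 1) \<le> integral {0..k} (\<lambda>s. norm (utt s))"
      using trapezoid_error_first[OF u ut utt_int k] by (simp add: \<tau>_def)
    then show ?thesis using True s_pos[of 1] by (simp add: T_def s_def)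
  next
    case False
    have "norm (\<tau> (Suc n)) \<le> k * integral {real n * k..real (Suc n) * k} (\<lambda>s. norm (uttt s))"
    proof -
      have ab: "0 < real n * k" "real n * k < real (Suc n) * k" "real (Suc n) * k - real n * k = k"
        using False k by (auto simp: algebra_simps)
      show ?thesis
        using trapezoid_error[OF u ut utt_int ab(1,2) utt uttt_int[OF ab(1,2)]] unfolding ab(3) \<tau>_def diff_Suc_1 .
    qed
    then have "s (Suc n) * norm (\<tau> (Suc n)) \<le> s (Suc n) * (k * integral {real n * k..real (Suc n) * k} (\<lambda>s. norm (uttt s)))"
      using s_pos[of "Suc n"] by (intro mult_left_mono) auto
    then show ?thesis using False by (simp add: T_def time_term_def s_def mult.left_commute)
  qed
  \<comment> \<open>The half-level average brings in \<open>E\<close> at two levels. The decreasing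
    weight lets each be estimated at its own level, and after summation the two halves of K
    recombine.\<close>
  have r_le: "s (Suc n) * norm (r (Suc n)) \<le> T (Suc n) + (\<Sum>q=1..2. K q / 2 * (Q q (Suc n) + Q q n))" for n
  proof -
    have "norm (r (Suc n)) \<le> norm (\<tau> (Suc n)) + (\<Sum>q=1..2. (norm (E q (Suc n)) + norm (E q n)) / 2)"
      unfolding r_def diff_Suc_1
      by (intro order_trans[OF norm_triangle_ineq] add_left_mono order_trans[OF norm_sum] sum_mono)
         (simp add: norm_triangle_ineq)
    then have "s (Suc n) * norm (r (Suc n)) \<le> s (Suc n) * (norm (\<tau> (Suc n)) + (\<Sum>q=1..2. (norm (E q (Suc n)) + norm (E q n)) / 2))"
      using s_pos[of "Suc n"] by (intro mult_left_mono) auto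
    also have "\<dots> = s (Suc n) * norm (\<tau> (Suc n)) + (\<Sum>q=1..2. (s (Suc n) * norm (E q (Suc n)) + s (Suc n) * norm (E q n)) / 2)"
      by (simp add: distrib_left sum_distrib_left)
    also have "\<dots> \<le> T (Suc n) + (\<Sum>q=1..2. K q / 2 * (Q q (Suc n) + Q q n))"
    proof (intro add_mono sum_mono \<tau>_le)
      fix q :: nat assume q: "q \<in> {1..2}"
      have "s (Suc n) * norm (E q n) \<le> s n * norm (E q n)" by (intro mult_right_mono s_dec) auto
      then show "(s (Suc n) * norm (E q (Suc n)) + s (Suc n) * norm (E q n)) / 2 \<le> K q / 2 * (Q q (Suc n) + Q q n)"
        using E_le[OF q, of "Suc n"] E_le[OF q, of n] by (simp add: distrib_left)
    qed
    finally show ?thesis .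
  qed
  have Q_sum: "(\<Sum>n<N. Q q (Suc n) + Q q n) \<le> 2 * (\<Sum>\<^sub>\<infinity>n\<in>{1..}. quad_term c (\<alpha> q) k (B q) ut utt n)"
    if q: "q \<in> {1..2}" for q
  proof -
    have eq: "quad_term c (\<alpha> q) k (B q) ut utt n = Q q n" if "n \<in> {1..}" for n using that by (auto simp: Q_def)
    have sm: "Q q summable_on {1..}" using quad_sum[OF q] by (subst summable_on_cong[OF eq, symmetric])
    have "(\<Sum>n<N. Q q n) \<le> (\<Sum>n<Suc N. Q q n)" using Q_nonneg by simp
    also have "\<dots> = (\<Sum>n<N. Q q (Suc n))" by (subst sum.lessThan_Suc_shift) (simp add: Q_def)
    finally have "(\<Sum>n<N. Q q n) \<le> (\<Sum>n<N. Q q (Suc n))" .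
    moreover have "(\<Sum>\<^sub>\<infinity>n\<in>{1..}. quad_term c (\<alpha> q) k (B q) ut utt n) = (\<Sum>\<^sub>\<infinity>n\<in>{1..}. Q q n)"
      by (rule infsum_cong) (rule eq)
    ultimately show ?thesis
      using sum_le_infsum_from_1[OF sm Q_nonneg, of N] by (simp add: sum.distrib)
  qed
  have T_sum: "(\<Sum>n<N. T (Suc n)) \<le> exp (- c/2) * integral {0..k} (\<lambda>\<zeta>. norm (utt \<zeta>))
      + k * (\<Sum>\<^sub>\<infinity>n\<in>{2..}. time_term c k uttt n)"
  proof -
    have nn: "0 \<le> time_term c k uttt n" for n
      unfolding time_term_def by (intro mult_nonneg_nonneg integral_nonneg_always) auto
    have T_nonneg: "0 \<le> T n" for n
      using nn k by (auto simp: T_def intro!: mult_nonneg_nonneg integral_nonneg_always)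
    have "(\<Sum>n<N. T (Suc n)) \<le> (\<Sum>n<Suc N. T (Suc n))" using T_nonneg by simp
    also have "\<dots> = T 1 + (\<Sum>n<N. T (Suc (Suc n)))" by (subst sum.lessThan_Suc_shift) simp
    also have "(\<Sum>n<N. T (Suc (Suc n))) = k * (\<Sum>n\<in>{2..Suc N}. time_term c k uttt n)"
      unfolding sum_distrib_left
      by (rule sum.reindex_bij_witness[of _ "\<lambda>n. n - 2" "\<lambda>n. Suc (Suc n)"]) (auto simp: T_def)
    also have "(\<Sum>n\<in>{2..Suc N}. time_term c k uttt n) \<le> (\<Sum>\<^sub>\<infinity>n\<in>{2..}. time_term c k uttt n)"
      using nn by (intro finite_sum_le_infsum time_sum) auto
    finally show ?thesis using k by (simp add: T_def)
  qed
  have "(\<Sum>n<N. s (Suc n) * norm (r (Suc n)))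
      \<le> (\<Sum>n<N. T (Suc n) + (\<Sum>q=1..2. K q / 2 * (Q q (Suc n) + Q q n)))"
    by (intro sum_mono r_le)
  also have "\<dots> = (\<Sum>n<N. T (Suc n)) + (\<Sum>q=1..2. K q / 2 * (\<Sum>n<N. Q q (Suc n) + Q q n))"
    unfolding sum.distrib[of "\<lambda>n. T (Suc n)"] sum_distrib_left by (subst sum.swap) (rule refl)
  also have "\<dots> \<le> (exp (- c/2) * integral {0..k} (\<lambda>\<zeta>. norm (utt \<zeta>))
      + k * (\<Sum>\<^sub>\<infinity>n\<in>{2..}. time_term c k uttt n))
      + (\<Sum>q=1..2. K q / 2 * (2 * (\<Sum>\<^sub>\<infinity>n\<in>{1..}. quad_term c (\<alpha> q) k (B q) ut utt n)))"
    using less_imp_le[OF K_pos] by (intro add_mono T_sum sum_mono mult_left_mono Q_sum) auto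
  finally have R: "(\<Sum>n<N. s (Suc n) * norm (r (Suc n))) \<le> exp (- c/2) * integral {0..k} (\<lambda>\<zeta>. norm (utt \<zeta>))
      + k * (\<Sum>\<^sub>\<infinity>n\<in>{2..}. time_term c k uttt n)
      + (\<Sum>q=1..2. K q * (\<Sum>\<^sub>\<infinity>n\<in>{1..}. quad_term c (\<alpha> q) k (B q) ut utt n))"
    by simp
  have "sqrt (\<Sum>n\<le>N. weighted_sq c e n) \<le> 2 / (1 - exp (- c)) * k * (\<Sum>n<N. s (Suc n) * norm (r (Suc n)))"
    unfolding s_def by (rule discrete_stability[OF k c e0 error_eq pos])
  also have "\<dots> \<le> 2 / (1 - exp (- c)) * k * (exp (- c/2) * integral {0..k} (\<lambda>\<zeta>. norm (utt \<zeta>))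
      + k * (\<Sum>\<^sub>\<infinity>n\<in>{2..}. time_term c k uttt n)
      + (\<Sum>q=1..2. K q * (\<Sum>\<^sub>\<infinity>n\<in>{1..}. quad_term c (\<alpha> q) k (B q) ut utt n)))"
    using R k c by (intro mult_left_mono) auto
  finally show ?thesis unfolding e_def[abs_def] .
qed

lemma norm_A_le:
  assumes "\<And>N. sqrt (\<Sum>n\<le>N. weighted_sq c v n) \<le> b"
  shows "weighted_sq c v summable_on UNIV" "norm_A c v \<le> b"
proof -
  have nn: "0 \<le> weighted_sq c v n" for n by (simp add: weighted_sq_def)
  have b: "0 \<le> b"
    using order_trans[OF real_sqrt_ge_zero[OF sum_nonneg] assms[of 0]] nn by simp
  have fin: "(\<Sum>n\<in>A. weighted_sq c v n) \<le> b\<^sup>2" if A: "finite A" for A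
  proof -
    obtain N where N: "A \<subseteq> {..N}" using A finite_nat_iff_bounded_le[of A] by blast
    have "(\<Sum>n\<in>A. weighted_sq c v n) \<le> (\<Sum>n\<le>N. weighted_sq c v n)"
      using N nn by (intro sum_mono2) auto
    also have "\<dots> \<le> b\<^sup>2" using assms[of N] by (rule sqrt_le_D)
    finally show ?thesis .
  qed
  show sm: "weighted_sq c v summable_on UNIV"
    using nn fin by (intro nonneg_bdd_above_summable_on) (auto intro!: bdd_aboveI)
  have "infsum (weighted_sq c v) UNIV \<le> b\<^sup>2"
    by (rule infsum_le_finite_sums[OF sm]) (rule fin)
  then show "norm_A c v \<le> b"
    unfolding norm_A_def using b by (rule real_le_lsqrt[rotated])
qed

theorem theorem6p3:
  fixes \<alpha> :: "nat \<Rightarrow> real" and c :: real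
  assumes "\<forall>q\<in>{1..2}. 0 < \<alpha> q \<and> \<alpha> q < 1" and "c > 0"
  shows "\<exists>C>0.
    \<forall>(D :: nat \<Rightarrow> 'a::{real_inner, complete_space} set) B f u0 u ut utt uttt.
      (\<forall>q\<in>{1..2}. self_adjoint_op (D q) (B q) \<and> positive_op (D q) (B q)) \<and>
      continuous (at 0 within {0..}) f \<and>
      solves_equation \<alpha> D B f u0 u ut \<and>
      regular_solution D B u ut utt uttt
      \<longrightarrow>
      (\<forall>k>0. \<forall>U.
        solves_scheme \<alpha> D B f u0 k U \<and>
        time_term c k uttt summable_on {2..} \<and>
        (\<forall>q\<in>{1..2}. quad_term c (\<alpha> q) k (B q) ut utt summable_on {1..})
        \<longrightarrow>
        weighted_sq c (\<lambda>n. U n - u (real n * k)) summable_on UNIV \<and>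
        norm_A c (\<lambda>n. U n - u (real n * k)) \<le>
          C * k * (exp (- c/2) * integral {0..k} (\<lambda>\<zeta>. norm (utt \<zeta>))
            + k * (\<Sum>\<^sub>\<infinity>n\<in>{2..}. time_term c k uttt n)
            + (\<Sum>q=1..2. \<Sum>\<^sub>\<infinity>n\<in>{1..}. quad_term c (\<alpha> q) k (B q) ut utt n)))"
proof -
  have "\<forall>q\<in>{1..2}. \<exists>C. trap_defect_bounded_by (\<alpha> q) C"
    using assms(1) trap_defect_bound unfolding trap_defect_bounded_by_def by metis
  then obtain K where K: "\<And>q. q \<in> {1..2} \<Longrightarrow> trap_defect_bounded_by (\<alpha> q) (K q)" by metis
  then have K_pos: "0 < K q" if "q \<in> {1..2}" for q using that by (simp add: trap_defect_bounded_by_def)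
  \<comment> \<open>At least 1, to dominate the coefficient of the time terms, and at least every
    \<open>K q\<close>.\<close>
  define L where "L = 1 + (\<Sum>q=1..2. K q)"
  have K_le: "K q \<le> L" if "q \<in> {1..2}" for q
    unfolding L_def using member_le_sum[of q "{1..2}" K] that less_imp_le[OF K_pos] by auto
  have L: "1 \<le> L" unfolding L_def using sum_nonneg[of "{1..2}" K] less_imp_le[OF K_pos] by auto
  define C where "C = 2 / (1 - exp (- c)) * L"
  show ?thesis
  proof (intro exI[of _ C] conjI allI impI)
    show "C > 0" using assms(2) L by (simp add: C_def)
  next
    fix D :: "nat \<Rightarrow> 'a set" and B f u0 u ut utt uttt k U
    assume H: "(\<forall>q\<in>{1..2}. self_adjoint_op (D q) (B q) \<and> positive_op (D q) (B q)) \<and>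
      continuous (at 0 within {0..}) f \<and> solves_equation \<alpha> D B f u0 u ut \<and> regular_solution D B u ut utt uttt"
      and k: "0 < (k::real)"
      and H': "solves_scheme \<alpha> D B f u0 k U \<and> time_term c k uttt summable_on {2..} \<and>
        (\<forall>q\<in>{1..2}. quad_term c (\<alpha> q) k (B q) ut utt summable_on {1..})"
    define P where "P = exp (- c/2) * integral {0..k} (\<lambda>\<zeta>. norm (utt \<zeta>)) + k * (\<Sum>\<^sub>\<infinity>n\<in>{2..}. time_term c k uttt n)"
    define Q where "Q q = (\<Sum>\<^sub>\<infinity>n\<in>{1..}. quad_term c (\<alpha> q) k (B q) ut utt n)" for q
    have P: "0 \<le> P"
      unfolding P_def time_term_def using k
      by (intro add_nonneg_nonneg mult_nonneg_nonneg infsum_nonneg integral_nonneg_always) auto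
    have Q: "0 \<le> Q q" for q
      unfolding Q_def quad_term_def
      by (intro infsum_nonneg mult_nonneg_nonneg add_nonneg_nonneg integral_nonneg_always) auto
    have "P + (\<Sum>q=1..2. K q * Q q) \<le> L * P + (\<Sum>q=1..2. L * Q q)"
      using L P Q K_le mult_right_mono[OF L P] by (intro add_mono sum_mono mult_right_mono) auto
    also have "\<dots> = L * (P + (\<Sum>q=1..2. Q q))" by (simp only: distrib_left sum_distrib_left)
    finally have "2 / (1 - exp (- c)) * k * (P + (\<Sum>q=1..2. K q * Q q))
        \<le> 2 / (1 - exp (- c)) * k * (L * (P + (\<Sum>q=1..2. Q q)))"
      using k assms(2) by (intro mult_left_mono) auto
    also have "\<dots> = C * k * (P + (\<Sum>q=1..2. Q q))" by (simp add: C_def)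
    finally have le: "2 / (1 - exp (- c)) * k * (P + (\<Sum>q=1..2. K q * Q q)) \<le> C * k * (P + (\<Sum>q=1..2. Q q))" .
    have "sqrt (\<Sum>n\<le>N. weighted_sq c (\<lambda>n. U n - u (real n * k)) n) \<le> C * k * (P + (\<Sum>q=1..2. Q q))" for N
    proof (rule order_trans[OF _ le])
      show "sqrt (\<Sum>n\<le>N. weighted_sq c (\<lambda>n. U n - u (real n * k)) n)
          \<le> 2 / (1 - exp (- c)) * k * (P + (\<Sum>q=1..2. K q * Q q))"
        unfolding P_def Q_def
        by (rule weighted_error_partial_sum[where \<alpha> = \<alpha> and D = D and B = B and f = f and ?u0.0 = u0 and ut = ut])
           (use assms H k H' K in blast)+
    qed
    from norm_A_le[OF this]
    show "weighted_sq c (\<lambda>n. U n - u (real n * k)) summable_on UNIV"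
      and "norm_A c (\<lambda>n. U n - u (real n * k)) \<le>
          C * k * (exp (- c/2) * integral {0..k} (\<lambda>\<zeta>. norm (utt \<zeta>))
            + k * (\<Sum>\<^sub>\<infinity>n\<in>{2..}. time_term c k uttt n)
            + (\<Sum>q=1..2. \<Sum>\<^sub>\<infinity>n\<in>{1..}. quad_term c (\<alpha> q) k (B q) ut utt n))"
      by (simp_all add: P_def Q_def)
  qed
qed

end
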